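(* Let $\mathfrak g$ be a Lie algebra with a non-degenerate invariant element $t\in(S^2\mathfrak g)^{\mathfrak g}$. If $(H,\rho,\pi)$ is a $\mathfrak g$-quasi-Poisson Lie group with Lie algebra $\mathfrak h$, then $(\mathfrak h,\dot\rho,\delta)$ is a Lie $\mathfrak g$-quasi-bialgebra, where $\dot\rho$ is defined by $$\bigl(\dot\rho(u)X\bigr)^L:=[\rho(u),X^L]\qquad\forall u\in\mathfrak g,\ X\in\mathfrak h,$$ with $X^L$ the left-invariant vector field on $H$ corresponding to $X\in\mathfrak h$, and $$\delta(X)=[X^L,\pi]|_1,$$ i.e. $\delta$ is the linearization of $\pi$ at the unit element $1\in H$.
   Context: Real finite-dimensional setting. Write $t=t^{ij}e_i\otimes e_j$ in a basis $e_i$ of $\mathfrak g$ (summation convention), and $a\wedge b=a\otimes b-b\otimes a$. Let $\phi\in\bigwedge^3\mathfrak g$ be given by $\phi(\alpha,\beta,\gamma)=\frac14\alpha([t^\sharp\beta,t^\sharp\gamma])$ for $\alpha,\beta,\gamma\in\mathfrak g^*$, where $t^\sharp:\mathfrak g^*\to\mathfrak g$ is induced by $t$. A $\mathfrak g$-quasi-Poisson manifold is a smooth manifold $M$ with an action $\rho$ of $\mathfrak g$ (a Lie algebra homomorphism $\rho:\mathfrak g\to\Gamma(TM)$, extended to an algebra morphism $\bigwedge\mathfrak g\to\Gamma(\bigwedge TM)$) and a $\mathfrak g$-invariant bivector field $\pi$ with $[\pi,\pi]/2=\rho(\phi)$, where $[\,,]$ is the Schouten bracket, normalized so that $[X,\cdot]=\mathcal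 L_X$ for vector fields $X$ and $[X_1\wedge X_2,Y_1\wedge Y_2]=\sum_{i,j}(-1)^{i+j}[X_i,Y_j]\wedge X_{\hat i}\wedge Y_{\hat j}$ (with $X_{\hat i}$ the remaining factor). A map is $\mathfrak g$-quasi-Poisson if it is $\mathfrak g$-equivariant and pushes $\pi_1$ forward to $\pi_2$. The fusion product $M_1\circledast M_2$ of two $\mathfrak g$-quasi-Poisson manifolds is $M_1\times M_2$ with the diagonal $\mathfrak g$-action and the bivector field $\pi_1+\pi_2-\frac12t^{ij}\rho_1(e_i)\wedge\rho_2(e_j)$. A $\mathfrak g$-quasi-Poisson Lie group is a Lie group $H$ with a $\mathfrak g$-quasi-Poisson structure $(\rho,\pi)$ such that the multiplication $H\circledast H\to H$ is a $\mathfrak g$-quasi-Poisson map. (In particular $\rho$ acts by infinitesimal automorphisms of $H$ and $\pi|_1=0$.) A Lie $\mathfrak g$-quasi-bialgebra is a triple $(\mathfrak h,\dot\rho,\delta)$ where $\mathfrak h$ is a Lie algebra, $\dot\rho$ is an action of $\mathfrak g$ on $\mathfrak h$ by Lie algebra derivations, and $\delta:\mathfrak h\to\bigwedge^2\mathfrak h$ is a $\mathfrak g$-invariant Lie cobracket (i.e. its transpose $\mathfrak h^*\otimes\mathfrak h^*\to\mathfrak h^*$ is a Lie bracket) such that for all $X,Y\in\mathfrak h$ $$\operatorname{ad}^{(2)}_X\delta(Y)-\operatorname{ad}^{(2)}_Y\delta(X)-\delta([X,Y])-t^{ij}\,\dot\rho(e_i)(X)\wedge\dot\rho(e_j)(Y)=0,\qquad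 \operatorname{ad}^{(2)}_X:=\operatorname{ad}_X\otimes1+1\otimes\operatorname{ad}_X.$$ *)

theory Defs
  imports "HOL-Analysis.Analysis" "HOL-Algebra.Group"
begin

section \<open>Linear algebra\<close>

typedef (overloaded) ('a::real_vector) dual = "{f :: 'a \<Rightarrow> real. linear f}"
  morphisms dual_app Dual
  by (rule exI[of _ "\<lambda>_. 0"]) (simp add: linear_iff)

setup_lifting type_definition_dual

instantiation dual :: (real_vector) real_vector
begin

lift_definition zero_dual :: "'a dual" is "\<lambda>_. 0"
  by (simp add: linear_iff)

lift_definition plus_dual :: "'a dual \<Rightarrow> 'a dual \<Rightarrow> 'a dual" is "\<lambda>f g x. f x + g x"
  by (simp add: linear_compose_add)

lift_definition minus_dual :: "'a dual \<Rightarrow> 'a dual \<Rightarrow> 'a dual" is "\<lambda>f g x. f x - g x"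
  by (simp add: linear_compose_sub)

lift_definition uminus_dual :: "'a dual \<Rightarrow> 'a dual" is "\<lambda>f x. - f x"
  by (simp add: linear_compose_neg)

lift_definition scaleR_dual :: "real \<Rightarrow> 'a dual \<Rightarrow> 'a dual" is "\<lambda>c f x. c * f x"
  by (simp add: linear_iff algebra_simps)

instance
  by standard (transfer; simp add: fun_eq_iff algebra_simps)+

end

text \<open>Elements of \<open>V \<otimes> V\<close> (\<open>V\<close> finite-dimensional) are bilinear forms on the dual of \<open>V\<close>, the
  decomposable tensor \<open>a \<otimes> b\<close> being \<open>(\<alpha>, \<beta>) \<mapsto> \<alpha>(a) \<beta>(b)\<close>.\<close>

type_synonym 'a tensor2 = "'a dual \<Rightarrow> 'a dual \<Rightarrow> real"

definition sym2 :: "('a::real_vector) tensor2 set" where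
  "sym2 = {T. bilinear T \<and> (\<forall>\<alpha> \<beta>. T \<alpha> \<beta> = T \<beta> \<alpha>)}"

definition ext2 :: "('a::real_vector) tensor2 set" where
  "ext2 = {T. bilinear T \<and> (\<forall>\<alpha> \<beta>. T \<alpha> \<beta> = - T \<beta> \<alpha>)}"

definition wedge :: "'a::real_vector \<Rightarrow> 'a \<Rightarrow> 'a tensor2" where
  "wedge a b \<alpha> \<beta> = dual_app \<alpha> a * dual_app \<beta> b - dual_app \<alpha> b * dual_app \<beta> a"

definition pullback :: "('a::real_vector \<Rightarrow> 'b::real_vector) \<Rightarrow> 'b dual \<Rightarrow> 'a dual" where
  "pullback L \<alpha> = Dual (\<lambda>x. dual_app \<alpha> (L x))"

text \<open>The action of \<open>L \<otimes> 1 + 1 \<otimes> L\<close> on \<open>V \<otimes> V\<close>.\<close>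

definition tensor_deriv :: "('a::real_vector \<Rightarrow> 'a) \<Rightarrow> 'a tensor2 \<Rightarrow> 'a tensor2" where
  "tensor_deriv L T \<alpha> \<beta> = T (pullback L \<alpha>) \<beta> + T \<alpha> (pullback L \<beta>)"

definition is_basis :: "'a::real_vector set \<Rightarrow> bool" where
  "is_basis B \<longleftrightarrow> finite B \<and> independent B \<and> span B = UNIV"

text \<open>The element of the basis dual to \<open>B\<close> that belongs to \<open>b \<in> B\<close>.\<close>

definition dual_vec :: "'a::real_vector set \<Rightarrow> 'a \<Rightarrow> 'a dual" where
  "dual_vec B b = Dual (\<lambda>v. representation B v b)"

text \<open>For basis vectors \<open>i = e\<^sub>i\<close> and \<open>j = e\<^sub>j\<close> this is the component of \<open>t\<close> with upper indices \<open>i j\<close>.\<close>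

definition comp2 :: "'a::real_vector set \<Rightarrow> 'a tensor2 \<Rightarrow> 'a \<Rightarrow> 'a \<Rightarrow> real" where
  "comp2 B t i j = t (dual_vec B i) (dual_vec B j)"

definition nondegenerate :: "('a::real_vector) tensor2 \<Rightarrow> bool" where
  "nondegenerate t \<longleftrightarrow> (\<forall>\<alpha>. (\<forall>\<beta>. t \<alpha> \<beta> = 0) \<longrightarrow> \<alpha> = 0)"

definition sharp :: "'a::real_vector set \<Rightarrow> 'a tensor2 \<Rightarrow> 'a dual \<Rightarrow> 'a" where
  "sharp B t \<alpha> = (\<Sum>b\<in>B. t \<alpha> (dual_vec B b) *\<^sub>R b)"


section \<open>Lie algebras\<close>

definition lie_algebra :: "('a::real_vector \<Rightarrow> 'a \<Rightarrow> 'a) \<Rightarrow> bool" where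
  "lie_algebra br \<longleftrightarrow> bilinear br \<and> (\<forall>x. br x x = 0) \<and>
     (\<forall>x y z. br x (br y z) + br y (br z x) + br z (br x y) = 0)"

definition invariant2 :: "('a::real_vector \<Rightarrow> 'a \<Rightarrow> 'a) \<Rightarrow> 'a tensor2 \<Rightarrow> bool" where
  "invariant2 br t \<longleftrightarrow> (\<forall>u \<alpha> \<beta>. tensor_deriv (br u) t \<alpha> \<beta> = 0)"

definition phi3 ::
  "('g::real_vector \<Rightarrow> 'g \<Rightarrow> 'g) \<Rightarrow> 'g set \<Rightarrow> 'g tensor2 \<Rightarrow> 'g dual \<Rightarrow> 'g dual \<Rightarrow> 'g dual \<Rightarrow> real"
  where "phi3 br B t \<alpha> \<beta> \<gamma> = 1 / 4 * dual_app \<alpha> (br (sharp B t \<beta>) (sharp B t \<gamma>))"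

definition lie_action_by_derivations ::
  "('g::real_vector \<Rightarrow> 'g \<Rightarrow> 'g) \<Rightarrow> ('h::real_vector \<Rightarrow> 'h \<Rightarrow> 'h) \<Rightarrow> ('g \<Rightarrow> 'h \<Rightarrow> 'h) \<Rightarrow> bool" where
  "lie_action_by_derivations brg brh r \<longleftrightarrow> bilinear r \<and>
     (\<forall>u v X. r (brg u v) X = r u (r v X) - r v (r u X)) \<and>
     (\<forall>u X Y. r u (brh X Y) = brh (r u X) Y + brh X (r u Y))"

definition transpose_cobracket :: "('h::real_vector \<Rightarrow> 'h tensor2) \<Rightarrow> 'h dual \<Rightarrow> 'h dual \<Rightarrow> 'h dual"
  where "transpose_cobracket \<delta> \<alpha> \<beta> = Dual (\<lambda>X. \<delta> X \<alpha> \<beta>)"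

definition lie_cobracket :: "('h::real_vector \<Rightarrow> 'h tensor2) \<Rightarrow> bool" where
  "lie_cobracket \<delta> \<longleftrightarrow> (\<forall>X. \<delta> X \<in> ext2) \<and> (\<forall>\<alpha> \<beta>. linear (\<lambda>X. \<delta> X \<alpha> \<beta>)) \<and>
     lie_algebra (transpose_cobracket \<delta>)"

definition lie_quasi_bialgebra ::
  "('g::real_vector \<Rightarrow> 'g \<Rightarrow> 'g) \<Rightarrow> 'g set \<Rightarrow> 'g tensor2 \<Rightarrow>
   ('h::real_vector \<Rightarrow> 'h \<Rightarrow> 'h) \<Rightarrow> ('g \<Rightarrow> 'h \<Rightarrow> 'h) \<Rightarrow> ('h \<Rightarrow> 'h tensor2) \<Rightarrow> bool" where
  "lie_quasi_bialgebra brg B t brh r \<delta> \<longleftrightarrow>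
     lie_algebra brh \<and>
     lie_action_by_derivations brg brh r \<and>
     lie_cobracket \<delta> \<and>
     (\<forall>u X \<alpha> \<beta>. \<delta> (r u X) \<alpha> \<beta> = tensor_deriv (r u) (\<delta> X) \<alpha> \<beta>) \<and>
     (\<forall>X Y \<alpha> \<beta>.
        tensor_deriv (brh X) (\<delta> Y) \<alpha> \<beta> - tensor_deriv (brh Y) (\<delta> X) \<alpha> \<beta> - \<delta> (brh X Y) \<alpha> \<beta>
        - (\<Sum>i\<in>B. \<Sum>j\<in>B. comp2 B t i j * wedge (r i X) (r j Y) \<alpha> \<beta>) = 0)"


section \<open>Smooth manifolds\<close>

text \<open>For open \<open>S\<close> in a finite-dimensional space: all iterated directional derivatives of order up to
  \<open>n\<close> exist, and are differentiable below order \<open>n\<close> and continuous at order \<open>n\<close>.\<close>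

primrec higher_diff_on ::
  "'a::real_normed_vector set \<Rightarrow> ('a \<Rightarrow> 'b::real_normed_vector) \<Rightarrow> nat \<Rightarrow> bool" where
  "higher_diff_on S f 0 \<longleftrightarrow> continuous_on S f"
| "higher_diff_on S f (Suc n) \<longleftrightarrow> (\<forall>x\<in>S. f differentiable (at x)) \<and>
     (\<forall>v. higher_diff_on S (\<lambda>x. frechet_derivative f (at x) v) n)"

definition smooth_on ::
  "'a::real_normed_vector set \<Rightarrow> ('a \<Rightarrow> 'b::real_normed_vector) \<Rightarrow> bool" where
  "smooth_on S f \<longleftrightarrow> (\<forall>n. higher_diff_on S f n)"

text \<open>The model space \<open>'e\<close> is any finite-dimensional Euclidean space. The class \<open>euclidean_space\<close> is not
  used because it excludes dimension 0.\<close>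

type_synonym ('m, 'e) atlas = "('m set \<times> ('m \<Rightarrow> 'e)) set"

definition smooth_manifold ::
  "('m::{t2_space,second_countable_topology}, 'e::real_inner) atlas \<Rightarrow> bool" where
  "smooth_manifold A \<longleftrightarrow>
     (\<exists>E::'e set. is_basis E) \<and>
     (\<Union>(U, \<kappa>)\<in>A. U) = UNIV \<and>
     (\<forall>(U, \<kappa>)\<in>A. open U \<and> open (\<kappa> ` U) \<and> homeomorphism U (\<kappa> ` U) \<kappa> (inv_into U \<kappa>)) \<and>
     (\<forall>(U, \<kappa>)\<in>A. \<forall>(V, \<mu>)\<in>A. smooth_on (\<kappa> ` (U \<inter> V)) (\<mu> \<circ> inv_into U \<kappa>))"

definition smooth_fun :: "('m, 'e::real_inner) atlas \<Rightarrow> ('m \<Rightarrow> real) \<Rightarrow> bool" where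
  "smooth_fun A f \<longleftrightarrow> (\<forall>(U, \<kappa>)\<in>A. smooth_on (\<kappa> ` U) (f \<circ> inv_into U \<kappa>))"

definition smooth_map ::
  "('m::topological_space, 'e::real_inner) atlas \<Rightarrow> ('n::topological_space, 'd::real_inner) atlas \<Rightarrow>
   ('m \<Rightarrow> 'n) \<Rightarrow> bool" where
  "smooth_map A A' F \<longleftrightarrow> continuous_on UNIV F \<and>
     (\<forall>(U, \<kappa>)\<in>A. \<forall>(V, \<mu>)\<in>A'. smooth_on (\<kappa> ` (U \<inter> F -` V)) (\<mu> \<circ> F \<circ> inv_into U \<kappa>))"

definition prod_atlas :: "('m, 'e) atlas \<Rightarrow> ('n, 'd) atlas \<Rightarrow> ('m \<times> 'n, 'e \<times> 'd) atlas" where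
  "prod_atlas A A' = {(U \<times> V, map_prod \<kappa> \<mu>) | U \<kappa> V \<mu>. (U, \<kappa>) \<in> A \<and> (V, \<mu>) \<in> A'}"


section \<open>Vector fields and bivector fields\<close>

text \<open>A tangent vector at \<open>p\<close> is the directional derivative, at \<open>p\<close> and in some chart around \<open>p\<close>, along
  some vector \<open>w\<close> of the model space; it acts on smooth functions and is set to 0 on all other functions,
  so that equality of tangent vectors (and of fields) is equality of HOL functions. A bivector at \<open>p\<close> is a
  finite sum of \<open>X \<and> Y = X \<otimes> Y - Y \<otimes> X\<close>, where \<open>X \<otimes> Y\<close> acts by \<open>(f, g) \<mapsto> X(f) Y(g)\<close>.\<close>

definition tangent_space ::
  "('m, 'e::real_inner) atlas \<Rightarrow> 'm \<Rightarrow> (('m \<Rightarrow> real) \<Rightarrow> real) set" where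
  "tangent_space A p =
     {X. \<exists>(U, \<kappa>)\<in>A. p \<in> U \<and> (\<exists>w. X = (\<lambda>f. if smooth_fun A f
        then frechet_derivative (f \<circ> inv_into U \<kappa>) (at (\<kappa> p)) w else 0))}"

definition bivectors_at ::
  "('m, 'e::real_inner) atlas \<Rightarrow> 'm \<Rightarrow> (('m \<Rightarrow> real) \<Rightarrow> ('m \<Rightarrow> real) \<Rightarrow> real) set" where
  "bivectors_at A p =
     {b. \<exists>(n::nat) X Y. (\<forall>k<n. X k \<in> tangent_space A p \<and> Y k \<in> tangent_space A p) \<and>
         b = (\<lambda>f g. \<Sum>k<n. X k f * Y k g - Y k f * X k g)}"

type_synonym 'm vfield = "('m \<Rightarrow> real) \<Rightarrow> 'm \<Rightarrow> real"
type_synonym 'm bivfield = "('m \<Rightarrow> real) \<Rightarrow> ('m \<Rightarrow> real) \<Rightarrow> 'm \<Rightarrow> real"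

definition vector_field :: "('m, 'e::real_inner) atlas \<Rightarrow> 'm vfield \<Rightarrow> bool" where
  "vector_field A X \<longleftrightarrow> (\<forall>p. (\<lambda>f. X f p) \<in> tangent_space A p) \<and>
     (\<forall>f. smooth_fun A f \<longrightarrow> smooth_fun A (X f))"

definition bivector_field :: "('m, 'e::real_inner) atlas \<Rightarrow> 'm bivfield \<Rightarrow> bool" where
  "bivector_field A P \<longleftrightarrow> (\<forall>p. (\<lambda>f g. P f g p) \<in> bivectors_at A p) \<and>
     (\<forall>f g. smooth_fun A f \<longrightarrow> smooth_fun A g \<longrightarrow> smooth_fun A (P f g))"

definition wedge_fields :: "'m vfield \<Rightarrow> 'm vfield \<Rightarrow> 'm bivfield" where
  "wedge_fields X Y f g p = X f p * Y g p - Y f p * X g p"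

definition commutator :: "'m vfield \<Rightarrow> 'm vfield \<Rightarrow> 'm vfield" where
  "commutator X Y f p = X (Y f) p - Y (X f) p"

text \<open>The Schouten bracket \<open>[X, P] = L\<^sub>X P\<close> of a vector field and a bivector field.\<close>

definition lie_deriv :: "'m vfield \<Rightarrow> 'm bivfield \<Rightarrow> 'm bivfield" where
  "lie_deriv X P f g p = X (P f g) p - P (X f) g p - P f (X g) p"

text \<open>The Schouten bracket of two bivector fields; its sign and normalization are fixed by
  \<open>schouten_wedge_fields\<close> below.\<close>

definition schouten ::
  "'m bivfield \<Rightarrow> 'm bivfield \<Rightarrow> ('m \<Rightarrow> real) \<Rightarrow> ('m \<Rightarrow> real) \<Rightarrow> ('m \<Rightarrow> real) \<Rightarrow> 'm \<Rightarrow> real" where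
  "schouten P Q f g h p =
     P f (Q g h) p + P g (Q h f) p + P h (Q f g) p +
     Q f (P g h) p + Q g (P h f) p + Q h (P f g) p"

definition wedge3_fields ::
  "'m vfield \<Rightarrow> 'm vfield \<Rightarrow> 'm vfield \<Rightarrow>
   ('m \<Rightarrow> real) \<Rightarrow> ('m \<Rightarrow> real) \<Rightarrow> ('m \<Rightarrow> real) \<Rightarrow> 'm \<Rightarrow> real" where
  "wedge3_fields X Y Z f g h p =
     X f p * Y g p * Z h p + Y f p * Z g p * X h p + Z f p * X g p * Y h p
     - X f p * Z g p * Y h p - Y f p * X g p * Z h p - Z f p * Y g p * X h p"

lemma schouten_wedge_fields:
  fixes X Y :: "nat \<Rightarrow> 'm vfield" and S :: "('m \<Rightarrow> real) set"
  assumes S: "\<And>V f. V \<in> X ` {1,2} \<union> Y ` {1,2} \<Longrightarrow> f \<in> S \<Longrightarrow> V f \<in> S"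
      "\<And>f g. f \<in> S \<Longrightarrow> g \<in> S \<Longrightarrow> (\<lambda>p. f p * g p) \<in> S"
    and diff: "\<And>V f g p. V \<in> X ` {1,2} \<union> Y ` {1,2} \<Longrightarrow> f \<in> S \<Longrightarrow> g \<in> S \<Longrightarrow>
        V (\<lambda>p. f p - g p) p = V f p - V g p"
    and leibniz: "\<And>V f g p. V \<in> X ` {1,2} \<union> Y ` {1,2} \<Longrightarrow> f \<in> S \<Longrightarrow> g \<in> S \<Longrightarrow>
        V (\<lambda>p. f p * g p) p = V f p * g p + f p * V g p"
    and fgh: "f \<in> S" "g \<in> S" "h \<in> S"
  shows "schouten (wedge_fields (X 1) (X 2)) (wedge_fields (Y 1) (Y 2)) f g h p =
     (\<Sum>i\<in>{1,2}. \<Sum>j\<in>{1,2}. (-1) ^ (i + j) *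
        wedge3_fields (commutator (X i) (Y j)) (X (3 - i)) (Y (3 - j)) f g h p)"
proof -
  have w: "wedge_fields V W a b = (\<lambda>p. V a p * W b p - W a p * V b p)" for V W :: "'m vfield" and a b
    by (rule ext) (simp add: wedge_fields_def)
  have ev: "Z (\<lambda>p. V a p * W b p - W a p * V b p) p =
      Z (V a) p * W b p + V a p * Z (W b) p - (Z (W a) p * V b p + W a p * Z (V b) p)"
    if "Z \<in> X ` {1,2} \<union> Y ` {1,2}" "V \<in> X ` {1,2} \<union> Y ` {1,2}" "W \<in> X ` {1,2} \<union> Y ` {1,2}"
      "a \<in> S" "b \<in> S" for Z V W a b p
  proof -
    have S': "V a \<in> S" "W b \<in> S" "W a \<in> S" "V b \<in> S"
      using that S(1) by blast+
    have "Z (\<lambda>p. V a p * W b p - W a p * V b p) p = Z (\<lambda>p. V a p * W b p) p - Z (\<lambda>p. W a p * V b p) p"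
      by (rule diff[OF that(1)]) (intro S(2) S')+
    then show ?thesis
      by (simp only: leibniz[OF that(1)] S')
  qed
  show ?thesis
    unfolding schouten_def w
    by (simp add: ev fgh wedge3_fields_def commutator_def) (simp add: algebra_simps)
qed


section \<open>Quasi-Poisson manifolds\<close>

text \<open>The image of a tensor \<open>\<phi> \<in> \<Lambda>\<^sup>3 \<gg> \<subseteq> \<gg> \<otimes> \<gg> \<otimes> \<gg>\<close> under \<open>\<rho>\<close>, as a sum over the components of \<open>\<phi>\<close>.\<close>

definition push3 ::
  "'g::real_vector set \<Rightarrow> ('g \<Rightarrow> 'm vfield) \<Rightarrow> ('g dual \<Rightarrow> 'g dual \<Rightarrow> 'g dual \<Rightarrow> real) \<Rightarrow>
   ('m \<Rightarrow> real) \<Rightarrow> ('m \<Rightarrow> real) \<Rightarrow> ('m \<Rightarrow> real) \<Rightarrow> 'm \<Rightarrow> real" where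
  "push3 B \<rho> \<phi> f g h p = (\<Sum>i\<in>B. \<Sum>j\<in>B. \<Sum>k\<in>B.
     \<phi> (dual_vec B i) (dual_vec B j) (dual_vec B k) * \<rho> i f p * \<rho> j g p * \<rho> k h p)"

definition lie_action_on_manifold ::
  "('g::real_vector \<Rightarrow> 'g \<Rightarrow> 'g) \<Rightarrow> ('m, 'e::real_inner) atlas \<Rightarrow> ('g \<Rightarrow> 'm vfield) \<Rightarrow> bool" where
  "lie_action_on_manifold brg A \<rho> \<longleftrightarrow> (\<forall>u. vector_field A (\<rho> u)) \<and>
     (\<forall>f p. linear (\<lambda>u. \<rho> u f p)) \<and>
     (\<forall>u v. \<rho> (brg u v) = commutator (\<rho> u) (\<rho> v))"

definition quasi_poisson_manifold ::
  "('g::real_vector \<Rightarrow> 'g \<Rightarrow> 'g) \<Rightarrow> 'g set \<Rightarrow> 'g tensor2 \<Rightarrow>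
   ('m::{t2_space,second_countable_topology}, 'e::real_inner) atlas \<Rightarrow>
   ('g \<Rightarrow> 'm vfield) \<Rightarrow> 'm bivfield \<Rightarrow> bool" where
  "quasi_poisson_manifold brg B t A \<rho> P \<longleftrightarrow>
     smooth_manifold A \<and> lie_action_on_manifold brg A \<rho> \<and> bivector_field A P \<and>
     (\<forall>u f g p. lie_deriv (\<rho> u) P f g p = 0) \<and>
     (\<forall>f g h p. schouten P P f g h p / 2 = push3 B \<rho> (phi3 brg B t) f g h p)"

definition lift_fst ::
  "('m, 'e::real_inner) atlas \<Rightarrow> ('n, 'd::real_inner) atlas \<Rightarrow> 'm vfield \<Rightarrow> ('m \<times> 'n) vfield" where
  "lift_fst A A' X F = (\<lambda>(x, y).
     if smooth_fun (prod_atlas A A') F then X (\<lambda>x'. F (x', y)) x else 0)"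

definition lift_snd ::
  "('m, 'e::real_inner) atlas \<Rightarrow> ('n, 'd::real_inner) atlas \<Rightarrow> 'n vfield \<Rightarrow> ('m \<times> 'n) vfield" where
  "lift_snd A A' Y F = (\<lambda>(x, y).
     if smooth_fun (prod_atlas A A') F then Y (\<lambda>y'. F (x, y')) y else 0)"

definition lift_fst2 ::
  "('m, 'e::real_inner) atlas \<Rightarrow> ('n, 'd::real_inner) atlas \<Rightarrow> 'm bivfield \<Rightarrow> ('m \<times> 'n) bivfield" where
  "lift_fst2 A A' P F G = (\<lambda>(x, y).
     if smooth_fun (prod_atlas A A') F \<and> smooth_fun (prod_atlas A A') G
     then P (\<lambda>x'. F (x', y)) (\<lambda>x'. G (x', y)) x else 0)"

definition lift_snd2 ::
  "('m, 'e::real_inner) atlas \<Rightarrow> ('n, 'd::real_inner) atlas \<Rightarrow> 'n bivfield \<Rightarrow> ('m \<times> 'n) bivfield" where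
  "lift_snd2 A A' Q F G = (\<lambda>(x, y).
     if smooth_fun (prod_atlas A A') F \<and> smooth_fun (prod_atlas A A') G
     then Q (\<lambda>y'. F (x, y')) (\<lambda>y'. G (x, y')) y else 0)"

definition fusion_action ::
  "('m, 'e::real_inner) atlas \<Rightarrow> ('n, 'd::real_inner) atlas \<Rightarrow>
   ('g \<Rightarrow> 'm vfield) \<Rightarrow> ('g \<Rightarrow> 'n vfield) \<Rightarrow> 'g \<Rightarrow> ('m \<times> 'n) vfield" where
  "fusion_action A A' \<rho>1 \<rho>2 u F p = lift_fst A A' (\<rho>1 u) F p + lift_snd A A' (\<rho>2 u) F p"

definition fusion_bivector ::
  "'g::real_vector set \<Rightarrow> 'g tensor2 \<Rightarrow>
   ('m, 'e::real_inner) atlas \<Rightarrow> ('n, 'd::real_inner) atlas \<Rightarrow>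
   ('g \<Rightarrow> 'm vfield) \<Rightarrow> ('g \<Rightarrow> 'n vfield) \<Rightarrow> 'm bivfield \<Rightarrow> 'n bivfield \<Rightarrow> ('m \<times> 'n) bivfield" where
  "fusion_bivector B t A A' \<rho>1 \<rho>2 P1 P2 F G p =
     lift_fst2 A A' P1 F G p + lift_snd2 A A' P2 F G p
     - 1 / 2 * (\<Sum>i\<in>B. \<Sum>j\<in>B. comp2 B t i j *
         wedge_fields (lift_fst A A' (\<rho>1 i)) (lift_snd A A' (\<rho>2 j)) F G p)"

definition quasi_poisson_map ::
  "('m::topological_space, 'e::real_inner) atlas \<Rightarrow> ('g \<Rightarrow> 'm vfield) \<Rightarrow> 'm bivfield \<Rightarrow>
   ('n::topological_space, 'd::real_inner) atlas \<Rightarrow> ('g \<Rightarrow> 'n vfield) \<Rightarrow> 'n bivfield \<Rightarrow>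
   ('m \<Rightarrow> 'n) \<Rightarrow> bool" where
  "quasi_poisson_map A \<rho>1 P1 A' \<rho>2 P2 F \<longleftrightarrow> smooth_map A A' F \<and>
     (\<forall>u f p. smooth_fun A' f \<longrightarrow> \<rho>1 u (f \<circ> F) p = \<rho>2 u f (F p)) \<and>
     (\<forall>f g p. smooth_fun A' f \<longrightarrow> smooth_fun A' g \<longrightarrow> P1 (f \<circ> F) (g \<circ> F) p = P2 f g (F p))"


section \<open>Lie groups\<close>

definition lie_group ::
  "('m::{t2_space,second_countable_topology}) monoid \<Rightarrow> ('m, 'e::real_inner) atlas \<Rightarrow> bool" where
  "lie_group H A \<longleftrightarrow> group H \<and> carrier H = UNIV \<and> smooth_manifold A \<and>
     smooth_map (prod_atlas A A) A (\<lambda>(x, y). x \<otimes>\<^bsub>H\<^esub> y) \<and>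
     smooth_map A A (\<lambda>x. inv\<^bsub>H\<^esub> x)"

definition left_invariant :: "'m monoid \<Rightarrow> ('m, 'e::real_inner) atlas \<Rightarrow> 'm vfield \<Rightarrow> bool" where
  "left_invariant H A X \<longleftrightarrow>
     (\<forall>a f p. smooth_fun A f \<longrightarrow> X (\<lambda>x. f (a \<otimes>\<^bsub>H\<^esub> x)) p = X f (a \<otimes>\<^bsub>H\<^esub> p))"

text \<open>\<open>'h\<close> with the bracket \<open>brh\<close> is the Lie algebra of \<open>H\<close>, via the isomorphism \<open>X \<mapsto> X\<^sup>L = lft X\<close> onto the
  Lie algebra of left-invariant vector fields.\<close>

definition lie_algebra_of_group ::
  "'m monoid \<Rightarrow> ('m, 'e::real_inner) atlas \<Rightarrow>
   ('h::real_vector \<Rightarrow> 'h \<Rightarrow> 'h) \<Rightarrow> ('h \<Rightarrow> 'm vfield) \<Rightarrow> bool" where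
  "lie_algebra_of_group H A brh lft \<longleftrightarrow>
     lie_algebra brh \<and>
     (\<forall>f p. linear (\<lambda>X. lft X f p)) \<and>
     bij_betw lft UNIV {V. vector_field A V \<and> left_invariant H A V} \<and>
     (\<forall>X Y. lft (brh X Y) = commutator (lft X) (lft Y))"

definition quasi_poisson_lie_group ::
  "('g::real_vector \<Rightarrow> 'g \<Rightarrow> 'g) \<Rightarrow> 'g set \<Rightarrow> 'g tensor2 \<Rightarrow>
   ('m::{t2_space,second_countable_topology}) monoid \<Rightarrow> ('m, 'e::real_inner) atlas \<Rightarrow>
   ('g \<Rightarrow> 'm vfield) \<Rightarrow> 'm bivfield \<Rightarrow> bool" where
  "quasi_poisson_lie_group brg B t H A \<rho> P \<longleftrightarrow>
     lie_group H A \<and>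
     quasi_poisson_manifold brg B t A \<rho> P \<and>
     quasi_poisson_map
       (prod_atlas A A) (fusion_action A A \<rho> \<rho>) (fusion_bivector B t A A \<rho> \<rho> P P)
       A \<rho> P
       (\<lambda>(x, y). x \<otimes>\<^bsub>H\<^esub> y)"

text \<open>The differential at \<open>1\<close> of a smooth function on \<open>H\<close>, as an element of the dual of \<open>\<hh> = T\<^sub>1 H\<close>.\<close>

definition diff_at_one :: "'m monoid \<Rightarrow> ('h::real_vector \<Rightarrow> 'm vfield) \<Rightarrow> ('m \<Rightarrow> real) \<Rightarrow> 'h dual" where
  "diff_at_one H lft f = Dual (\<lambda>X. lft X f \<one>\<^bsub>H\<^esub>)"

definition rho_dot ::
  "('h::real_vector \<Rightarrow> 'm vfield) \<Rightarrow> ('g \<Rightarrow> 'm vfield) \<Rightarrow> 'g \<Rightarrow> 'h \<Rightarrow> 'h" where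
  "rho_dot lft \<rho> u X = (THE Y. lft Y = commutator (\<rho> u) (lft X))"

text \<open>The value at \<open>1\<close> of \<open>[X\<^sup>L, P]\<close>, as an element of \<open>\<Lambda>\<^sup>2 \<hh> = \<Lambda>\<^sup>2 T\<^sub>1 H\<close>.\<close>

definition delta_of ::
  "'m monoid \<Rightarrow> ('m, 'e::real_inner) atlas \<Rightarrow> ('h::real_vector \<Rightarrow> 'm vfield) \<Rightarrow>
   'm bivfield \<Rightarrow> 'h \<Rightarrow> 'h tensor2" where
  "delta_of H A lft P X \<alpha> \<beta> = (THE r. \<forall>f g. smooth_fun A f \<longrightarrow> smooth_fun A g \<longrightarrow>
     diff_at_one H lft f = \<alpha> \<longrightarrow> diff_at_one H lft g = \<beta> \<longrightarrow>
     r = lie_deriv (lft X) P f g \<one>\<^bsub>H\<^esub>)"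

end

(*
Since the multiplication is a quasi-Poisson map, rho and pi vanish at the unit and satisfy
  rho(u)(ab) = (R_b) rho(u)(a) + (L_a) rho(u)(b),
  pi(ab) = (R_b) pi(a) + (L_a) pi(b) - 1/2 t^{ij} (R_b) rho(e_i)(a) ^ (L_a) rho(e_j)(b).
Because of the vanishing, f |-> X(rho(u) f)(1) and (f,g) |-> X(pi(f,g))(1) depend only on the
differentials at 1. The first identity makes [rho(u), X^L] left-invariant, and
[df, dg] = d(pi(f,g)) is the transpose of delta, so its Jacobiator is d([pi,pi]/2)(1), where
[pi,pi]/2 = rho(phi) is cubic in quantities that vanish at 1. Differentiating the second identity
in b along Y and then in a along X at (1,1) gives a formula for X(Y pi(f,g))(1); its
antisymmetrisation in X and Y is the cocycle condition, each of the two fusion terms contributing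
one half of t^{ij} rho(e_i)X ^ rho(e_j)Y.
*)
theory Submission
  imports Defs
begin

section \<open>Smooth functions on open sets\<close>

text \<open>Tangent vectors are tested on globally smooth functions only, and the coefficients of
  \<rho>(u) or \<pi> in a left-invariant frame come pointwise, with no known dependence on the
  point. So the claim that X(\<rho>(u) f)(1) sees only df is not obtained from smooth coefficients
  but from an estimate: near 1 the frame, applied to functions dual to it at 1, is a matrix close to
  the identity, and this bounds the coefficients by quantities that vanish at 1. The claim carries
  more than the definition of \<delta>. A composite of two fields is of second order, and it is this
  claim that makes [\<rho>(u), X^L] a tangent vector at the unit, and then, by left invariance,
  everywhere. In the cocycle computation the covectors pulled back by ad_X bring in X(W f)(1), which
  depends on more than df. Expanding \<delta> in a basis isolates these second derivatives, so that
  they can be matched with those in X(Y \<pi>(f,g))(1).\<close>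

lemma higher_diff_on_cong:
  assumes "open S" "\<And>x. x \<in> S \<Longrightarrow> f x = g x" "higher_diff_on S f n"
  shows "higher_diff_on S g n"
  using assms(2,3)
proof (induction n arbitrary: f g)
  case 0
  then show ?case by (auto cong: continuous_on_cong)
next
  case (Suc n)
  have d: "g differentiable at x" if "x \<in> S" for x
    using Suc.prems that assms(1) unfolding differentiable_def
    by (metis differentiable_def has_derivative_transform_within_open higher_diff_on.simps(2))
  have e: "frechet_derivative f (at x) v = frechet_derivative g (at x) v" if "x \<in> S" for x v
    using frechet_derivative_transform_within_open[of f x S g] Suc.prems that assms(1) by auto
  show ?case
    using Suc.prems(2) d Suc.IH[OF e] by auto
qed

lemma higher_diff_on_Suc: "higher_diff_on S f (Suc n) \<Longrightarrow> higher_diff_on S f n"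
proof (induction n arbitrary: f)
  case 0
  then show ?case
    by (auto intro!: continuous_at_imp_continuous_on differentiable_imp_continuous_within)
next
  case (Suc n)
  then show ?case by (metis higher_diff_on.simps(2))
qed

lemma higher_diff_on_local:
  assumes "\<And>x. x \<in> S \<Longrightarrow> \<exists>T. open T \<and> x \<in> T \<and> higher_diff_on T f n"
  shows "higher_diff_on S f n"
  using assms
proof (induction n arbitrary: f)
  case 0
  have "isCont f x" if "x \<in> S" for x
    using 0[OF that] continuous_on_eq_continuous_at by auto
  then show ?case by (simp add: continuous_at_imp_continuous_on)
next
  case (Suc n)
  have "f differentiable at x" if "x \<in> S" for x
    using Suc.prems[OF that] by auto
  moreover have "higher_diff_on S (\<lambda>x. frechet_derivative f (at x) v) n" for v
    by (rule Suc.IH) (use Suc.prems in fastforce)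
  ultimately show ?case by simp
qed

lemma frechet_derivativeI: "(f has_derivative f') (at x) \<Longrightarrow> frechet_derivative f (at x) v = f' v"
  using frechet_derivative_at by metis

lemma frechet_derivative_at_works:
  "f differentiable (at x) \<Longrightarrow> (f has_derivative (\<lambda>v. frechet_derivative f (at x) v)) (at x)"
  using frechet_derivative_works by metis

text \<open>\<open>higher_diff_on\<close> recurses on \<open>frechet_derivative\<close>, a choice
  term. Any explicit derivative \<open>f'\<close> may stand in for it, because the two agree on the
  open set \<open>S\<close>; the induction steps for sums, linear images, products and compositions
  enter this way.\<close>

lemma higher_diff_on_SucI:
  assumes "open S" "\<And>x. x \<in> S \<Longrightarrow> (f has_derivative f' x) (at x)"
    and "\<And>v. higher_diff_on S (\<lambda>x. f' x v) n"
  shows "higher_diff_on S f (Suc n)"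
proof -
  have "higher_diff_on S (\<lambda>x. frechet_derivative f (at x) v) n" for v
    by (rule higher_diff_on_cong[OF assms(1) _ assms(3)[of v]]) (simp add: frechet_derivativeI[OF assms(2)])
  then show ?thesis using assms(2) by (auto simp: differentiable_def)
qed

section \<open>Calculus rules for iterated differentiability\<close>

lemma higher_diff_on_const: "higher_diff_on S (\<lambda>x. c) n"
  by (induction n arbitrary: c) auto

lemma higher_diff_on_add:
  assumes "open S"
  shows "higher_diff_on S f n \<Longrightarrow> higher_diff_on S g n \<Longrightarrow> higher_diff_on S (\<lambda>x. f x + g x) n"
proof (induction n arbitrary: f g)
  case 0
  then show ?case by (auto intro: continuous_intros)
next
  case (Suc n)
  show ?case
  proof (rule higher_diff_on_SucI[OF assms])
    show "((\<lambda>x. f x + g x) has_derivative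
        (\<lambda>v. frechet_derivative f (at x) v + frechet_derivative g (at x) v)) (at x)" if "x \<in> S" for x
      using Suc.prems that by (auto intro!: has_derivative_add frechet_derivative_at_works)
  qed (use Suc in auto)
qed

lemma higher_diff_on_linear:
  assumes "open S" "bounded_linear L"
  shows "higher_diff_on S f n \<Longrightarrow> higher_diff_on S (\<lambda>x. L (f x)) n"
proof (induction n arbitrary: f)
  case 0
  then show ?case
    using continuous_on_compose2[OF linear_continuous_on[OF assms(2), of UNIV]] by auto
next
  case (Suc n)
  have h: "((\<lambda>x. L (f x)) has_derivative (\<lambda>v. L (frechet_derivative f (at x) v))) (at x)" if "x \<in> S" for x
    using Suc.prems that by (auto intro!: bounded_linear.has_derivative[OF assms(2)] frechet_derivative_at_works)
  show ?case
    by (rule higher_diff_on_SucI[OF assms(1) h]) (use Suc in auto)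
qed

lemma higher_diff_on_mult:
  fixes f g :: "'a::real_normed_vector \<Rightarrow> real"
  assumes "open S"
  shows "higher_diff_on S f n \<Longrightarrow> higher_diff_on S g n \<Longrightarrow> higher_diff_on S (\<lambda>x. f x * g x) n"
proof (induction n arbitrary: f g)
  case 0
  then show ?case by (auto intro: continuous_intros)
next
  case (Suc n)
  have h: "((\<lambda>x. f x * g x) has_derivative
      (\<lambda>v. f x * frechet_derivative g (at x) v + frechet_derivative f (at x) v * g x)) (at x)" if "x \<in> S" for x
    using Suc.prems that by (auto intro!: has_derivative_mult frechet_derivative_at_works)
  have "higher_diff_on S (\<lambda>x. f x * frechet_derivative g (at x) v + frechet_derivative f (at x) v * g x) n" for v
    using Suc.prems higher_diff_on_Suc[OF Suc.prems(1)] higher_diff_on_Suc[OF Suc.prems(2)]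
    by (intro higher_diff_on_add[OF assms] Suc.IH) auto
  with h show ?case by (intro higher_diff_on_SucI[OF assms]) blast+
qed

lemma higher_diff_on_sum:
  assumes "open S" "\<And>i. i \<in> I \<Longrightarrow> higher_diff_on S (f i) n"
  shows "higher_diff_on S (\<lambda>x. \<Sum>i\<in>I. f i x) n"
  using assms(2)
  by (induction I rule: infinite_finite_induct) (auto intro!: higher_diff_on_const higher_diff_on_add[OF assms(1)])

text \<open>Along \<open>v\<close> the derivative is that of \<open>f\<close> along the constant
  direction \<open>L v\<close>, again at the affine argument, so the induction closes without
  coordinates. Slices of functions on a product are of this kind.\<close>

lemma higher_diff_on_affine:
  fixes f :: "'b::real_normed_vector \<Rightarrow> 'c::real_normed_vector"
    and L :: "'a::real_normed_vector \<Rightarrow> 'b"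
  assumes "bounded_linear L" "open S" "open T"
    and "\<And>x. x \<in> T \<Longrightarrow> c + L x \<in> S"
  shows "higher_diff_on S f n \<Longrightarrow> higher_diff_on T (\<lambda>x. f (c + L x)) n"
proof (induction n arbitrary: f)
  case 0
  have "continuous_on T (\<lambda>x. c + L x)"
    using linear_continuous_on[OF assms(1)] by (intro continuous_intros)
  then show ?case
    using 0 assms(4) by (auto intro!: continuous_on_compose2[of S f])
next
  case (Suc n)
  have h: "((\<lambda>x. f (c + L x)) has_derivative (\<lambda>v. frechet_derivative f (at (c + L x)) (L v))) (at x)"
    if "x \<in> T" for x
  proof -
    have "((\<lambda>x. c + L x) has_derivative L) (at x)"
      using bounded_linear_imp_has_derivative[OF assms(1)] by (auto intro!: derivative_eq_intros)
    moreover have "(f has_derivative frechet_derivative f (at (c + L x))) (at (c + L x))"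
      using Suc.prems that assms(4) by (auto intro!: frechet_derivative_at_works)
    ultimately show ?thesis
      using diff_chain_at[of "\<lambda>x. c + L x" L x f] by (simp add: o_def)
  qed
  have "higher_diff_on T (\<lambda>x. frechet_derivative f (at (c + L x)) (L v)) n" for v
    using Suc.prems by (intro Suc.IH[of "\<lambda>y. frechet_derivative f (at y) (L v)"]) auto
  with h show ?case by (intro higher_diff_on_SucI[OF assms(3)]) blast+
qed

text \<open>The model space is an inner product space with a finite basis, possibly of dimension 0.
  Orthonormalising gives coordinates \<open>x \<bullet> b\<close>, which resolve a vector that
  varies with a point into fixed directions.\<close>

lemma finite_dim_orthonormal_basis:
  fixes E :: "'e::real_inner set"
  assumes "is_basis E"
  obtains C :: "'e set" where "finite C" "\<And>x. (\<Sum>b\<in>C. (x \<bullet> b) *\<^sub>R b) = x"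
proof -
  obtain D where D: "finite D" "span D = span E" "pairwise orthogonal D"
    using basis_orthogonal[of E] assms unfolding is_basis_def by blast
  \<comment> \<open>The orthogonal family may contain 0, which cannot be normalised.\<close>
  define C where "C = (\<lambda>x. x /\<^sub>R norm x) ` (D - {0})"
  have fin: "finite C" by (simp add: C_def D)
  have nrm: "b \<bullet> b = 1" if "b \<in> C" for b
  proof -
    obtain x where x: "x \<in> D" "x \<noteq> 0" "b = x /\<^sub>R norm x" using \<open>b \<in> C\<close> by (auto simp: C_def)
    then have "norm b = 1" by simp
    then show ?thesis by (simp add: dot_square_norm)
  qed
  have orth: "b \<bullet> c = 0" if "b \<in> C" "c \<in> C" "b \<noteq> c" for b c
  proof -
    obtain x y where x: "x \<in> D" "b = x /\<^sub>R norm x" "y \<in> D" "c = y /\<^sub>R norm y"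
      using \<open>b \<in> C\<close> \<open>c \<in> C\<close> by (auto simp: C_def)
    then have "x \<bullet> y = 0" using D(3) that(3) by (metis pairwise_def orthogonal_def)
    then show ?thesis using x by simp
  qed
  have "D \<subseteq> span C"
  proof
    fix x assume "x \<in> D"
    show "x \<in> span C"
    proof (cases "x = 0")
      case False
      then have "x /\<^sub>R norm x \<in> span C" using \<open>x \<in> D\<close> by (auto simp: C_def intro: span_base)
      then have "norm x *\<^sub>R (x /\<^sub>R norm x) \<in> span C" by (rule span_scale)
      then show ?thesis using False by simp
    qed (simp add: span_zero)
  qed
  then have sp: "span C = UNIV"
    using D(2) assms unfolding is_basis_def by (metis span_mono span_span top.extremum_uniqueI)
  have "(\<Sum>b\<in>C. (x \<bullet> b) *\<^sub>R b) = x" for x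
  proof -
    obtain u where u: "x = (\<Sum>c\<in>C. u c *\<^sub>R c)"
      using sp span_finite[OF fin] by auto
    have "x \<bullet> b = u b" if "b \<in> C" for b
    proof -
      have "x \<bullet> b = (\<Sum>c\<in>C. u c * (c \<bullet> b))" by (simp add: u inner_sum_left)
      also have "\<dots> = (\<Sum>c\<in>C. if c = b then u c else 0)"
        by (rule sum.cong) (use orth nrm that in auto)
      finally show ?thesis using fin that by simp
    qed
    then show ?thesis using u by simp
  qed
  with fin that show thesis by blast
qed

text \<open>The chain rule differentiates \<open>f\<close> along
  \<open>frechet_derivative g (at x) v\<close>, a direction that moves with \<open>x\<close>,
  whereas the induction hypothesis covers fixed directions. Resolving it in the basis
  \<open>C\<close> turns the derivative into a finite sum of products.\<close>

lemma higher_diff_on_compose: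
  fixes f :: "'e::real_inner \<Rightarrow> real" and g :: "'a::real_normed_vector \<Rightarrow> 'e"
  assumes "is_basis (E :: 'e set)" "open S" "open T" "\<And>x. x \<in> S \<Longrightarrow> g x \<in> T"
  shows "higher_diff_on T f n \<Longrightarrow> higher_diff_on S g n \<Longrightarrow> higher_diff_on S (\<lambda>x. f (g x)) n"
proof (induction n arbitrary: f)
  case 0
  then show ?case
    using assms(4) by (auto intro!: continuous_on_compose2[of T f])
next
  case (Suc n)
  obtain C :: "'e set" where C: "finite C" "\<And>x. (\<Sum>b\<in>C. (x \<bullet> b) *\<^sub>R b) = x"
    using finite_dim_orthonormal_basis[OF assms(1)] by blast
  have h: "((\<lambda>x. f (g x)) has_derivative
      (\<lambda>v. frechet_derivative f (at (g x)) (frechet_derivative g (at x) v))) (at x)"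
    if "x \<in> S" for x
  proof -
    have "(f has_derivative frechet_derivative f (at (g x))) (at (g x))"
      using Suc.prems that assms(4) by (auto intro!: frechet_derivative_at_works)
    moreover have "(g has_derivative frechet_derivative g (at x)) (at x)"
      using Suc.prems that by (auto intro!: frechet_derivative_at_works)
    ultimately show ?thesis
      using diff_chain_at by (fastforce simp: o_def)
  qed
  have e: "frechet_derivative f (at (g x)) w = (\<Sum>b\<in>C. (w \<bullet> b) * frechet_derivative f (at (g x)) b)"
    if "x \<in> S" for x w
  proof -
    have l: "linear (frechet_derivative f (at (g x)))"
      using Suc.prems that assms(4) by (auto intro!: linear_frechet_derivative)
    show ?thesis
      by (subst C(2)[of w, symmetric]) (simp only: linear_sum[OF l] linear_scale[OF l] real_scaleR_def)
  qed
  have h': "((\<lambda>x. f (g x)) has_derivative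
      (\<lambda>v. \<Sum>b\<in>C. (frechet_derivative g (at x) v \<bullet> b) * frechet_derivative f (at (g x)) b)) (at x)"
    if "x \<in> S" for x
    using h[OF that] by (simp only: e[OF that, symmetric])
  have "higher_diff_on S (\<lambda>x. \<Sum>b\<in>C. (frechet_derivative g (at x) v \<bullet> b) * frechet_derivative f (at (g x)) b) n" for v
  proof (intro higher_diff_on_sum higher_diff_on_mult assms)
    fix b assume "b \<in> C"
    show "higher_diff_on S (\<lambda>x. frechet_derivative g (at x) v \<bullet> b) n"
      using Suc.prems by (intro higher_diff_on_linear[where L="\<lambda>y. y \<bullet> b"] assms bounded_linear_inner_left) auto
    show "higher_diff_on S (\<lambda>x. frechet_derivative f (at (g x)) b) n"
      using Suc.prems higher_diff_on_Suc[OF Suc.prems(2)] by (intro Suc.IH[of "\<lambda>y. frechet_derivative f (at y) b"]) auto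
  qed
  with h' show ?case by (intro higher_diff_on_SucI[OF assms(2)]) blast+
qed

lemma smooth_on_differentiable: "smooth_on S f \<Longrightarrow> x \<in> S \<Longrightarrow> f differentiable (at x)"
  unfolding smooth_on_def by (metis higher_diff_on.simps(2))

lemma smooth_on_has_derivative:
  "smooth_on S f \<Longrightarrow> x \<in> S \<Longrightarrow> (f has_derivative (\<lambda>v. frechet_derivative f (at x) v)) (at x)"
  by (simp add: frechet_derivative_at_works smooth_on_differentiable)

lemma smooth_on_frechet_derivative:
  "smooth_on S f \<Longrightarrow> smooth_on S (\<lambda>x. frechet_derivative f (at x) v)"
  unfolding smooth_on_def by (metis higher_diff_on.simps(2))

lemma smooth_on_continuous_on: "smooth_on S f \<Longrightarrow> continuous_on S f"
  unfolding smooth_on_def by (metis higher_diff_on.simps(1))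

lemma smooth_on_cong: "smooth_on S f \<Longrightarrow> open S \<Longrightarrow> (\<And>x. x \<in> S \<Longrightarrow> f x = g x) \<Longrightarrow> smooth_on S g"
  unfolding smooth_on_def using higher_diff_on_cong by blast

lemma smooth_on_local:
  "(\<And>x. x \<in> S \<Longrightarrow> \<exists>T. open T \<and> x \<in> T \<and> smooth_on T f) \<Longrightarrow> smooth_on S f"
  unfolding smooth_on_def by (intro allI higher_diff_on_local) blast

lemma smooth_on_const: "smooth_on S (\<lambda>x. c)"
  unfolding smooth_on_def by (blast intro: higher_diff_on_const)

lemma smooth_on_add: "open S \<Longrightarrow> smooth_on S f \<Longrightarrow> smooth_on S g \<Longrightarrow> smooth_on S (\<lambda>x. f x + g x)"
  unfolding smooth_on_def by (blast intro: higher_diff_on_add)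

lemma smooth_on_mult:
  fixes f g :: "'a::real_normed_vector \<Rightarrow> real"
  shows "open S \<Longrightarrow> smooth_on S f \<Longrightarrow> smooth_on S g \<Longrightarrow> smooth_on S (\<lambda>x. f x * g x)"
  unfolding smooth_on_def by (blast intro: higher_diff_on_mult)

lemma smooth_on_compose:
  fixes f :: "'e::real_inner \<Rightarrow> real" and g :: "'a::real_normed_vector \<Rightarrow> 'e"
  assumes "is_basis (E :: 'e set)" "open S" "open T" "\<And>x. x \<in> S \<Longrightarrow> g x \<in> T"
    and "smooth_on T f" "smooth_on S g"
  shows "smooth_on S (\<lambda>x. f (g x))"
  using higher_diff_on_compose[where f=f and g=g, OF assms(1-4)] assms(5,6) unfolding smooth_on_def by blast

lemma smooth_on_Pair1:
  fixes f :: "'a::real_normed_vector \<times> 'b::real_normed_vector \<Rightarrow> 'c::real_normed_vector"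
  assumes "smooth_on S f" "open S" "open T" "\<And>x. x \<in> T \<Longrightarrow> (x, y) \<in> S"
  shows "smooth_on T (\<lambda>x. f (x, y))"
  using higher_diff_on_affine[OF bounded_linear_Pair[OF bounded_linear_ident bounded_linear_zero], of S T "(0, y)" f]
    assms unfolding smooth_on_def by (intro allI) simp

lemma smooth_on_Pair2:
  fixes f :: "'a::real_normed_vector \<times> 'b::real_normed_vector \<Rightarrow> 'c::real_normed_vector"
  assumes "smooth_on S f" "open S" "open T" "\<And>y. y \<in> T \<Longrightarrow> (x, y) \<in> S"
  shows "smooth_on T (\<lambda>y. f (x, y))"
  using higher_diff_on_affine[OF bounded_linear_Pair[OF bounded_linear_zero bounded_linear_ident], of S T "(x, 0)" f]
    assms unfolding smooth_on_def by (intro allI) simp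

lemma frechet_derivative_Pair1:
  assumes "f differentiable (at (x, y))"
  shows "frechet_derivative (\<lambda>x. f (x, y)) (at x) v = frechet_derivative f (at (x, y)) (v, 0)"
proof (rule frechet_derivativeI)
  have "((\<lambda>x. (x, y)) has_derivative (\<lambda>v. (v, 0))) (at x)"
    by (auto intro!: derivative_eq_intros)
  from diff_chain_at[OF this, of f] frechet_derivative_at_works[OF assms]
  show "((\<lambda>x. f (x, y)) has_derivative (\<lambda>v. frechet_derivative f (at (x, y)) (v, 0))) (at x)"
    by (simp add: o_def)
qed

lemma frechet_derivative_Pair2:
  assumes "f differentiable (at (x, y))"
  shows "frechet_derivative (\<lambda>y. f (x, y)) (at y) v = frechet_derivative f (at (x, y)) (0, v)"
proof (rule frechet_derivativeI)
  have "((\<lambda>y. (x, y)) has_derivative (\<lambda>v. (0, v))) (at y)"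
    by (auto intro!: derivative_eq_intros)
  from diff_chain_at[OF this, of f] frechet_derivative_at_works[OF assms]
  show "((\<lambda>y. f (x, y)) has_derivative (\<lambda>v. frechet_derivative f (at (x, y)) (0, v))) (at y)"
    by (simp add: o_def)
qed

section \<open>Symmetry of second derivatives\<close>

lemma has_real_derivative_line:
  assumes "f differentiable (at (x + a *\<^sub>R u))"
  shows "((\<lambda>a. f (x + a *\<^sub>R u)) has_real_derivative frechet_derivative f (at (x + a *\<^sub>R u)) u) (at a)"
proof -
  have "((\<lambda>a. x + a *\<^sub>R u) has_derivative (\<lambda>h. h *\<^sub>R u)) (at a)"
    by (auto intro!: derivative_eq_intros)
  from diff_chain_at[OF this frechet_derivative_at_works[OF assms]]
  show ?thesis
    using linear_scale[OF linear_frechet_derivative[OF assms]]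
    by (simp add: o_def has_field_derivative_def) (simp add: mult.commute[of _ "frechet_derivative f _ _"])
qed

text \<open>Two mean value theorems: along \<open>u\<close>, for the difference of \<open>f\<close>
  on two opposite sides of the parallelogram with edges \<open>s u\<close> and \<open>s v\<close>,
  then along \<open>v\<close>. The left side is symmetric in \<open>u\<close> and \<open>v\<close>
  while the order of derivatives on the right is not, which gives Schwarz's theorem. The bound on
  \<open>s\<close> keeps the parallelogram in the ball.\<close>

lemma second_difference:
  fixes f :: "'a::real_normed_vector \<Rightarrow> real"
  assumes "smooth_on S f" "ball x r \<subseteq> S" "s > 0" "s * (norm u + norm v) < r"
  shows "\<exists>a b. 0 < a \<and> a < s \<and> 0 < b \<and> b < s \<and>
    f (x + s *\<^sub>R u + s *\<^sub>R v) - f (x + s *\<^sub>R u) - f (x + s *\<^sub>R v) + f x =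
    s * s * frechet_derivative (\<lambda>y. frechet_derivative f (at y) u) (at (x + a *\<^sub>R u + b *\<^sub>R v)) v"
proof -
  have inS: "x + a *\<^sub>R u + b *\<^sub>R v \<in> S" if "0 \<le> a" "a \<le> s" "0 \<le> b" "b \<le> s" for a b
  proof -
    have "norm (a *\<^sub>R u + b *\<^sub>R v) \<le> a * norm u + b * norm v"
      using norm_triangle_ineq[of "a *\<^sub>R u" "b *\<^sub>R v"] that by simp
    also have "\<dots> \<le> s * norm u + s * norm v"
      using that by (intro add_mono mult_right_mono) auto
    finally have "norm (a *\<^sub>R u + b *\<^sub>R v) < r"
      using assms(4) by (simp add: distrib_left)
    moreover have "dist x (x + a *\<^sub>R u + b *\<^sub>R v) = norm (a *\<^sub>R u + b *\<^sub>R v)"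
      using norm_minus_cancel[of "a *\<^sub>R u + b *\<^sub>R v"] by (simp add: dist_norm add.commute)
    ultimately show ?thesis using assms(2) by auto
  qed
  let ?g = "\<lambda>a. f (x + s *\<^sub>R v + a *\<^sub>R u) - f (x + a *\<^sub>R u)"
  let ?g' = "\<lambda>a. frechet_derivative f (at (x + s *\<^sub>R v + a *\<^sub>R u)) u - frechet_derivative f (at (x + a *\<^sub>R u)) u"
  have "\<exists>a. 0 < a \<and> a < s \<and> ?g s - ?g 0 = (s - 0) * ?g' a"
  proof (rule MVT2)
    show "0 < s" by fact
    fix a assume a: "0 \<le> a" "a \<le> s"
    have "f differentiable at (x + s *\<^sub>R v + a *\<^sub>R u)" "f differentiable at (x + a *\<^sub>R u)"
      using inS[of a s] inS[of a 0] a assms(3)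
      by (auto intro!: smooth_on_differentiable[OF assms(1)] simp: algebra_simps)
    then show "(?g has_real_derivative ?g' a) (at a)"
      by (intro derivative_intros has_real_derivative_line)
  qed
  then obtain a where a: "0 < a" "a < s" "?g s - ?g 0 = s * ?g' a" by auto
  let ?k = "\<lambda>b. frechet_derivative f (at (x + a *\<^sub>R u + b *\<^sub>R v)) u"
  let ?k' = "\<lambda>b. frechet_derivative (\<lambda>y. frechet_derivative f (at y) u) (at (x + a *\<^sub>R u + b *\<^sub>R v)) v"
  have "\<exists>b. 0 < b \<and> b < s \<and> ?k s - ?k 0 = (s - 0) * ?k' b"
  proof (rule MVT2)
    show "0 < s" by fact
    fix b assume b: "0 \<le> b" "b \<le> s"
    show "(?k has_real_derivative ?k' b) (at b)"
      using inS[of a b] a b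
      by (intro has_real_derivative_line[where f="\<lambda>y. frechet_derivative f (at y) u"]
          smooth_on_differentiable[OF smooth_on_frechet_derivative[OF assms(1)]]) auto
  qed
  then obtain b where b: "0 < b" "b < s" "?k s - ?k 0 = s * ?k' b" by auto
  have "?g' a = ?k s - ?k 0" by (simp add: algebra_simps)
  then have "?g s - ?g 0 = s * s * ?k' b" using a(3) b(3) by simp
  then show ?thesis
    using a b by (intro exI[of _ a] exI[of _ b]) (simp add: algebra_simps)
qed

text \<open>Schwarz's theorem: one second difference is \<open>s * s\<close> times either mixed
  derivative, each taken at some point near \<open>x\<close>, and continuity of both at
  \<open>x\<close> excludes different values.\<close>

lemma frechet_derivative_commute:
  fixes f :: "'a::real_normed_vector \<Rightarrow> real"
  assumes "smooth_on S f" "open S" "x \<in> S"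
  shows "frechet_derivative (\<lambda>y. frechet_derivative f (at y) u) (at x) v =
    frechet_derivative (\<lambda>y. frechet_derivative f (at y) v) (at x) u" (is "?p u v x = ?p v u x")
proof (rule ccontr)
  assume ne: "?p u v x \<noteq> ?p v u x"
  \<comment> \<open>Half the gap: no number is at distance less than \<open>e\<close> from both
    mixed derivatives at \<open>x\<close>.\<close>
  define e where "e = \<bar>?p u v x - ?p v u x\<bar> / 2"
  have e: "e > 0" using ne by (simp add: e_def)
  have cont: "continuous (at x) (?p u v)" "continuous (at x) (?p v u)"
    using smooth_on_continuous_on[OF smooth_on_frechet_derivative[OF smooth_on_frechet_derivative[OF assms(1)]]]
      assms(2,3) continuous_on_eq_continuous_at by blast+
  obtain d1 where d1: "d1 > 0" "\<And>y. dist y x < d1 \<Longrightarrow> dist (?p u v y) (?p u v x) < e"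
    using cont(1) e unfolding continuous_at_eps_delta by blast
  obtain d2 where d2: "d2 > 0" "\<And>y. dist y x < d2 \<Longrightarrow> dist (?p v u y) (?p v u x) < e"
    using cont(2) e unfolding continuous_at_eps_delta by blast
  obtain r where r: "r > 0" "ball x r \<subseteq> S"
    using assms(2,3) open_contains_ball by blast
  define R where "R = min r (min d1 d2)"
  have R: "R > 0" "R \<le> r" "R \<le> d1" "R \<le> d2" using r d1 d2 by (auto simp: R_def)
  \<comment> \<open>The \<open>+ 1\<close> keeps the denominator positive when
    \<open>u = v = 0\<close>.\<close>
  define s where "s = R / (2 * (norm u + norm v + 1))"
  have pos: "norm u + norm v + 1 > 0" by (simp add: add_nonneg_pos)
  have s: "s > 0" using R pos by (simp add: s_def)
  have "s * (norm u + norm v) < s * (2 * (norm u + norm v + 1))"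
    using s pos by (intro mult_strict_left_mono) auto
  also have "\<dots> = R" using pos unfolding s_def by (simp add: field_simps)
  finally have sR: "s * (norm u + norm v) < R" .
  have dist: "dist (x + a *\<^sub>R u' + b *\<^sub>R v') x < R"
    if "0 < a" "a < s" "0 < b" "b < s" "norm u' + norm v' = norm u + norm v" for a b u' v'
  proof -
    have "norm (a *\<^sub>R u' + b *\<^sub>R v') \<le> a * norm u' + b * norm v'"
      using norm_triangle_ineq[of "a *\<^sub>R u'" "b *\<^sub>R v'"] that by simp
    also have "\<dots> \<le> s * norm u' + s * norm v'"
      using that by (intro add_mono mult_right_mono) auto
    also have "\<dots> < R" using sR that(5) by (metis distrib_left)
    finally show ?thesis by (simp add: dist_norm add.assoc)
  qed
  obtain a b where ab: "0 < a" "a < s" "0 < b" "b < s"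
    "f (x + s *\<^sub>R u + s *\<^sub>R v) - f (x + s *\<^sub>R u) - f (x + s *\<^sub>R v) + f x = s * s * ?p u v (x + a *\<^sub>R u + b *\<^sub>R v)"
    using second_difference[OF assms(1) r(2) s, of u v] sR R by auto
  obtain a' b' where ab': "0 < a'" "a' < s" "0 < b'" "b' < s"
    "f (x + s *\<^sub>R v + s *\<^sub>R u) - f (x + s *\<^sub>R v) - f (x + s *\<^sub>R u) + f x = s * s * ?p v u (x + a' *\<^sub>R v + b' *\<^sub>R u)"
    using second_difference[OF assms(1) r(2) s, of v u] sR R by (auto simp: add.commute)
  have "s * s * ?p u v (x + a *\<^sub>R u + b *\<^sub>R v) = s * s * ?p v u (x + a' *\<^sub>R v + b' *\<^sub>R u)"
    using ab(5) ab'(5) by (simp add: algebra_simps)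
  then have eq: "?p u v (x + a *\<^sub>R u + b *\<^sub>R v) = ?p v u (x + a' *\<^sub>R v + b' *\<^sub>R u)"
    using s by simp
  have "\<bar>?p u v (x + a *\<^sub>R u + b *\<^sub>R v) - ?p u v x\<bar> < e"
    using d1(2)[of "x + a *\<^sub>R u + b *\<^sub>R v"] dist[OF ab(1-4), of u v] R by (simp add: dist_real_def)
  moreover have "\<bar>?p v u (x + a' *\<^sub>R v + b' *\<^sub>R u) - ?p v u x\<bar> < e"
    using d2(2)[of "x + a' *\<^sub>R v + b' *\<^sub>R u"] dist[OF ab'(1-4), of v u] R by (simp add: dist_real_def)
  ultimately show False unfolding eq e_def by (simp add: abs_if split: if_splits)
qed

section \<open>Tangent vectors\<close>

text \<open>The part of \<open>smooth_manifold\<close> needed of a domain: for products this avoids checking the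
  transition maps of \<open>prod_atlas\<close>.\<close>

definition charted :: "('m::topological_space, 'e::real_inner) atlas \<Rightarrow> bool" where
  "charted A \<longleftrightarrow> (\<Union>(U, \<kappa>)\<in>A. U) = UNIV \<and>
     (\<forall>(U, \<kappa>)\<in>A. open U \<and> open (\<kappa> ` U) \<and> inj_on \<kappa> U \<and> continuous_on (\<kappa> ` U) (inv_into U \<kappa>))"

lemma smooth_manifold_charted:
  assumes "smooth_manifold A" shows "charted A"
proof -
  note m = assms[unfolded smooth_manifold_def, THEN conjunct2]
  note ch = m[THEN conjunct2, THEN conjunct1]
  have "open U \<and> open (\<kappa> ` U) \<and> inj_on \<kappa> U \<and> continuous_on (\<kappa> ` U) (inv_into U \<kappa>)" if "(U, \<kappa>) \<in> A" for U \<kappa>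
  proof -
    have h: "open U \<and> open (\<kappa> ` U) \<and> homeomorphism U (\<kappa> ` U) \<kappa> (inv_into U \<kappa>)"
      using bspec[OF ch that] by (simp only: prod.case)
    then have "\<forall>x\<in>U. inv_into U \<kappa> (\<kappa> x) = x" "continuous_on (\<kappa> ` U) (inv_into U \<kappa>)"
      unfolding homeomorphism_def by simp_all
    then show ?thesis using h inj_on_inverseI[of U "inv_into U \<kappa>" \<kappa>] by simp
  qed
  then show ?thesis unfolding charted_def by (intro conjI m[THEN conjunct1]) auto
qed

lemma chartedD:
  assumes "charted A" "(U, \<kappa>) \<in> A"
  shows "open U" "open (\<kappa> ` U)" "inj_on \<kappa> U" "continuous_on (\<kappa> ` U) (inv_into U \<kappa>)"
  using assms unfolding charted_def by auto

lemma charted_cover: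
  assumes "charted A"
  obtains U \<kappa> where "(U, \<kappa>) \<in> A" "p \<in> U"
proof -
  have "p \<in> (\<Union>(U, \<kappa>)\<in>A. U)" using assms unfolding charted_def by simp
  then show thesis using that by auto
qed

lemma charted_open_image:
  assumes "charted A" "(U, \<kappa>) \<in> A" "open W"
  shows "open (\<kappa> ` (U \<inter> W))"
proof -
  have "\<kappa> ` (U \<inter> W) = \<kappa> ` U \<inter> inv_into U \<kappa> -` W"
    using chartedD(3)[OF assms(1,2)] by (auto simp: inv_into_f_f)
  then show ?thesis
    using continuous_open_preimage[OF chartedD(4,2)[OF assms(1,2)] assms(3)] by simp
qed

lemma inv_into_map_prod:
  assumes "inj_on \<kappa> U" "inj_on \<mu> V" "x \<in> \<kappa> ` U" "y \<in> \<mu> ` V"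
  shows "inv_into (U \<times> V) (map_prod \<kappa> \<mu>) (x, y) = (inv_into U \<kappa> x, inv_into V \<mu> y)"
proof -
  have "inj_on (map_prod \<kappa> \<mu>) (U \<times> V)" using assms by (simp add: map_prod_inj_on)
  then show ?thesis
    using assms by (intro inv_into_f_eq) (auto simp: inv_into_into f_inv_into_f)
qed

lemma prod_atlasI: "(U, \<kappa>) \<in> A \<Longrightarrow> (V, \<mu>) \<in> A' \<Longrightarrow> (U \<times> V, map_prod \<kappa> \<mu>) \<in> prod_atlas A A'"
  unfolding prod_atlas_def by blast

lemma map_prod_image_Times: "map_prod \<kappa> \<mu> ` (U \<times> V) = \<kappa> ` U \<times> \<mu> ` V"
  by auto

lemma charted_prod:
  assumes "charted A" "charted A'"
  shows "charted (prod_atlas A A')"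
  unfolding charted_def
proof (intro conjI ballI)
  show "(\<Union>(U, \<kappa>)\<in>prod_atlas A A'. U) = UNIV"
  proof -
    have "\<exists>W\<in>prod_atlas A A'. (p, q) \<in> (case W of (U, \<kappa>) \<Rightarrow> U)" for p q
      using charted_cover[OF assms(1), of p] charted_cover[OF assms(2), of q]
      by (metis (mono_tags, lifting) SigmaI case_prod_conv prod_atlasI)
    then show ?thesis by auto
  qed
next
  fix W assume "W \<in> prod_atlas A A'"
  then obtain U \<kappa> V \<mu> where W: "W = (U \<times> V, map_prod \<kappa> \<mu>)" "(U, \<kappa>) \<in> A" "(V, \<mu>) \<in> A'"
    unfolding prod_atlas_def by blast
  note c = chartedD[OF assms(1) W(2)] and c' = chartedD[OF assms(2) W(3)]
  have "continuous_on (\<kappa> ` U \<times> \<mu> ` V) (\<lambda>z. (inv_into U \<kappa> (fst z), inv_into V \<mu> (snd z)))"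
    by (intro continuous_on_Pair continuous_on_compose2[OF c(4)] continuous_on_compose2[OF c'(4)]
        continuous_intros) auto
  then have "continuous_on (\<kappa> ` U \<times> \<mu> ` V) (inv_into (U \<times> V) (map_prod \<kappa> \<mu>))"
    by (rule continuous_on_eq) (auto simp: inv_into_map_prod[OF c(3) c'(3)])
  then show "case W of (U, \<kappa>) \<Rightarrow> open U \<and> open (\<kappa> ` U) \<and> inj_on \<kappa> U \<and> continuous_on (\<kappa> ` U) (inv_into U \<kappa>)"
    using c c' by (simp add: W(1) map_prod_image_Times open_Times map_prod_inj_on)
qed

section \<open>Smooth functions and smooth maps\<close>

lemma smooth_funD: "smooth_fun A f \<Longrightarrow> (U, \<kappa>) \<in> A \<Longrightarrow> smooth_on (\<kappa> ` U) (\<lambda>x. f (inv_into U \<kappa> x))"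
  unfolding smooth_fun_def o_def by auto

lemma smooth_funI:
  "(\<And>U \<kappa>. (U, \<kappa>) \<in> A \<Longrightarrow> smooth_on (\<kappa> ` U) (\<lambda>x. f (inv_into U \<kappa> x))) \<Longrightarrow> smooth_fun A f"
  unfolding smooth_fun_def o_def by auto

lemma smooth_fun_const: "smooth_fun A (\<lambda>p. c)"
  by (intro smooth_funI smooth_on_const)

lemma smooth_fun_add:
  "charted A \<Longrightarrow> smooth_fun A f \<Longrightarrow> smooth_fun A g \<Longrightarrow> smooth_fun A (\<lambda>p. f p + g p)"
  by (auto intro!: smooth_funI smooth_on_add dest: smooth_funD chartedD)

lemma smooth_fun_mult:
  "charted A \<Longrightarrow> smooth_fun A f \<Longrightarrow> smooth_fun A g \<Longrightarrow> smooth_fun A (\<lambda>p. f p * g p)"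
  by (auto intro!: smooth_funI smooth_on_mult dest: smooth_funD chartedD)

lemma smooth_fun_diff:
  "charted A \<Longrightarrow> smooth_fun A f \<Longrightarrow> smooth_fun A g \<Longrightarrow> smooth_fun A (\<lambda>p. f p - g p)"
  using smooth_fun_add[of A f "\<lambda>p. -1 * g p"] smooth_fun_mult[OF _ smooth_fun_const, of A g "-1"] by simp

lemma smooth_fun_sum:
  assumes "charted A" "\<And>i. i \<in> I \<Longrightarrow> smooth_fun A (f i)"
  shows "smooth_fun A (\<lambda>p. \<Sum>i\<in>I. f i p)"
  using assms(2)
  by (induction I rule: infinite_finite_induct) (auto intro!: smooth_fun_const smooth_fun_add[OF assms(1)])

lemma smooth_mapD:
  assumes "smooth_map A A' F" "(U, \<kappa>) \<in> A" "(V, \<mu>) \<in> A'"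
  shows "smooth_on (\<kappa> ` (U \<inter> F -` V)) (\<lambda>x. \<mu> (F (inv_into U \<kappa> x)))"
  using assms(1)[unfolded smooth_map_def o_def, THEN conjunct2, THEN bspec, OF assms(2), unfolded prod.case,
      THEN bspec, OF assms(3)] by simp

text \<open>\<open>F\<close> is controlled in coordinates only on the part of a chart that it sends
  into one target chart. These parts are open by continuity of \<open>F\<close>, and smoothness is
  glued from them. The basis in the definition of \<open>smooth_manifold\<close> for the target
  feeds the chain rule.\<close>

lemma smooth_fun_compose:
  fixes A' :: "('n::{t2_space,second_countable_topology}, 'd::real_inner) atlas"
  assumes "charted A" "smooth_manifold A'" "smooth_map A A' F" "smooth_fun A' f"
  shows "smooth_fun A (\<lambda>p. f (F p))"
proof (intro smooth_funI smooth_on_local)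
  fix U \<kappa> x assume ch: "(U, \<kappa>) \<in> A" and "x \<in> \<kappa> ` U"
  then obtain p where p: "p \<in> U" "x = \<kappa> p" by blast
  have c': "charted A'" using assms(2) by (rule smooth_manifold_charted)
  obtain V \<mu> where V: "(V, \<mu>) \<in> A'" "F p \<in> V" using charted_cover[OF c'] by blast
  obtain E :: "'d set" where E: "is_basis E"
    using assms(2)[unfolded smooth_manifold_def, THEN conjunct1] by blast
  define T where "T = \<kappa> ` (U \<inter> F -` V)"
  have "open (F -` V)"
    using assms(3) chartedD(1)[OF c' V(1)] unfolding smooth_map_def by (simp add: open_vimage)
  then have T: "open T" unfolding T_def by (rule charted_open_image[OF assms(1) ch])
  have inv: "inv_into U \<kappa> (\<kappa> q) = q" if "q \<in> U" for q
    using chartedD(3)[OF assms(1) ch] that by simp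
  have sm: "smooth_on T (\<lambda>x. \<mu> (F (inv_into U \<kappa> x)))"
    unfolding T_def by (rule smooth_mapD[OF assms(3) ch V(1)])
  have "smooth_on T (\<lambda>x. f (inv_into V \<mu> (\<mu> (F (inv_into U \<kappa> x)))))"
    by (rule smooth_on_compose[OF E T chartedD(2)[OF c' V(1)] _ smooth_funD[OF assms(4) V(1)] sm])
      (auto simp: T_def inv)
  then have "smooth_on T (\<lambda>x. f (F (inv_into U \<kappa> x)))"
    by (rule smooth_on_cong[OF _ T]) (use chartedD(3)[OF c' V(1)] in \<open>auto simp: T_def inv\<close>)
  moreover have "x \<in> T" using p V(2) by (auto simp: T_def)
  ultimately show "\<exists>T. open T \<and> x \<in> T \<and> smooth_on T (\<lambda>x. f (F (inv_into U \<kappa> x)))"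
    using T by blast
qed

section \<open>Tangent vectors as derivations, and their images under smooth maps\<close>

lemma tangent_spaceE:
  assumes "v \<in> tangent_space A p"
  obtains U \<kappa> w where "(U, \<kappa>) \<in> A" "p \<in> U"
    "\<And>f. smooth_fun A f \<Longrightarrow> v f = frechet_derivative (\<lambda>x. f (inv_into U \<kappa> x)) (at (\<kappa> p)) w"
    "\<And>f. \<not> smooth_fun A f \<Longrightarrow> v f = 0"
proof -
  obtain U \<kappa> w where "(U, \<kappa>) \<in> A" "p \<in> U"
    "v = (\<lambda>f. if smooth_fun A f then frechet_derivative (\<lambda>x. f (inv_into U \<kappa> x)) (at (\<kappa> p)) w else 0)"
    using assms unfolding tangent_space_def o_def by blast
  then show thesis using that by simp
qed

lemma tangent_spaceI:
  assumes "(U, \<kappa>) \<in> A" "p \<in> U"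
    "\<And>f. smooth_fun A f \<Longrightarrow> v f = frechet_derivative (\<lambda>x. f (inv_into U \<kappa> x)) (at (\<kappa> p)) w"
    "\<And>f. \<not> smooth_fun A f \<Longrightarrow> v f = 0"
  shows "v \<in> tangent_space A p"
proof -
  have "v = (\<lambda>f. if smooth_fun A f then frechet_derivative (f \<circ> inv_into U \<kappa>) (at (\<kappa> p)) w else 0)"
    using assms(3,4) by (auto simp: o_def)
  then show ?thesis using assms(1,2) unfolding tangent_space_def by blast
qed

lemma chart_has_derivative:
  assumes "smooth_fun A f" "(U, \<kappa>) \<in> A" "p \<in> U"
  shows "((\<lambda>x. f (inv_into U \<kappa> x)) has_derivative
    (\<lambda>w. frechet_derivative (\<lambda>x. f (inv_into U \<kappa> x)) (at (\<kappa> p)) w)) (at (\<kappa> p))"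
  using smooth_on_has_derivative[OF smooth_funD[OF assms(1,2)]] assms(3) by blast

lemma tangent_nonsmooth: "v \<in> tangent_space A p \<Longrightarrow> \<not> smooth_fun A f \<Longrightarrow> v f = 0"
  by (metis tangent_spaceE)

lemma tangent_const:
  assumes "v \<in> tangent_space A p" shows "v (\<lambda>p. c) = 0"
  using assms by (rule tangent_spaceE) (simp add: smooth_fun_const)

lemma tangent_add:
  assumes "charted A" "v \<in> tangent_space A p" "smooth_fun A f" "smooth_fun A g"
  shows "v (\<lambda>p. f p + g p) = v f + v g"
  using assms(2)
proof (rule tangent_spaceE)
  fix U \<kappa> w assume h: "(U, \<kappa>) \<in> A" "p \<in> U"
    "\<And>f. smooth_fun A f \<Longrightarrow> v f = frechet_derivative (\<lambda>x. f (inv_into U \<kappa> x)) (at (\<kappa> p)) w"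
  show ?thesis
    using frechet_derivativeI[OF has_derivative_add[OF chart_has_derivative[OF assms(3) h(1,2)]
          chart_has_derivative[OF assms(4) h(1,2)]]] h(3) smooth_fun_add[OF assms(1,3,4)] assms(3,4)
    by simp
qed

lemma tangent_mult:
  assumes "charted A" "v \<in> tangent_space A p" "smooth_fun A f" "smooth_fun A g"
  shows "v (\<lambda>p. f p * g p) = v f * g p + f p * v g"
  using assms(2)
proof (rule tangent_spaceE)
  fix U \<kappa> w assume h: "(U, \<kappa>) \<in> A" "p \<in> U"
    "\<And>f. smooth_fun A f \<Longrightarrow> v f = frechet_derivative (\<lambda>x. f (inv_into U \<kappa> x)) (at (\<kappa> p)) w"
  show ?thesis
    using frechet_derivativeI[OF has_derivative_mult[OF chart_has_derivative[OF assms(3) h(1,2)]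
          chart_has_derivative[OF assms(4) h(1,2)]]] h smooth_fun_mult[OF assms(1,3,4)] assms(3,4)
      chartedD(3)[OF assms(1) h(1)]
    by simp
qed

lemma tangent_scale:
  assumes "charted A" "v \<in> tangent_space A p" "smooth_fun A f"
  shows "v (\<lambda>p. c * f p) = c * v f"
  using tangent_mult[OF assms(1,2) smooth_fun_const assms(3)] tangent_const[OF assms(2)] by simp

lemma tangent_diff:
  assumes "charted A" "v \<in> tangent_space A p" "smooth_fun A f" "smooth_fun A g"
  shows "v (\<lambda>p. f p - g p) = v f - v g"
  using tangent_add[OF assms(1-3) smooth_fun_mult[OF assms(1) smooth_fun_const assms(4)], of "-1"]
    tangent_scale[OF assms(1,2,4), of "-1"] by simp

lemma tangent_sum:
  assumes "charted A" "v \<in> tangent_space A p" "\<And>i. i \<in> I \<Longrightarrow> smooth_fun A (f i)"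
  shows "v (\<lambda>p. \<Sum>i\<in>I. f i p) = (\<Sum>i\<in>I. v (f i))"
  using assms(3)
  by (induction I rule: infinite_finite_induct)
    (simp_all add: tangent_const[OF assms(2)] tangent_add[OF assms(1,2)] smooth_fun_sum[OF assms(1)])

text \<open>The vector \<open>w\<close> is the image of the direction of \<open>v\<close> under the
  derivative of \<open>F\<close> in coordinates, so one \<open>w\<close> serves all
  \<open>f\<close>. As the target chart is prescribed, the identity map yields the change of chart.
  Only smooth \<open>f\<close> are covered, since \<open>f \<circ> F\<close> can be smooth when
  \<open>f\<close> is not.\<close>

lemma tangent_pushforward:
  fixes A' :: "('n::{t2_space,second_countable_topology}, 'd::real_inner) atlas"
  assumes "charted A" "smooth_manifold A'" "smooth_map A A' F" "v \<in> tangent_space A p"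
    and "(V, \<mu>) \<in> A'" "F p \<in> V"
  shows "\<exists>w. \<forall>f. smooth_fun A' f \<longrightarrow>
    v (\<lambda>p. f (F p)) = frechet_derivative (\<lambda>x. f (inv_into V \<mu> x)) (at (\<mu> (F p))) w"
  using assms(4)
proof (rule tangent_spaceE)
  fix U \<kappa> w assume h: "(U, \<kappa>) \<in> A" "p \<in> U"
    "\<And>f. smooth_fun A f \<Longrightarrow> v f = frechet_derivative (\<lambda>x. f (inv_into U \<kappa> x)) (at (\<kappa> p)) w"
  have c': "charted A'" using assms(2) by (rule smooth_manifold_charted)
  define T where "T = \<kappa> ` (U \<inter> F -` V)"
  have "open (F -` V)"
    using assms(3) chartedD(1)[OF c' assms(5)] unfolding smooth_map_def by (simp add: open_vimage)
  then have T: "open T" unfolding T_def by (rule charted_open_image[OF assms(1) h(1)])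
  have inv: "inv_into U \<kappa> (\<kappa> q) = q" if "q \<in> U" for q
    using chartedD(3)[OF assms(1) h(1)] that by simp
  have pT: "\<kappa> p \<in> T" using h(2) assms(6) by (auto simp: T_def)
  let ?G = "\<lambda>x. \<mu> (F (inv_into U \<kappa> x))"
  have sm: "smooth_on T ?G"
    unfolding T_def by (rule smooth_mapD[OF assms(3) h(1) assms(5)])
  show ?thesis
  proof (intro exI allI impI)
    fix f assume f: "smooth_fun A' f"
    have d: "((\<lambda>x. f (inv_into V \<mu> (?G x))) has_derivative
      (\<lambda>w. frechet_derivative (\<lambda>x. f (inv_into V \<mu> x)) (at (\<mu> (F p))) (frechet_derivative ?G (at (\<kappa> p)) w))) (at (\<kappa> p))"
      using diff_chain_at[OF smooth_on_has_derivative[OF sm pT], of "\<lambda>x. f (inv_into V \<mu> x)"]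
        chart_has_derivative[OF f assms(5,6)] by (simp add: inv h(2) o_def)
    have "((\<lambda>x. f (F (inv_into U \<kappa> x))) has_derivative
      (\<lambda>w. frechet_derivative (\<lambda>x. f (inv_into V \<mu> x)) (at (\<mu> (F p))) (frechet_derivative ?G (at (\<kappa> p)) w))) (at (\<kappa> p))"
      by (rule has_derivative_transform_within_open[OF d T pT])
        (use chartedD(3)[OF c' assms(5)] in \<open>auto simp: T_def inv\<close>)
    then show "v (\<lambda>p. f (F p)) = frechet_derivative (\<lambda>x. f (inv_into V \<mu> x)) (at (\<mu> (F p)))
       (frechet_derivative ?G (at (\<kappa> p)) w)"
      using h(3)[OF smooth_fun_compose[OF assms(1-3) f]] frechet_derivativeI by simp
  qed
qed

lemma smooth_map_ident:
  assumes "smooth_manifold A" shows "smooth_map A A (\<lambda>p. p)"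
  using assms unfolding smooth_map_def smooth_manifold_def vimage_ident o_def by (simp add: continuous_on_id)

lemma tangent_space_chart:
  assumes "smooth_manifold A" "v \<in> tangent_space A p" "(V, \<mu>) \<in> A" "p \<in> V"
  obtains w where "\<And>f. smooth_fun A f \<Longrightarrow> v f = frechet_derivative (\<lambda>x. f (inv_into V \<mu> x)) (at (\<mu> p)) w"
  using tangent_pushforward[OF smooth_manifold_charted[OF assms(1)] assms(1)
      smooth_map_ident[OF assms(1)] assms(2-4)] by auto

section \<open>Partial derivatives on a product\<close>

lemma smooth_fun_prodD:
  assumes "charted A" "charted A'" "smooth_fun (prod_atlas A A') F" "(U, \<kappa>) \<in> A" "(V, \<mu>) \<in> A'"
  shows "smooth_on (\<kappa> ` U \<times> \<mu> ` V) (\<lambda>(x, y). F (inv_into U \<kappa> x, inv_into V \<mu> y))"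
  using smooth_funD[OF assms(3) prod_atlasI[OF assms(4,5)], unfolded map_prod_image_Times]
  by (rule smooth_on_cong)
    (auto simp: inv_into_map_prod[OF chartedD(3)[OF assms(1,4)] chartedD(3)[OF assms(2,5)]]
      intro!: open_Times chartedD(2)[OF assms(1,4)] chartedD(2)[OF assms(2,5)])

lemma smooth_fun_slice1:
  assumes "charted A" "charted A'" "smooth_fun (prod_atlas A A') F"
  shows "smooth_fun A (\<lambda>x. F (x, y))"
proof (rule smooth_funI)
  fix U \<kappa> assume U: "(U, \<kappa>) \<in> A"
  obtain V \<mu> where V: "(V, \<mu>) \<in> A'" "y \<in> V" using charted_cover[OF assms(2)] by blast
  show "smooth_on (\<kappa> ` U) (\<lambda>x. F (inv_into U \<kappa> x, y))"
    using smooth_on_Pair1[OF smooth_fun_prodD[OF assms U V(1)] _ chartedD(2)[OF assms(1) U], of "\<mu> y"]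
      V chartedD(2)[OF assms(1) U] chartedD(2,3)[OF assms(2) V(1)] by (simp add: open_Times)
qed

lemma smooth_fun_slice2:
  assumes "charted A" "charted A'" "smooth_fun (prod_atlas A A') F"
  shows "smooth_fun A' (\<lambda>y. F (x, y))"
proof (rule smooth_funI)
  fix V \<mu> assume V: "(V, \<mu>) \<in> A'"
  obtain U \<kappa> where U: "(U, \<kappa>) \<in> A" "x \<in> U" using charted_cover[OF assms(1)] by blast
  show "smooth_on (\<mu> ` V) (\<lambda>y. F (x, inv_into V \<mu> y))"
    using smooth_on_Pair2[OF smooth_fun_prodD[OF assms U(1) V] _ chartedD(2)[OF assms(2) V], of "\<kappa> x"]
      U chartedD(2,3)[OF assms(1) U(1)] chartedD(2)[OF assms(2) V] by (simp add: open_Times)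
qed

lemma tangent_slice1_chart:
  assumes "charted A" "charted A'" "smooth_fun (prod_atlas A A') F"
    and "(U, \<kappa>) \<in> A" "x \<in> U" "(V, \<mu>) \<in> A'" "y \<in> V"
  shows "frechet_derivative (\<lambda>x. F (inv_into U \<kappa> x, y)) (at (\<kappa> x)) w =
    frechet_derivative (\<lambda>(x, y). F (inv_into U \<kappa> x, inv_into V \<mu> y)) (at (\<kappa> x, \<mu> y)) (w, 0)"
proof -
  have "(\<lambda>(x, y). F (inv_into U \<kappa> x, inv_into V \<mu> y)) differentiable (at (\<kappa> x, \<mu> y))"
    using smooth_on_differentiable[OF smooth_fun_prodD[OF assms(1-4,6)]] assms(5,7) by blast
  from frechet_derivative_Pair1[OF this] show ?thesis
    using chartedD(3)[OF assms(2,6)] assms(7) by simp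
qed

lemma tangent_slice2_chart:
  assumes "charted A" "charted A'" "smooth_fun (prod_atlas A A') F"
    and "(U, \<kappa>) \<in> A" "x \<in> U" "(V, \<mu>) \<in> A'" "y \<in> V"
  shows "frechet_derivative (\<lambda>y. F (x, inv_into V \<mu> y)) (at (\<mu> y)) w =
    frechet_derivative (\<lambda>(x, y). F (inv_into U \<kappa> x, inv_into V \<mu> y)) (at (\<kappa> x, \<mu> y)) (0, w)"
proof -
  have "(\<lambda>(x, y). F (inv_into U \<kappa> x, inv_into V \<mu> y)) differentiable (at (\<kappa> x, \<mu> y))"
    using smooth_on_differentiable[OF smooth_fun_prodD[OF assms(1-4,6)]] assms(5,7) by blast
  from frechet_derivative_Pair2[OF this] show ?thesis
    using chartedD(3)[OF assms(1,4)] assms(5) by simp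
qed

text \<open>In coordinates this is the derivative of a smooth two-variable function along the
  constant direction \<open>(w, 0)\<close>, restricted to a slice.\<close>

lemma smooth_fun_tangent_slice1:
  assumes "charted A" "charted A'" "smooth_fun (prod_atlas A A') F" "v \<in> tangent_space A x"
  shows "smooth_fun A' (\<lambda>y. v (\<lambda>x. F (x, y)))"
  using assms(4)
proof (rule tangent_spaceE)
  fix U \<kappa> w assume h: "(U, \<kappa>) \<in> A" "x \<in> U"
    "\<And>f. smooth_fun A f \<Longrightarrow> v f = frechet_derivative (\<lambda>x. f (inv_into U \<kappa> x)) (at (\<kappa> x)) w"
  show ?thesis
  proof (rule smooth_funI)
    fix V \<mu> assume V: "(V, \<mu>) \<in> A'"
    note c = chartedD[OF assms(1) h(1)] and c' = chartedD[OF assms(2) V]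
    let ?D = "\<lambda>z. frechet_derivative (\<lambda>(x, y). F (inv_into U \<kappa> x, inv_into V \<mu> y)) (at z) (w, 0)"
    have "smooth_on (\<mu> ` V) (\<lambda>y. ?D (\<kappa> x, y))"
      using smooth_on_Pair2[OF smooth_on_frechet_derivative[OF smooth_fun_prodD[OF assms(1-3) h(1) V]] _ c'(2)]
        c c' h(2) by (simp add: open_Times)
    then show "smooth_on (\<mu> ` V) (\<lambda>y. v (\<lambda>x. F (x, inv_into V \<mu> y)))"
      by (rule smooth_on_cong[OF _ c'(2)])
        (use c' h(3)[OF smooth_fun_slice1[OF assms(1-3)]] tangent_slice1_chart[OF assms(1-3) h(1,2) V] in auto)
  qed
qed

lemma smooth_fun_tangent_slice2:
  assumes "charted A" "charted A'" "smooth_fun (prod_atlas A A') F" "v \<in> tangent_space A' y"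
  shows "smooth_fun A (\<lambda>x. v (\<lambda>y. F (x, y)))"
  using assms(4)
proof (rule tangent_spaceE)
  fix V \<mu> w assume h: "(V, \<mu>) \<in> A'" "y \<in> V"
    "\<And>f. smooth_fun A' f \<Longrightarrow> v f = frechet_derivative (\<lambda>y. f (inv_into V \<mu> y)) (at (\<mu> y)) w"
  show ?thesis
  proof (rule smooth_funI)
    fix U \<kappa> assume U: "(U, \<kappa>) \<in> A"
    note c = chartedD[OF assms(1) U] and c' = chartedD[OF assms(2) h(1)]
    let ?D = "\<lambda>z. frechet_derivative (\<lambda>(x, y). F (inv_into U \<kappa> x, inv_into V \<mu> y)) (at z) (0, w)"
    have "smooth_on (\<kappa> ` U) (\<lambda>x. ?D (x, \<mu> y))"
      using smooth_on_Pair1[OF smooth_on_frechet_derivative[OF smooth_fun_prodD[OF assms(1-3) U h(1)]] _ c(2)]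
        c c' h(2) by (simp add: open_Times)
    then show "smooth_on (\<kappa> ` U) (\<lambda>x. v (\<lambda>y. F (inv_into U \<kappa> x, y)))"
      by (rule smooth_on_cong[OF _ c(2)])
        (use c h(2) h(3)[OF smooth_fun_slice2[OF assms(1-3)]] tangent_slice2_chart[OF assms(1-3) U _ h(1,2)] in auto)
  qed
qed

text \<open>Both sides are mixed second derivatives of the coordinate expression at one point, along
  \<open>(w, 0)\<close> and \<open>(0, w')\<close>; Schwarz's theorem applies.\<close>

lemma tangent_slices_commute:
  assumes "charted A" "charted A'" "smooth_fun (prod_atlas A A') F"
    and "v \<in> tangent_space A x" "v' \<in> tangent_space A' y"
  shows "v (\<lambda>x. v' (\<lambda>y. F (x, y))) = v' (\<lambda>y. v (\<lambda>x. F (x, y)))"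
proof -
  obtain U \<kappa> w where h: "(U, \<kappa>) \<in> A" "x \<in> U"
    "\<And>f. smooth_fun A f \<Longrightarrow> v f = frechet_derivative (\<lambda>x. f (inv_into U \<kappa> x)) (at (\<kappa> x)) w"
    using tangent_spaceE[OF assms(4)] by metis
  obtain V \<mu> w' where h': "(V, \<mu>) \<in> A'" "y \<in> V"
    "\<And>f. smooth_fun A' f \<Longrightarrow> v' f = frechet_derivative (\<lambda>y. f (inv_into V \<mu> y)) (at (\<mu> y)) w'"
    using tangent_spaceE[OF assms(5)] by metis
  note c = chartedD[OF assms(1) h(1)] and c' = chartedD[OF assms(2) h'(1)]
  let ?F = "\<lambda>(x, y). F (inv_into U \<kappa> x, inv_into V \<mu> y)"
  let ?S = "\<kappa> ` U \<times> \<mu> ` V"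
  have sm: "smooth_on ?S ?F" by (rule smooth_fun_prodD[OF assms(1-3) h(1) h'(1)])
  have op: "open ?S" using c c' by (simp add: open_Times)
  have z: "(\<kappa> x, \<mu> y) \<in> ?S" using h(2) h'(2) by blast
  note dd = smooth_on_differentiable[OF smooth_on_frechet_derivative[OF sm] z]
  have "v (\<lambda>x. v' (\<lambda>y. F (x, y))) = frechet_derivative (\<lambda>x. frechet_derivative ?F (at (x, \<mu> y)) (0, w')) (at (\<kappa> x)) w"
  proof -
    have "frechet_derivative ?F (at (a, \<mu> y)) (0, w') = v' (\<lambda>y. F (inv_into U \<kappa> a, y))" if "a \<in> \<kappa> ` U" for a
      using that c h'(3)[OF smooth_fun_slice2[OF assms(1-3)]] tangent_slice2_chart[OF assms(1-3) h(1) _ h'(1,2)] by auto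
    then show ?thesis
      using h(3)[OF smooth_fun_tangent_slice2[OF assms(1-3,5)]] smooth_on_differentiable
        frechet_derivative_transform_within_open[of "\<lambda>x. frechet_derivative ?F (at (x, \<mu> y)) (0, w')" "\<kappa> x" "\<kappa> ` U"
          "\<lambda>a. v' (\<lambda>y. F (inv_into U \<kappa> a, y))"]
        smooth_on_differentiable[OF smooth_on_Pair1[OF smooth_on_frechet_derivative[OF sm] op c(2)], of "\<mu> y" "\<kappa> x" "(0, w')"]
        c(2) h(2) h'(2)
      by simp
  qed
  also have "\<dots> = frechet_derivative (\<lambda>z. frechet_derivative ?F (at z) (0, w')) (at (\<kappa> x, \<mu> y)) (w, 0)"
    by (rule frechet_derivative_Pair1[OF dd])
  also have "\<dots> = frechet_derivative (\<lambda>z. frechet_derivative ?F (at z) (w, 0)) (at (\<kappa> x, \<mu> y)) (0, w')"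
    by (rule frechet_derivative_commute[OF sm op z])
  also have "\<dots> = frechet_derivative (\<lambda>y. frechet_derivative ?F (at (\<kappa> x, y)) (w, 0)) (at (\<mu> y)) w'"
    by (rule frechet_derivative_Pair2[OF dd, symmetric])
  also have "\<dots> = v' (\<lambda>y. v (\<lambda>x. F (x, y)))"
  proof -
    have "frechet_derivative ?F (at (\<kappa> x, b)) (w, 0) = v (\<lambda>x. F (x, inv_into V \<mu> b))" if "b \<in> \<mu> ` V" for b
      using that c' h(3)[OF smooth_fun_slice1[OF assms(1-3)]] tangent_slice1_chart[OF assms(1-3) h(1,2) h'(1)] by auto
    then show ?thesis
      using h'(3)[OF smooth_fun_tangent_slice1[OF assms(1-4)]]
        frechet_derivative_transform_within_open[of "\<lambda>y. frechet_derivative ?F (at (\<kappa> x, y)) (w, 0)" "\<mu> y" "\<mu> ` V"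
          "\<lambda>b. v (\<lambda>x. F (x, inv_into V \<mu> b))"]
        smooth_on_differentiable[OF smooth_on_Pair2[OF smooth_on_frechet_derivative[OF sm] op c'(2)], of "\<kappa> x" "\<mu> y" "(w, 0)"]
        c'(2) h(2) h'(2)
      by simp
  qed
  finally show ?thesis .
qed

text \<open>Applied to the multiplication, this makes left translations smooth maps, along which
  tangent vectors can be pushed.\<close>

lemma smooth_map_slice2:
  assumes "charted A" "charted A'" "charted A''" "smooth_map (prod_atlas A A') A'' F"
  shows "smooth_map A' A'' (\<lambda>y. F (x, y))"
  unfolding smooth_map_def
proof (intro conjI ballI)
  have contF: "continuous_on UNIV F" using assms(4) unfolding smooth_map_def by blast
  then show cont: "continuous_on UNIV (\<lambda>y. F (x, y))"
    by (auto intro!: continuous_on_compose2[of UNIV F] continuous_intros)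
  fix VM assume VM: "VM \<in> A'"
  obtain V \<mu> where V: "VM = (V, \<mu>)" "(V, \<mu>) \<in> A'" using VM by (cases VM) auto
  obtain U \<kappa> where U: "(U, \<kappa>) \<in> A" "x \<in> U" using charted_cover[OF assms(1)] by blast
  show "case VM of (U, \<kappa>) \<Rightarrow> \<forall>(V, \<mu>)\<in>A''. smooth_on (\<kappa> ` (U \<inter> (\<lambda>y. F (x, y)) -` V)) (\<mu> \<circ> (\<lambda>y. F (x, y)) \<circ> inv_into U \<kappa>)"
    unfolding V(1) prod.case
  proof (intro ballI, clarify)
    fix W \<nu> assume W: "(W, \<nu>) \<in> A''"
    note c = chartedD[OF assms(1) U(1)] and c' = chartedD[OF assms(2) V(2)] and oW = chartedD(1)[OF assms(3) W]
    let ?S = "map_prod \<kappa> \<mu> ` ((U \<times> V) \<inter> F -` W)"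
    let ?T = "\<mu> ` (V \<inter> (\<lambda>y. F (x, y)) -` W)"
    have S: "open ?S"
      using contF oW by (intro charted_open_image[OF charted_prod[OF assms(1,2)] prod_atlasI[OF U(1) V(2)]])
        (simp add: open_vimage)
    have T: "open ?T"
      using cont oW by (intro charted_open_image[OF assms(2) V(2)]) (simp add: open_vimage)
    have sm: "smooth_on ?S (\<lambda>z. \<nu> (F (inv_into (U \<times> V) (map_prod \<kappa> \<mu>) z)))"
      by (rule smooth_mapD[OF assms(4) prod_atlasI[OF U(1) V(2)] W])
    have sub: "(\<kappa> x, y) \<in> ?S" if "y \<in> ?T" for y
      using that
    proof (rule imageE)
      fix q assume q: "y = \<mu> q" "q \<in> V \<inter> (\<lambda>y. F (x, y)) -` W"
      then have "(x, q) \<in> (U \<times> V) \<inter> F -` W" "(\<kappa> x, y) = map_prod \<kappa> \<mu> (x, q)" using U(2) by auto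
      then show ?thesis by blast
    qed
    have "smooth_on ?T (\<lambda>y. \<nu> (F (inv_into (U \<times> V) (map_prod \<kappa> \<mu>) (\<kappa> x, y))))"
      by (rule smooth_on_Pair2[OF sm S T sub])
    then show "smooth_on ?T (\<nu> \<circ> (\<lambda>y. F (x, y)) \<circ> inv_into V \<mu>)"
      by (rule smooth_on_cong[OF _ T])
        (use c c' U(2) in \<open>auto simp: inv_into_map_prod\<close>)
  qed
qed

section \<open>Left-invariant frames\<close>

lemma dual_app_Dual: "linear f \<Longrightarrow> dual_app (Dual f) = f"
  using Dual_inverse by blast

lemma dual_eqI: "(\<And>x. dual_app \<alpha> x = dual_app \<beta> x) \<Longrightarrow> \<alpha> = \<beta>"
  by (metis dual_app_inject ext)

lemma linear_dual_app: "linear (dual_app \<alpha>)"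
  using dual_app[of \<alpha>] by simp

lemma linear_sum_scaleR:
  fixes L :: "'a::real_vector \<Rightarrow> real"
  assumes "linear L"
  shows "L (\<Sum>i\<in>I. c i *\<^sub>R x i) = (\<Sum>i\<in>I. c i * L (x i))"
  by (simp add: linear_sum[OF assms] linear_scale[OF assms])

text \<open>With \<open>M\<close> within 1/2 of the identity matrix, \<open>q = c M\<close> gives
  \<open>c = q - c (M - I)\<close>. In the norm given by the sum of absolute values the last term is
  at most half of \<open>c\<close> and is absorbed, hence the factor 2.\<close>

lemma coeff_sum_bound:
  fixes c :: "'i \<Rightarrow> real"
  assumes "finite S" "\<And>j. j \<in> S \<Longrightarrow> q j = (\<Sum>i\<in>S. c i * M i j)"
    and "(\<Sum>i\<in>S. \<Sum>j\<in>S. \<bar>M i j - (if i = j then 1 else 0)\<bar>) \<le> 1 / 2"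
  shows "(\<Sum>i\<in>S. \<bar>c i\<bar>) \<le> 2 * (\<Sum>j\<in>S. \<bar>q j\<bar>)"
proof -
  let ?d = "\<lambda>i j. M i j - (if i = j then 1 else 0)"
  have c: "c j = q j - (\<Sum>i\<in>S. c i * ?d i j)" if "j \<in> S" for j
  proof -
    have "(\<Sum>i\<in>S. c i * ?d i j) = q j - (\<Sum>i\<in>S. if i = j then c i else 0)"
      unfolding assms(2)[OF that] sum_subtractf[symmetric] by (rule sum.cong) (auto simp: algebra_simps)
    then show ?thesis using that assms(1) by simp
  qed
  have row: "(\<Sum>j\<in>S. \<bar>?d i j\<bar>) \<le> 1 / 2" if "i \<in> S" for i
  proof -
    have "(\<Sum>j\<in>S. \<bar>?d i j\<bar>) \<le> (\<Sum>i\<in>S. \<Sum>j\<in>S. \<bar>?d i j\<bar>)"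
      by (rule member_le_sum[OF that _ assms(1)]) (simp add: sum_nonneg)
    then show ?thesis using assms(3) by linarith
  qed
  have "(\<Sum>j\<in>S. \<bar>c j\<bar>) \<le> (\<Sum>j\<in>S. \<bar>q j\<bar> + (\<Sum>i\<in>S. \<bar>c i\<bar> * \<bar>?d i j\<bar>))"
  proof (rule sum_mono)
    fix j assume "j \<in> S"
    then have "\<bar>c j\<bar> \<le> \<bar>q j\<bar> + \<bar>\<Sum>i\<in>S. c i * ?d i j\<bar>"
      by (subst c) linarith+
    also have "\<bar>\<Sum>i\<in>S. c i * ?d i j\<bar> \<le> (\<Sum>i\<in>S. \<bar>c i\<bar> * \<bar>?d i j\<bar>)"
      unfolding abs_mult[symmetric] by (rule sum_abs)
    finally show "\<bar>c j\<bar> \<le> \<bar>q j\<bar> + (\<Sum>i\<in>S. \<bar>c i\<bar> * \<bar>?d i j\<bar>)" by simp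
  qed
  also have "\<dots> = (\<Sum>j\<in>S. \<bar>q j\<bar>) + (\<Sum>i\<in>S. \<bar>c i\<bar> * (\<Sum>j\<in>S. \<bar>?d i j\<bar>))"
    unfolding sum.distrib sum_distrib_left by (subst sum.swap) simp
  also have "\<dots> \<le> (\<Sum>j\<in>S. \<bar>q j\<bar>) + (\<Sum>i\<in>S. \<bar>c i\<bar> * (1 / 2))"
    by (intro add_left_mono sum_mono mult_left_mono row) auto
  finally show ?thesis by (simp add: sum_divide_distrib[symmetric])
qed

locale lie_group_with_algebra =
  fixes H :: "('m::{t2_space,second_countable_topology}) monoid" (structure)
    and A :: "('m, 'e::real_inner) atlas"
    and brh :: "'h::real_vector \<Rightarrow> 'h \<Rightarrow> 'h"
    and lft :: "'h \<Rightarrow> 'm vfield"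
  assumes lie_group: "lie_group H A"
    and lie_algebra_of_group: "lie_algebra_of_group H A brh lft"
begin

lemma manifold: "smooth_manifold A"
  and group_H: "group H"
  and carrier_H: "carrier H = UNIV"
  and smooth_mult_map: "smooth_map (prod_atlas A A) A (\<lambda>(x, y). x \<otimes> y)"
  using lie_group unfolding lie_group_def by simp_all

lemma charted: "charted A"
  by (rule smooth_manifold_charted[OF manifold])

lemma group_simps [simp]:
  "x \<otimes> \<one> = x" "\<one> \<otimes> x = x" "inv x \<otimes> x = \<one>" "x \<otimes> inv x = \<one>"
  "(x \<otimes> y) \<otimes> z = x \<otimes> (y \<otimes> z)" "x \<otimes> (inv x \<otimes> y) = y" "inv x \<otimes> (x \<otimes> y) = y"
proof -
  interpret group H by (rule group_H)
  have c: "z \<in> carrier H" for z by (simp add: carrier_H)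
  show "x \<otimes> \<one> = x" "\<one> \<otimes> x = x" "inv x \<otimes> x = \<one>" "x \<otimes> inv x = \<one>"
    using c by simp_all
  show "(x \<otimes> y) \<otimes> z = x \<otimes> (y \<otimes> z)" by (rule m_assoc[OF c c c])
  show "x \<otimes> (inv x \<otimes> y) = y" "inv x \<otimes> (x \<otimes> y) = y"
    using c by (simp_all add: m_assoc[symmetric])
qed

abbreviation smooth :: "('m \<Rightarrow> real) \<Rightarrow> bool" where "smooth \<equiv> smooth_fun A"

lemmas smooth_intros = smooth_fun_const smooth_fun_add[OF charted] smooth_fun_mult[OF charted]
  smooth_fun_diff[OF charted] smooth_fun_sum[OF charted]

lemma smooth_mult: "smooth f \<Longrightarrow> smooth_fun (prod_atlas A A) (\<lambda>z. f (fst z \<otimes> snd z))"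
  using smooth_fun_compose[OF charted_prod[OF charted charted] manifold smooth_mult_map]
  by (simp add: case_prod_unfold)

lemma smooth_left_translate: "smooth f \<Longrightarrow> smooth (\<lambda>x. f (a \<otimes> x))"
  using smooth_fun_slice2[OF charted charted smooth_mult, of f a] by simp

text \<open>Vectors are 0 on nonsmooth functions, so a translated vector is again a vector only if
  translation preserves nonsmoothness too; translating back by \<open>inv a\<close> shows
  this.\<close>

lemma smooth_left_translate_iff: "smooth (\<lambda>x. f (a \<otimes> x)) \<longleftrightarrow> smooth f"
  using smooth_left_translate[of f a] smooth_left_translate[of "\<lambda>x. f (a \<otimes> x)" "inv a"] by auto

lemma smooth_tangent_left_translate:
  "smooth f \<Longrightarrow> v \<in> tangent_space A b \<Longrightarrow> smooth (\<lambda>a. v (\<lambda>x. f (a \<otimes> x)))"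
  using smooth_fun_tangent_slice2[OF charted charted smooth_mult, of f] by simp

lemma smooth_tangent_right_translate:
  "smooth f \<Longrightarrow> v \<in> tangent_space A a \<Longrightarrow> smooth (\<lambda>b. v (\<lambda>x. f (x \<otimes> b)))"
  using smooth_fun_tangent_slice1[OF charted charted smooth_mult, of f] by simp

lemma tangent_translates_commute:
  assumes "smooth f" "v \<in> tangent_space A a" "w \<in> tangent_space A b"
  shows "v (\<lambda>x. w (\<lambda>y. f (x \<otimes> y))) = w (\<lambda>y. v (\<lambda>x. f (x \<otimes> y)))"
  using tangent_slices_commute[OF charted charted smooth_mult[OF assms(1)] assms(2,3)] by simp

lemma tangent_left_translate:
  assumes "v \<in> tangent_space A p"
  shows "(\<lambda>f. v (\<lambda>x. f (a \<otimes> x))) \<in> tangent_space A (a \<otimes> p)"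
proof -
  obtain V \<mu> where V: "(V, \<mu>) \<in> A" "a \<otimes> p \<in> V" using charted_cover[OF charted] by blast
  have "smooth_map A A (\<lambda>x. a \<otimes> x)"
    using smooth_map_slice2[OF charted charted charted smooth_mult_map, of a] by simp
  from tangent_pushforward[OF charted manifold this assms V]
  obtain w where "\<And>f. smooth f \<Longrightarrow>
    v (\<lambda>p. f (a \<otimes> p)) = frechet_derivative (\<lambda>x. f (inv_into V \<mu> x)) (at (\<mu> (a \<otimes> p))) w"
    by blast
  then show ?thesis
    by (rule tangent_spaceI[OF V])
      (simp_all add: tangent_nonsmooth[OF assms] smooth_left_translate_iff)
qed

section \<open>Left-invariant vector fields and their values at the unit\<close>

lemma lft_vector_field: "vector_field A (lft X)"
  and lft_left_invariant: "left_invariant H A (lft X)"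
  using lie_algebra_of_group unfolding lie_algebra_of_group_def bij_betw_def by blast+

lemma lft_tangent: "(\<lambda>f. lft X f p) \<in> tangent_space A p"
  using lft_vector_field unfolding vector_field_def by blast

lemma lft_smooth: "smooth f \<Longrightarrow> smooth (lft X f)"
  using lft_vector_field unfolding vector_field_def by blast

lemma lft_left_translate: "smooth f \<Longrightarrow> lft X (\<lambda>x. f (a \<otimes> x)) p = lft X f (a \<otimes> p)"
  using lft_left_invariant unfolding left_invariant_def by blast

lemma lft_at: "smooth f \<Longrightarrow> lft X f a = lft X (\<lambda>x. f (a \<otimes> x)) \<one>"
  by (simp add: lft_left_translate)

lemma linear_lft: "linear (\<lambda>X. lft X f p)"
  using lie_algebra_of_group unfolding lie_algebra_of_group_def by blast

lemma lft_commutator: "lft (brh X Y) = commutator (lft X) (lft Y)"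
  using lie_algebra_of_group unfolding lie_algebra_of_group_def by blast

lemma inj_lft: "lft X = lft Y \<Longrightarrow> X = Y"
  using lie_algebra_of_group unfolding lie_algebra_of_group_def bij_betw_def by (metis UNIV_I inj_onD)

lemma lft_surj: "vector_field A V \<Longrightarrow> left_invariant H A V \<Longrightarrow> \<exists>X. lft X = V"
  using lie_algebra_of_group unfolding lie_algebra_of_group_def bij_betw_def by (metis (mono_tags) imageE mem_Collect_eq)

lemmas lft_nonsmooth = tangent_nonsmooth[OF lft_tangent]
  and lft_const = tangent_const[OF lft_tangent]
  and lft_plus = tangent_add[OF charted lft_tangent]
  and lft_times = tangent_mult[OF charted lft_tangent]
  and lft_scale = tangent_scale[OF charted lft_tangent]
  and lft_minus = tangent_diff[OF charted lft_tangent]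
  and lft_sum = tangent_sum[OF charted lft_tangent]

text \<open>Left translation moves the value at \<open>p\<close> to the unit. This is the
  extensionality rule that reduces identities in \<open>'h\<close> to identities between
  numbers.\<close>

lemma lft_eqI:
  assumes "\<And>f. smooth f \<Longrightarrow> lft X f \<one> = lft Y f \<one>"
  shows "X = Y"
proof (rule inj_lft, intro ext)
  fix f p
  show "lft X f p = lft Y f p"
    using assms[OF smooth_left_translate, of f p] lft_at[of f _ p] lft_nonsmooth by (cases "smooth f") auto
qed

text \<open>Left translation spreads \<open>v\<close> over the group: \<open>V f a\<close> is a
  partial derivative of \<open>f (a \<otimes> x)\<close> in \<open>x\<close> at the unit, hence
  smooth in \<open>a\<close>. Surjectivity of \<open>lft\<close> then supplies
  \<open>X\<close>.\<close>

lemma tangent_at_one_lft: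
  assumes v: "v \<in> tangent_space A \<one>"
  obtains X where "\<And>f. lft X f \<one> = v f"
proof -
  define V where "V = (\<lambda>f a. v (\<lambda>x. f (a \<otimes> x)))"
  have "vector_field A V"
    unfolding vector_field_def V_def
    using tangent_left_translate[OF v] smooth_tangent_left_translate[OF _ v] by simp
  moreover have "left_invariant H A V"
    unfolding left_invariant_def V_def by simp
  ultimately obtain X where "lft X = V" using lft_surj by blast
  then have "lft X f \<one> = v f" for f by (simp add: V_def)
  then show thesis by (rule that)
qed

lemma tangent_lft:
  assumes v: "v \<in> tangent_space A p"
  obtains X where "\<And>f. lft X f p = v f"
proof -
  have "(\<lambda>f. v (\<lambda>x. f (inv p \<otimes> x))) \<in> tangent_space A \<one>"
    using tangent_left_translate[OF v, of "inv p"] by simp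
  then obtain X where X: "\<And>f. lft X f \<one> = v (\<lambda>x. f (inv p \<otimes> x))"
    by (rule tangent_at_one_lft) blast
  have "lft X f p = v f" for f
  proof (cases "smooth f")
    case True
    then show ?thesis using lft_at[of f X p] X[of "\<lambda>x. f (p \<otimes> x)"] by simp
  qed (simp add: lft_nonsmooth tangent_nonsmooth[OF v])
  then show thesis by (rule that)
qed

section \<open>A basis of the Lie algebra and functions dual to it at the unit\<close>

text \<open>Finite dimension is inherited from the model space: each chart direction
  \<open>w\<close> at the unit is the value there of some \<open>lft (X w)\<close>, and the
  \<open>X b\<close>, for \<open>b\<close> in an orthonormal basis \<open>C\<close> of the model
  space, span \<open>'h\<close>.\<close>

lemma basis_exists: "\<exists>S :: 'h set. is_basis S"
proof -
  obtain U \<kappa> where U: "(U, \<kappa>) \<in> A" "\<one> \<in> U" using charted_cover[OF charted] by blast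
  obtain E :: "'e set" where E: "is_basis E"
    using manifold[unfolded smooth_manifold_def, THEN conjunct1] by blast
  obtain C :: "'e set" where C: "finite C" "\<And>x. (\<Sum>b\<in>C. (x \<bullet> b) *\<^sub>R b) = x"
    using finite_dim_orthonormal_basis[OF E] by blast
  have "\<exists>X. \<forall>f. smooth f \<longrightarrow> lft X f \<one> = frechet_derivative (\<lambda>x. f (inv_into U \<kappa> x)) (at (\<kappa> \<one>)) w" for w
  proof -
    let ?v = "\<lambda>f. if smooth f then frechet_derivative (\<lambda>x. f (inv_into U \<kappa> x)) (at (\<kappa> \<one>)) w else 0"
    have "?v \<in> tangent_space A \<one>" by (rule tangent_spaceI[OF U]) auto
    then obtain X where "\<And>f. lft X f \<one> = ?v f" by (rule tangent_at_one_lft) blast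
    then show ?thesis by (intro exI[of _ X]) simp
  qed
  then obtain X where X: "\<And>w f. smooth f \<Longrightarrow>
      lft (X w) f \<one> = frechet_derivative (\<lambda>x. f (inv_into U \<kappa> x)) (at (\<kappa> \<one>)) w"
    by metis
  have "Y \<in> span (X ` C)" for Y
  proof -
    obtain w where w: "\<And>f. smooth f \<Longrightarrow> lft Y f \<one> = frechet_derivative (\<lambda>x. f (inv_into U \<kappa> x)) (at (\<kappa> \<one>)) w"
      using tangent_space_chart[OF manifold lft_tangent U] by metis
    have "Y = (\<Sum>b\<in>C. (w \<bullet> b) *\<^sub>R X b)"
    proof (rule lft_eqI)
      fix f assume f: "smooth f"
      have lin: "linear (frechet_derivative (\<lambda>x. f (inv_into U \<kappa> x)) (at (\<kappa> \<one>)))"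
        using smooth_on_differentiable[OF smooth_funD[OF f U(1)]] U(2) by (auto intro!: linear_frechet_derivative)
      have "lft (\<Sum>b\<in>C. (w \<bullet> b) *\<^sub>R X b) f \<one> = (\<Sum>b\<in>C. (w \<bullet> b) * lft (X b) f \<one>)"
        by (rule linear_sum_scaleR[OF linear_lft])
      also have "\<dots> = frechet_derivative (\<lambda>x. f (inv_into U \<kappa> x)) (at (\<kappa> \<one>)) (\<Sum>b\<in>C. (w \<bullet> b) *\<^sub>R b)"
        unfolding linear_sum_scaleR[OF lin] by (simp add: X[OF f])
      finally show "lft Y f \<one> = lft (\<Sum>b\<in>C. (w \<bullet> b) *\<^sub>R X b) f \<one>"
        by (simp add: w[OF f] C(2))
    qed
    moreover have "(\<Sum>b\<in>C. (w \<bullet> b) *\<^sub>R X b) \<in> span (X ` C)"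
      by (intro span_sum span_scale span_base imageI)
    ultimately show ?thesis by simp
  qed
  then have sp: "span (X ` C) = UNIV" by auto
  obtain S where S: "S \<subseteq> X ` C" "independent S" "X ` C \<subseteq> span S"
    using maximal_independent_subset[of "X ` C"] by metis
  have "span S = UNIV" using S(3) sp by (metis span_mono span_span top.extremum_uniqueI)
  moreover have "finite S" using S(1) C(1) finite_subset by blast
  ultimately show ?thesis using S(2) unfolding is_basis_def by blast
qed

definition Bs :: "'h set" where "Bs = (SOME S. is_basis S)"

lemma Bs: "finite Bs" "independent Bs" "span Bs = UNIV"
  using someI_ex[OF basis_exists] unfolding Bs_def is_basis_def by blast+

lemma sum_representation: "(\<Sum>b\<in>Bs. representation Bs X b *\<^sub>R b) = X"
  by (rule sum_representation_eq[OF Bs(2) _ Bs(1)]) (simp_all add: Bs)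

lemma linear_expand:
  fixes L :: "'h \<Rightarrow> real"
  assumes "linear L"
  shows "L X = (\<Sum>b\<in>Bs. representation Bs X b * L b)"
proof -
  have "L X = L (\<Sum>b\<in>Bs. representation Bs X b *\<^sub>R b)" by (simp only: sum_representation)
  then show ?thesis by (simp only: linear_sum_scaleR[OF assms])
qed

text \<open>A dual basis is built by adjoining one vector at a time. Smooth functions can serve as
  functionals because by \<open>lft_eqI\<close> they separate the points of
  \<open>'h\<close>.\<close>

lemma separating_functions:
  assumes "finite S" "independent (S :: 'h set)"
  shows "\<exists>\<phi>. \<forall>s\<in>S. smooth (\<phi> s) \<and> (\<forall>r\<in>S. lft r (\<phi> s) \<one> = (if r = s then 1 else 0))"
  using assms
proof (induction S rule: finite_induct)
  case (insert x S)
  then have "independent S" and xS: "x \<notin> span S"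
    using independent_insert by (metis insert.hyps(2))+
  then obtain \<phi> where \<phi>: "\<And>s. s \<in> S \<Longrightarrow> smooth (\<phi> s)"
    "\<And>r s. r \<in> S \<Longrightarrow> s \<in> S \<Longrightarrow> lft r (\<phi> s) \<one> = (if r = s then 1 else 0)"
    using insert.IH by blast
  \<comment> \<open>The vector of \<open>span S\<close> that the functions \<open>\<phi> s\<close>
    do not distinguish from \<open>x\<close> at the unit.\<close>
  define x' where "x' = (\<Sum>s\<in>S. lft x (\<phi> s) \<one> *\<^sub>R s)"
  have "x' \<in> span S" unfolding x'_def by (intro span_sum span_scale span_base)
  then have "x \<noteq> x'" using xS by auto
  then obtain f where f: "smooth f" "lft x f \<one> \<noteq> lft x' f \<one>" using lft_eqI by blast
  have x'f: "lft x' f \<one> = (\<Sum>s\<in>S. lft x (\<phi> s) \<one> * lft s f \<one>)"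
    unfolding x'_def by (rule linear_sum_scaleR[OF linear_lft])
  \<comment> \<open>\<open>f\<close> without its part visible on \<open>S\<close>: the vectors of
    \<open>S\<close> annihilate \<open>g\<close> at the unit, and \<open>lft x g \<one>\<close> is
    the nonzero difference of the values of \<open>x\<close> and \<open>x'\<close> on
    \<open>f\<close>.\<close>
  define g where "g = (\<lambda>p. f p - (\<Sum>s\<in>S. lft s f \<one> * \<phi> s p))"
  have g: "smooth g" unfolding g_def by (intro smooth_intros f \<phi>)
  have lg: "lft r g \<one> = lft r f \<one> - (\<Sum>s\<in>S. lft s f \<one> * lft r (\<phi> s) \<one>)" for r
    unfolding g_def by (simp add: lft_minus lft_sum lft_scale smooth_intros f \<phi>)
  have gS: "lft r g \<one> = 0" if "r \<in> S" for r
  proof -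
    have "(\<Sum>s\<in>S. lft s f \<one> * lft r (\<phi> s) \<one>) = (\<Sum>s\<in>S. if s = r then lft s f \<one> else 0)"
      by (rule sum.cong) (use \<phi>(2) that in auto)
    then show ?thesis using lg that insert.hyps(1) by simp
  qed
  have gx: "lft x g \<one> \<noteq> 0" using lg[of x] x'f f(2) by (simp add: mult.commute)
  \<comment> \<open>Rescaled, \<open>g\<close> is dual to \<open>x\<close>; each old function loses
    the multiple of \<open>g\<close> that makes \<open>x\<close> annihilate it.\<close>
  define \<psi> where "\<psi> = (\<lambda>s p. if s = x then (1 / lft x g \<one>) * g p
    else \<phi> s p - (lft x (\<phi> s) \<one> / lft x g \<one>) * g p)"
  have "smooth (\<psi> s) \<and> (\<forall>r\<in>insert x S. lft r (\<psi> s) \<one> = (if r = s then 1 else 0))" if "s \<in> insert x S" for s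
  proof (cases "s = x")
    case True
    have eq: "\<psi> s = (\<lambda>p. (1 / lft x g \<one>) * g p)" unfolding \<psi>_def using True by simp
    have "smooth (\<psi> s)" unfolding eq by (intro smooth_intros g)
    moreover have "lft r (\<psi> s) \<one> = (1 / lft x g \<one>) * lft r g \<one>" for r
      unfolding eq by (rule lft_scale[OF g])
    ultimately show ?thesis
      using True gx gS insert.hyps(2) by auto
  next
    case False
    then have s: "s \<in> S" using that by simp
    have eq: "\<psi> s = (\<lambda>p. \<phi> s p - (lft x (\<phi> s) \<one> / lft x g \<one>) * g p)" using False by (simp add: \<psi>_def)
    have sm: "smooth (\<lambda>p. (lft x (\<phi> s) \<one> / lft x g \<one>) * g p)" by (intro smooth_intros g)
    have "lft r (\<psi> s) \<one> = lft r (\<phi> s) \<one> - (lft x (\<phi> s) \<one> / lft x g \<one>) * lft r g \<one>" for r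
      unfolding eq lft_minus[OF \<phi>(1)[OF s] sm] lft_scale[OF g] ..
    moreover have "smooth (\<psi> s)" unfolding eq by (intro smooth_intros g \<phi>(1) s)
    ultimately show ?thesis using s gS gx \<phi>(2) False insert.hyps(2) by auto
  qed
  then show ?case by blast
qed simp

text \<open>Global functions whose differentials at the unit form the basis dual to \<open>Bs\<close>. They come from linear
  algebra alone, because left-invariant fields are separated by their values at the unit on smooth functions;
  so no bump functions are needed.\<close>

definition coframe :: "'h \<Rightarrow> 'm \<Rightarrow> real" where
  "coframe = (SOME \<phi>. \<forall>s\<in>Bs. smooth (\<phi> s) \<and> (\<forall>r\<in>Bs. lft r (\<phi> s) \<one> = (if r = s then 1 else 0)))"

lemma coframe:
  shows "s \<in> Bs \<Longrightarrow> smooth (coframe s)"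
    and "r \<in> Bs \<Longrightarrow> s \<in> Bs \<Longrightarrow> lft r (coframe s) \<one> = (if r = s then 1 else 0)"
  using someI_ex[OF separating_functions[OF Bs(1,2)]] unfolding coframe_def by blast+

abbreviation d :: "('m \<Rightarrow> real) \<Rightarrow> 'h dual" where "d \<equiv> diff_at_one H lft"

lemma dual_app_d: "dual_app (d f) X = lft X f \<one>"
  unfolding diff_at_one_def by (simp add: dual_app_Dual linear_lft)

lemma lft_cf:
  assumes "b \<in> Bs" shows "lft X (coframe b) \<one> = representation Bs X b"
proof -
  have "lft X (coframe b) \<one> = (\<Sum>c\<in>Bs. representation Bs X c * lft c (coframe b) \<one>)"
    by (rule linear_expand[OF linear_lft])
  also have "\<dots> = (\<Sum>c\<in>Bs. if c = b then representation Bs X c else 0)"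
    by (rule sum.cong) (use coframe assms in auto)
  finally show ?thesis using assms Bs by simp
qed

text \<open>Lets identities between tensors on \<open>'h\<close> be tested on differentials of
  global functions, where \<delta> is a derivative of \<pi>.\<close>

lemma d_surj: obtains f where "smooth f" "d f = \<alpha>"
proof
  let ?f = "\<lambda>p. \<Sum>b\<in>Bs. dual_app \<alpha> b * coframe b p"
  show "smooth ?f" by (intro smooth_intros coframe)
  show "d ?f = \<alpha>"
  proof (rule dual_eqI)
    fix X
    have "lft X ?f \<one> = (\<Sum>b\<in>Bs. dual_app \<alpha> b * representation Bs X b)"
      by (simp add: lft_sum lft_scale smooth_intros coframe lft_cf)
    then show "dual_app (d ?f) X = dual_app \<alpha> X"
      by (simp add: dual_app_d linear_expand[OF linear_dual_app, of \<alpha> X] mult.commute)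
  qed
qed

lemma dual_expand: "\<alpha> = (\<Sum>b\<in>Bs. dual_app \<alpha> b *\<^sub>R d (coframe b))"
proof (rule dual_eqI)
  fix X :: 'h
  have l: "linear (\<lambda>\<alpha>. dual_app \<alpha> X)"
    by (rule linearI) (simp_all add: plus_dual.rep_eq scaleR_dual.rep_eq)
  show "dual_app \<alpha> X = dual_app (\<Sum>b\<in>Bs. dual_app \<alpha> b *\<^sub>R d (coframe b)) X"
    unfolding linear_sum_scaleR[OF l]
    by (simp add: dual_app_d lft_cf linear_expand[OF linear_dual_app, of \<alpha> X] mult.commute)
qed

lemma d_add: "smooth f \<Longrightarrow> smooth g \<Longrightarrow> d (\<lambda>p. f p + g p) = d f + d g"
  by (rule dual_eqI) (simp add: dual_app_d lft_plus plus_dual.rep_eq)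

lemma d_scale: "smooth f \<Longrightarrow> d (\<lambda>p. c * f p) = c *\<^sub>R d f"
  by (rule dual_eqI) (simp add: dual_app_d lft_scale scaleR_dual.rep_eq)

lemma tangent_expand:
  assumes "v \<in> tangent_space A p"
  obtains c where "\<And>f. v f = (\<Sum>b\<in>Bs. c b * lft b f p)"
proof -
  obtain X where X: "\<And>f. lft X f p = v f" using assms by (rule tangent_lft) blast
  have "v f = (\<Sum>b\<in>Bs. representation Bs X b * lft b f p)" for f
    using linear_expand[OF linear_lft[of f p], of X] X by simp
  then show thesis by (rule that)
qed

text \<open>After the two derivatives are interchanged, left invariance turns the inner one into
  \<open>lft Y f\<close>. This removes right translates from the multiplicativity
  identities.\<close>

lemma lft_tangent_right_translate:
  assumes "smooth f" "v \<in> tangent_space A a"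
  shows "lft Y (\<lambda>b. v (\<lambda>x. f (x \<otimes> b))) \<one> = v (lft Y f)"
proof -
  have "lft Y (\<lambda>b. v (\<lambda>x. f (x \<otimes> b))) \<one> = v (\<lambda>x. lft Y (\<lambda>b. f (x \<otimes> b)) \<one>)"
    by (rule tangent_translates_commute[OF assms lft_tangent, symmetric])
  then show ?thesis by (simp add: lft_at[OF assms(1), symmetric])
qed

section \<open>Linearisation at the unit of fields that vanish there\<close>

text \<open>The values of \<open>Qp\<close> on the coframe form a linear system for the coefficients
  \<open>c\<close> whose matrix is close to the identity, so \<open>coeff_sum_bound\<close>
  estimates \<open>c\<close> whatever its dependence on \<open>p\<close>.\<close>

lemma frame_bound:
  assumes "\<And>f. smooth f \<Longrightarrow> Qp f = (\<Sum>b\<in>Bs. c b * lft b f p)"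
    and "(\<Sum>b\<in>Bs. \<Sum>b'\<in>Bs. \<bar>lft b (coframe b') p - (if b = b' then 1 else 0)\<bar>) \<le> 1 / 2"
    and "smooth f"
  shows "\<bar>Qp f\<bar> \<le> 2 * (\<Sum>b\<in>Bs. \<bar>Qp (coframe b)\<bar>) * (\<Sum>b\<in>Bs. \<bar>lft b f p\<bar>)"
proof -
  have c: "(\<Sum>b\<in>Bs. \<bar>c b\<bar>) \<le> 2 * (\<Sum>b\<in>Bs. \<bar>Qp (coframe b)\<bar>)"
    by (rule coeff_sum_bound[OF Bs(1) _ assms(2)]) (simp add: assms(1) coframe)
  have "\<bar>Qp f\<bar> \<le> (\<Sum>b\<in>Bs. \<bar>c b\<bar> * \<bar>lft b f p\<bar>)"
    unfolding assms(1)[OF assms(3)] abs_mult[symmetric] by (rule sum_abs)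
  also have "\<dots> \<le> (\<Sum>b\<in>Bs. (\<Sum>b\<in>Bs. \<bar>c b\<bar>) * \<bar>lft b f p\<bar>)"
    by (intro sum_mono mult_right_mono member_le_sum[OF _ _ Bs(1)]) auto
  also have "\<dots> = (\<Sum>b\<in>Bs. \<bar>c b\<bar>) * (\<Sum>b\<in>Bs. \<bar>lft b f p\<bar>)"
    by (simp add: sum_distrib_left)
  also have "\<dots> \<le> 2 * (\<Sum>b\<in>Bs. \<bar>Qp (coframe b)\<bar>) * (\<Sum>b\<in>Bs. \<bar>lft b f p\<bar>)"
    by (intro mult_right_mono c sum_nonneg) auto
  finally show ?thesis .
qed

text \<open>By \<open>frame_bound\<close>, near the unit \<open>Q f\<close> is at most a product of two factors vanishing there.\<close>

lemma tangent_comp_first_order_zero: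
  assumes frame: "\<And>p. \<exists>c. \<forall>f. smooth f \<longrightarrow> Q f p = (\<Sum>b\<in>Bs. c b * lft b f p)"
    and smooth_Q: "\<And>f. smooth f \<Longrightarrow> smooth (Q f)"
    and Q_one: "\<And>f. smooth f \<Longrightarrow> Q f \<one> = 0"
    and f: "smooth f" "d f = 0"
    and v: "v \<in> tangent_space A \<one>"
  shows "v (Q f) = 0"
  using v
proof (rule tangent_spaceE)
  fix U \<kappa> w assume U: "(U, \<kappa>) \<in> A" "\<one> \<in> U"
    and vw: "\<And>f. smooth f \<Longrightarrow> v f = frechet_derivative (\<lambda>x. f (inv_into U \<kappa> x)) (at (\<kappa> \<one>)) w"
  \<comment> \<open>A straight line in the chart with velocity \<open>w\<close>; only its behaviour
    near \<open>s = 0\<close> enters.\<close>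
  define \<gamma> where "\<gamma> = (\<lambda>s. inv_into U \<kappa> (\<kappa> \<one> + s *\<^sub>R w))"
  have \<gamma>0: "\<gamma> 0 = \<one>" using chartedD(3)[OF charted U(1)] U(2) by (simp add: \<gamma>_def)
  have der: "((\<lambda>s. g (\<gamma> s)) has_real_derivative v g) (at 0)" if "smooth g" for g
    using has_real_derivative_line[of "\<lambda>x. g (inv_into U \<kappa> x)" "\<kappa> \<one>" 0 w]
      smooth_on_differentiable[OF smooth_funD[OF that U(1)]] U(2) vw[OF that]
    by (simp add: \<gamma>_def)
  have lim: "((\<lambda>s. g (\<gamma> s)) \<longlongrightarrow> g \<one>) (at 0)" if "smooth g" for g
    using DERIV_isCont[OF der[OF that]] \<gamma>0 unfolding isCont_def by simp
  have quot: "((\<lambda>s. g (\<gamma> s) / s) \<longlongrightarrow> v g) (at 0)" if "smooth g" "g \<one> = 0" for g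
    using der[OF that(1)] \<gamma>0 that(2) unfolding DERIV_def by simp
  have df: "lft b f \<one> = 0" for b
    using f(2) dual_app_d[of f b] by (simp add: zero_dual.rep_eq)
  let ?M = "\<lambda>s. \<Sum>b\<in>Bs. \<Sum>b'\<in>Bs. \<bar>lft b (coframe b') (\<gamma> s) - (if b = b' then 1 else 0)\<bar>"
  have "((\<lambda>s. ?M s) \<longlongrightarrow> (\<Sum>b\<in>Bs. \<Sum>b'\<in>Bs. \<bar>lft b (coframe b') \<one> - (if b = b' then 1 else 0)\<bar>)) (at 0)"
    by (intro tendsto_sum tendsto_rabs tendsto_diff tendsto_const lim lft_smooth coframe)
  also have "(\<Sum>b\<in>Bs. \<Sum>b'\<in>Bs. \<bar>lft b (coframe b') \<one> - (if b = b' then 1 else 0)\<bar>) = 0"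
    by (simp add: coframe)
  \<comment> \<open>At the unit the matrix is the identity, so \<open>frame_bound\<close> applies
    for all small nonzero \<open>s\<close>.\<close>
  finally have "\<forall>\<^sub>F s in at 0. ?M s < 1 / 2"
    by (rule order_tendstoD(2)) simp
  then have "\<forall>\<^sub>F s in at 0. norm (Q f (\<gamma> s) / s) \<le>
      2 * (\<Sum>b\<in>Bs. \<bar>Q (coframe b) (\<gamma> s)\<bar>) * (\<Sum>b\<in>Bs. \<bar>lft b f (\<gamma> s) / s\<bar>)"
  proof eventually_elim
    case (elim s)
    obtain c where "\<And>f. smooth f \<Longrightarrow> Q f (\<gamma> s) = (\<Sum>b\<in>Bs. c b * lft b f (\<gamma> s))"
      using frame by blast
    from frame_bound[where Qp="\<lambda>f. Q f (\<gamma> s)", OF this _ f(1)] elim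
    have "\<bar>Q f (\<gamma> s)\<bar> \<le> 2 * (\<Sum>b\<in>Bs. \<bar>Q (coframe b) (\<gamma> s)\<bar>) * (\<Sum>b\<in>Bs. \<bar>lft b f (\<gamma> s)\<bar>)"
      by simp
    then have "\<bar>Q f (\<gamma> s)\<bar> / \<bar>s\<bar> \<le> 2 * (\<Sum>b\<in>Bs. \<bar>Q (coframe b) (\<gamma> s)\<bar>) * (\<Sum>b\<in>Bs. \<bar>lft b f (\<gamma> s)\<bar>) / \<bar>s\<bar>"
      by (rule divide_right_mono) simp
    then show ?case
      by (simp add: abs_divide sum_divide_distrib[symmetric])
  qed
  \<comment> \<open>The division by \<open>s\<close> is spent on \<open>lft b f\<close>, which
    vanishes at the unit since \<open>d f = 0\<close>, so that the quotient converges. The other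
    factor tends to 0 because \<open>Q\<close> vanishes at the unit.\<close>
  moreover have "((\<lambda>s. 2 * (\<Sum>b\<in>Bs. \<bar>Q (coframe b) (\<gamma> s)\<bar>) * (\<Sum>b\<in>Bs. \<bar>lft b f (\<gamma> s) / s\<bar>)) \<longlongrightarrow>
      2 * (\<Sum>b\<in>Bs. \<bar>Q (coframe b) \<one>\<bar>) * (\<Sum>b\<in>Bs. \<bar>v (lft b f)\<bar>)) (at 0)"
    by (intro tendsto_mult tendsto_const tendsto_sum tendsto_rabs lim quot smooth_Q coframe lft_smooth f df)
  then have "((\<lambda>s. 2 * (\<Sum>b\<in>Bs. \<bar>Q (coframe b) (\<gamma> s)\<bar>) * (\<Sum>b\<in>Bs. \<bar>lft b f (\<gamma> s) / s\<bar>)) \<longlongrightarrow> 0) (at 0)"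
    by (simp add: Q_one coframe)
  ultimately have "((\<lambda>s. Q f (\<gamma> s) / s) \<longlongrightarrow> 0) (at 0)"
    by (rule Lim_null_comparison)
  with quot[OF smooth_Q[OF f(1)] Q_one[OF f(1)]] show "v (Q f) = 0"
    using tendsto_unique[OF at_neq_bot] by blast
qed

text \<open>The frame hypothesis says that on smooth functions \<open>Q\<close> is a tangent vector
  at each point. It fits \<open>\<rho> u\<close> as well as \<open>\<pi>\<close> with one smooth
  argument fixed, so the lemmas that carry it linearise both.\<close>

lemma frame_linear:
  assumes frame: "\<And>p. \<exists>c. \<forall>f. smooth f \<longrightarrow> Q f p = (\<Sum>b\<in>Bs. c b * lft b f p)"
    and "smooth f" "smooth g"
  shows "Q (\<lambda>p. f p + c * g p) = (\<lambda>p. Q f p + c * Q g p)"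
proof
  fix p
  obtain a where "\<And>f. smooth f \<Longrightarrow> Q f p = (\<Sum>b\<in>Bs. a b * lft b f p)" using frame by blast
  then show "Q (\<lambda>p. f p + c * g p) p = Q f p + c * Q g p"
    by (simp add: assms(2,3) smooth_intros lft_plus lft_scale sum.distrib sum_distrib_left algebra_simps)
qed

lemma tangent_comp_cong:
  assumes frame: "\<And>p. \<exists>c. \<forall>f. smooth f \<longrightarrow> Q f p = (\<Sum>b\<in>Bs. c b * lft b f p)"
    and smooth_Q: "\<And>f. smooth f \<Longrightarrow> smooth (Q f)"
    and Q_one: "\<And>f. smooth f \<Longrightarrow> Q f \<one> = 0"
    and fg: "smooth f" "smooth g" "d f = d g"
    and v: "v \<in> tangent_space A \<one>"
  shows "v (Q f) = v (Q g)"
proof -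
  let ?h = "\<lambda>p. f p + (-1) * g p"
  have h: "smooth ?h" by (intro smooth_intros fg)
  have "d ?h = 0"
    using d_add[OF fg(1) smooth_fun_mult[OF charted smooth_fun_const fg(2), of "-1"]] d_scale[OF fg(2), of "-1"] fg(3)
    by simp
  then have "v (Q ?h) = 0"
    using tangent_comp_first_order_zero[OF frame smooth_Q Q_one h _ v] by blast
  then show ?thesis
    using tangent_diff[OF charted v smooth_Q smooth_Q, OF fg(1,2)] 
      frame_linear[OF frame fg(1,2), where c="-1", simplified] by simp
qed

text \<open>Although \<open>v (Q f)\<close> is a second-order expression, it sees only
  \<open>d f\<close>, and so it is a tangent vector at the unit; its coordinates are the values on
  the coframe.\<close>

lemma tangent_comp_lft:
  assumes frame: "\<And>p. \<exists>c. \<forall>f. smooth f \<longrightarrow> Q f p = (\<Sum>b\<in>Bs. c b * lft b f p)"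
    and smooth_Q: "\<And>f. smooth f \<Longrightarrow> smooth (Q f)"
    and Q_one: "\<And>f. smooth f \<Longrightarrow> Q f \<one> = 0"
    and v: "v \<in> tangent_space A \<one>"
  obtains Y where "\<And>f. smooth f \<Longrightarrow> v (Q f) = lft Y f \<one>"
proof -
  let ?Y = "\<Sum>b\<in>Bs. v (Q (coframe b)) *\<^sub>R b"
  have "v (Q f) = lft ?Y f \<one>" if f: "smooth f" for f
  proof -
    \<comment> \<open>A combination of coframe functions with the same differential as
      \<open>f\<close>, on which \<open>v (Q f)\<close> is computed by linearity.\<close>
    let ?g = "\<lambda>p. \<Sum>b\<in>Bs. lft b f \<one> * coframe b p"
    have g: "smooth ?g" by (intro smooth_intros coframe)
    have "d ?g = d f"
    proof (rule dual_eqI)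
      fix X
      have b: "lft b ?g \<one> = lft b f \<one>" if "b \<in> Bs" for b
      proof -
        have "lft b ?g \<one> = (\<Sum>c\<in>Bs. lft c f \<one> * lft b (coframe c) \<one>)"
          by (simp add: lft_sum lft_scale smooth_intros coframe)
        also have "\<dots> = (\<Sum>c\<in>Bs. if c = b then lft c f \<one> else 0)"
          by (rule sum.cong) (use coframe that in auto)
        finally show ?thesis using that Bs by simp
      qed
      have e: "lft X h \<one> = (\<Sum>b\<in>Bs. representation Bs X b * lft b h \<one>)" for h
        by (rule linear_expand[OF linear_lft])
      show "dual_app (d ?g) X = dual_app (d f) X"
        unfolding dual_app_d e[of ?g] e[of f] by (simp add: b)
    qed
    then have "v (Q f) = v (Q ?g)"
      using tangent_comp_cong[OF frame smooth_Q Q_one f g _ v] by simp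
    also have "Q ?g = (\<lambda>p. \<Sum>b\<in>Bs. lft b f \<one> * Q (coframe b) p)"
    proof
      fix p
      obtain a where a: "\<And>f. smooth f \<Longrightarrow> Q f p = (\<Sum>b\<in>Bs. a b * lft b f p)" using frame by blast
      have "Q ?g p = (\<Sum>b\<in>Bs. \<Sum>c\<in>Bs. a b * (lft c f \<one> * lft b (coframe c) p))"
        by (simp add: a[OF g] lft_sum lft_scale smooth_intros coframe sum_distrib_left)
      also have "\<dots> = (\<Sum>c\<in>Bs. lft c f \<one> * (\<Sum>b\<in>Bs. a b * lft b (coframe c) p))"
        by (subst sum.swap) (simp add: sum_distrib_left mult.left_commute)
      also have "\<dots> = (\<Sum>c\<in>Bs. lft c f \<one> * Q (coframe c) p)"
        by (rule sum.cong) (simp_all add: a coframe)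
      finally show "Q ?g p = (\<Sum>b\<in>Bs. lft b f \<one> * Q (coframe b) p)" .
    qed
    also have "v \<dots> = (\<Sum>b\<in>Bs. lft b f \<one> * v (Q (coframe b)))"
      by (simp add: tangent_sum[OF charted v] tangent_scale[OF charted v] smooth_intros smooth_Q coframe)
    also have "\<dots> = lft ?Y f \<one>"
      unfolding linear_sum_scaleR[OF linear_lft] by (simp add: mult.commute)
    finally show ?thesis .
  qed
  then show thesis by (rule that)
qed

end

section \<open>Quasi-Poisson Lie groups\<close>

locale quasi_poisson_group = lie_group_with_algebra H A brh lft
  for H :: "('m::{t2_space,second_countable_topology}) monoid" (structure)
    and A :: "('m, 'e::real_inner) atlas"
    and brh :: "'h::real_vector \<Rightarrow> 'h \<Rightarrow> 'h"
    and lft :: "'h \<Rightarrow> 'm vfield" +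
  fixes brg :: "'g::real_vector \<Rightarrow> 'g \<Rightarrow> 'g"
    and B :: "'g set"
    and t :: "'g tensor2"
    and \<rho> :: "'g \<Rightarrow> 'm vfield"
    and \<pi> :: "'m bivfield"
  assumes sym_t: "t \<in> sym2"
    and quasi_poisson: "quasi_poisson_lie_group brg B t H A \<rho> \<pi>"
begin

lemma rho_vector_field: "vector_field A (\<rho> u)"
  and linear_rho: "linear (\<lambda>u. \<rho> u f p)"
  and rho_commutator: "\<rho> (brg u v) = commutator (\<rho> u) (\<rho> v)"
  and pi_bivector_field: "bivector_field A \<pi>"
  and pi_invariant: "lie_deriv (\<rho> u) \<pi> f g p = 0"
  and pi_schouten: "schouten \<pi> \<pi> f g h p / 2 = push3 B \<rho> (phi3 brg B t) f g h p"
  using quasi_poisson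
  unfolding quasi_poisson_lie_group_def quasi_poisson_manifold_def lie_action_on_manifold_def by blast+

lemma rho_tangent: "(\<lambda>f. \<rho> u f p) \<in> tangent_space A p"
  using rho_vector_field unfolding vector_field_def by blast

lemma rho_smooth: "smooth f \<Longrightarrow> smooth (\<rho> u f)"
  using rho_vector_field unfolding vector_field_def by blast

lemma pi_smooth: "smooth f \<Longrightarrow> smooth g \<Longrightarrow> smooth (\<pi> f g)"
  using pi_bivector_field unfolding bivector_field_def by blast

lemmas rho_nonsmooth = tangent_nonsmooth[OF rho_tangent]
  and rho_const = tangent_const[OF rho_tangent]
  and rho_minus = tangent_diff[OF charted rho_tangent]

lemma pi_expand:
  obtains n :: nat and V W where "\<And>k. k < n \<Longrightarrow> V k \<in> tangent_space A p"
    "\<And>k. k < n \<Longrightarrow> W k \<in> tangent_space A p"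
    "\<And>f g. \<pi> f g p = (\<Sum>k<n. V k f * W k g - W k f * V k g)"
proof -
  have "(\<lambda>f g. \<pi> f g p) \<in> bivectors_at A p"
    using pi_bivector_field unfolding bivector_field_def by blast
  then obtain n :: nat and V W where h: "\<forall>k<n. V k \<in> tangent_space A p \<and> W k \<in> tangent_space A p"
    "(\<lambda>f g. \<pi> f g p) = (\<lambda>f g. \<Sum>k<n. V k f * W k g - W k f * V k g)"
    unfolding bivectors_at_def by blast
  then have "\<pi> f g p = (\<Sum>k<n. V k f * W k g - W k f * V k g)" for f g
    using fun_cong[OF fun_cong[OF h(2)], of f g] by simp
  then show thesis using that h(1) by blast
qed

lemma pi_antisym: "\<pi> f g p = - \<pi> g f p"
proof -
  obtain n :: nat and V W where "\<And>k. k < n \<Longrightarrow> V k \<in> tangent_space A p"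
    "\<And>k. k < n \<Longrightarrow> W k \<in> tangent_space A p"
    "\<And>f g. \<pi> f g p = (\<Sum>k<n. V k f * W k g - W k f * V k g)"
    by (rule pi_expand[of p]) (rule that)
  then show ?thesis by (simp add: sum_negf[symmetric] mult.commute)
qed

lemma rho_frame: "\<exists>c. \<forall>f. smooth f \<longrightarrow> \<rho> u f p = (\<Sum>b\<in>Bs. c b * lft b f p)"
proof -
  obtain c where "\<And>f. \<rho> u f p = (\<Sum>b\<in>Bs. c b * lft b f p)" 
    by (rule tangent_expand[OF rho_tangent[of u p]]) (rule that)
  then show ?thesis by (intro exI allI impI)
qed

lemma pi_frame: "\<exists>c. \<forall>f. smooth f \<longrightarrow> \<pi> f g p = (\<Sum>b\<in>Bs. c b * lft b f p)"
proof -
  obtain n :: nat and V W where VW: "\<And>k. k < n \<Longrightarrow> V k \<in> tangent_space A p"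
    "\<And>k. k < n \<Longrightarrow> W k \<in> tangent_space A p"
    "\<And>f g. \<pi> f g p = (\<Sum>k<n. V k f * W k g - W k f * V k g)"
    by (rule pi_expand[of p]) (rule that)
  have "\<forall>v\<in>tangent_space A p. \<exists>c. \<forall>f. v f = (\<Sum>b\<in>Bs. c b * lft b f p)"
  proof
    fix v assume "v \<in> tangent_space A p"
    then obtain c where "\<And>f. v f = (\<Sum>b\<in>Bs. c b * lft b f p)" by (rule tangent_expand) (rule that)
    then show "\<exists>c. \<forall>f. v f = (\<Sum>b\<in>Bs. c b * lft b f p)" by (intro exI allI)
  qed
  from bchoice[OF this] obtain c where
    c: "\<And>v f. v \<in> tangent_space A p \<Longrightarrow> v f = (\<Sum>b\<in>Bs. c v b * lft b f p)"
    by blast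
  have "\<pi> f g p = (\<Sum>b\<in>Bs. (\<Sum>k<n. c (V k) b * W k g - c (W k) b * V k g) * lft b f p)" for f
  proof -
    have "\<pi> f g p = (\<Sum>k<n. \<Sum>b\<in>Bs. (c (V k) b * W k g - c (W k) b * V k g) * lft b f p)"
      unfolding VW(3)
    proof (rule sum.cong)
      fix k assume "k \<in> {..<n}"
      then have k: "k < n" by simp
      show "V k f * W k g - W k f * V k g = (\<Sum>b\<in>Bs. (c (V k) b * W k g - c (W k) b * V k g) * lft b f p)"
        unfolding c[OF VW(1)[OF k], of f] c[OF VW(2)[OF k], of f]
        by (simp add: sum_distrib_left sum_distrib_right sum_subtractf algebra_simps)
    qed simp
    then show ?thesis by (subst (asm) sum.swap) (simp add: sum_distrib_right)
  qed
  then show ?thesis by (intro exI allI impI)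
qed

lemma pi_linear1:
  "smooth f \<Longrightarrow> smooth f' \<Longrightarrow> \<pi> (\<lambda>p. f p + c * f' p) g = (\<lambda>p. \<pi> f g p + c * \<pi> f' g p)"
  using frame_linear[OF pi_frame] .

section \<open>Multiplicativity of the action and of the bivector field\<close>

lemma quasi_poisson_mult:
  "quasi_poisson_map (prod_atlas A A) (fusion_action A A \<rho> \<rho>) (fusion_bivector B t A A \<rho> \<rho> \<pi> \<pi>)
     A \<rho> \<pi> (\<lambda>(x, y). x \<otimes> y)"
  using quasi_poisson unfolding quasi_poisson_lie_group_def by (elim conjE)

lemma mult_rho:
  assumes "smooth f"
  shows "\<rho> u (\<lambda>x. f (x \<otimes> b)) a + \<rho> u (\<lambda>y. f (a \<otimes> y)) b = \<rho> u f (a \<otimes> b)"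
proof -
  have "fusion_action A A \<rho> \<rho> u (f \<circ> (\<lambda>(x, y). x \<otimes> y)) (a, b) = \<rho> u f ((\<lambda>(x, y). x \<otimes> y) (a, b))"
    using quasi_poisson_mult assms unfolding quasi_poisson_map_def by blast
  then show ?thesis
    using smooth_mult[OF assms]
    by (simp add: fusion_action_def lift_fst_def lift_snd_def o_def case_prod_unfold)
qed

lemma mult_pi:
  assumes "smooth f" "smooth g"
  shows "\<pi> (\<lambda>x. f (x \<otimes> b)) (\<lambda>x. g (x \<otimes> b)) a + \<pi> (\<lambda>y. f (a \<otimes> y)) (\<lambda>y. g (a \<otimes> y)) b
    - 1 / 2 * (\<Sum>i\<in>B. \<Sum>j\<in>B. comp2 B t i j *
        (\<rho> i (\<lambda>x. f (x \<otimes> b)) a * \<rho> j (\<lambda>y. g (a \<otimes> y)) b - \<rho> j (\<lambda>y. f (a \<otimes> y)) b * \<rho> i (\<lambda>x. g (x \<otimes> b)) a))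
    = \<pi> f g (a \<otimes> b)"
proof -
  have "fusion_bivector B t A A \<rho> \<rho> \<pi> \<pi> (f \<circ> (\<lambda>(x, y). x \<otimes> y)) (g \<circ> (\<lambda>(x, y). x \<otimes> y)) (a, b)
      = \<pi> f g ((\<lambda>(x, y). x \<otimes> y) (a, b))"
    using quasi_poisson_mult assms unfolding quasi_poisson_map_def by blast
  then show ?thesis
    using smooth_mult[OF assms(1)] smooth_mult[OF assms(2)]
    by (simp add: fusion_bivector_def lift_fst_def lift_snd_def lift_fst2_def lift_snd2_def
        wedge_fields_def o_def case_prod_unfold)
qed

text \<open>With both factors equal to the unit, \<open>mult_rho\<close> says that twice the value
  equals the value; on nonsmooth \<open>f\<close> the value is 0 by convention.\<close>

lemma rho_one: "\<rho> u f \<one> = 0"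
  using mult_rho[of f u \<one> \<one>] rho_nonsmooth[of f u \<one>] by (cases "smooth f") auto

lemma pi_one: "smooth f \<Longrightarrow> smooth g \<Longrightarrow> \<pi> f g \<one> = 0"
  using mult_pi[of f g \<one> \<one>] by (simp add: rho_one)

text \<open>Mixed second derivatives on \<open>H \<times> H\<close> commute, so the infinitesimal automorphism \<open>\<rho> u\<close>
  normalises the left-invariant fields.\<close>

lemma commutator_rho_lft_left_invariant:
  assumes "smooth f"
  shows "commutator (\<rho> u) (lft X) f a = commutator (\<rho> u) (lft X) (\<lambda>x. f (a \<otimes> x)) \<one>"
proof -
  let ?fa = "\<lambda>x. f (a \<otimes> x)"
  have "lft X ?fa = (\<lambda>x. lft X f (a \<otimes> x))" using lft_left_translate[OF assms] by blast
  then have "\<rho> u (lft X ?fa) \<one> = 0" by (simp add: rho_one)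
  moreover have "lft X (\<rho> u ?fa) \<one> = lft X (\<rho> u f) a - \<rho> u (lft X f) a"
  proof -
    \<comment> \<open>Multiplicativity solved for the left translate. The subtracted term contains
      \<open>f\<close> right-translated by \<open>b\<close>, so the derivatives at \<open>a\<close>
      and in \<open>b\<close> can be interchanged.\<close>
    have eq: "\<rho> u ?fa = (\<lambda>b. \<rho> u f (a \<otimes> b) - \<rho> u (\<lambda>x. f (x \<otimes> b)) a)"
      using mult_rho[OF assms, of u _ a] by (intro ext) (simp add: algebra_simps)
    have "lft X (\<lambda>b. \<rho> u (\<lambda>x. f (x \<otimes> b)) a) \<one> = \<rho> u (\<lambda>x. lft X (\<lambda>b. f (x \<otimes> b)) \<one>) a"
      by (rule tangent_translates_commute[OF assms rho_tangent lft_tangent, symmetric])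
    also have "(\<lambda>x. lft X (\<lambda>b. f (x \<otimes> b)) \<one>) = lft X f"
      using lft_at[OF assms] by auto
    finally show ?thesis
      unfolding eq
      using lft_minus[OF smooth_left_translate[OF rho_smooth[OF assms]] smooth_tangent_right_translate[OF assms rho_tangent]]
        lft_at[OF rho_smooth[OF assms], of X _ a] by simp
  qed
  ultimately show ?thesis by (simp add: commutator_def)
qed

lemma commutator_nonsmooth:
  "\<not> smooth f \<Longrightarrow> commutator (\<rho> u) (lft X) f p = 0"
proof -
  assume "\<not> smooth f"
  then have "\<rho> u f = (\<lambda>p. 0)" "lft X f = (\<lambda>p. 0)" by (auto simp: rho_nonsmooth lft_nonsmooth)
  then show ?thesis by (simp add: commutator_def rho_const lft_const)
qed

text \<open>At the unit \<open>\<rho> u\<close> vanishes, so the commutator is minus the derivative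
  of \<open>\<rho> u f\<close> along \<open>X\<close>, which \<open>tangent_comp_lft\<close>
  identifies with some \<open>lft Y\<close>; left invariance carries this to
  \<open>p\<close>.\<close>

lemma commutator_rho_lft_tangent: "(\<lambda>f. commutator (\<rho> u) (lft X) f p) \<in> tangent_space A p"
proof -
  obtain Y where Y: "\<And>f. smooth f \<Longrightarrow> lft X (\<rho> u f) \<one> = lft Y f \<one>"
    using tangent_comp_lft[where Q="\<rho> u", OF rho_frame rho_smooth rho_one lft_tangent] by blast
  have "commutator (\<rho> u) (lft X) f p = lft (- Y) f p" for f
  proof (cases "smooth f")
    case True
    have "commutator (\<rho> u) (lft X) f p = - lft Y f p"
      unfolding commutator_rho_lft_left_invariant[OF True, of u X p] lft_at[OF True, of Y p]
      by (simp add: commutator_def rho_one Y smooth_left_translate True)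
    then show ?thesis using linear_neg[OF linear_lft[of f p]] by simp
  qed (simp add: commutator_nonsmooth lft_nonsmooth)
  then show ?thesis using lft_tangent[of "- Y" p] by simp
qed

lemma commutator_rho_lft_smooth: "smooth f \<Longrightarrow> smooth (commutator (\<rho> u) (lft X) f)"
  unfolding commutator_def[abs_def] by (intro smooth_intros rho_smooth lft_smooth)

section \<open>The induced action on the Lie algebra\<close>

abbreviation r :: "'g \<Rightarrow> 'h \<Rightarrow> 'h" where "r \<equiv> rho_dot lft \<rho>"

text \<open>Shows that the definite description in \<open>rho_dot\<close> denotes: the commutator is
  a left-invariant vector field, hence the image of exactly one element.\<close>

lemma lft_rho_dot: "lft (r u X) = commutator (\<rho> u) (lft X)"
proof -
  have "vector_field A (commutator (\<rho> u) (lft X))"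
    unfolding vector_field_def using commutator_rho_lft_tangent commutator_rho_lft_smooth by blast
  moreover have "left_invariant H A (commutator (\<rho> u) (lft X))"
    unfolding left_invariant_def
  proof (intro allI impI)
    fix a f p assume f: "smooth f"
    show "commutator (\<rho> u) (lft X) (\<lambda>x. f (a \<otimes> x)) p = commutator (\<rho> u) (lft X) f (a \<otimes> p)"
      using commutator_rho_lft_left_invariant[OF f, of u X "a \<otimes> p"]
        commutator_rho_lft_left_invariant[OF smooth_left_translate[OF f], of u X a p] by simp
  qed
  ultimately have "\<exists>!Y. lft Y = commutator (\<rho> u) (lft X)"
    using lft_surj inj_lft by metis
  then show ?thesis unfolding rho_dot_def by (rule theI')
qed

lemma lft_rho_dot_one: "lft (r u X) f \<one> = - lft X (\<rho> u f) \<one>"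
  by (simp add: lft_rho_dot commutator_def rho_one)

text \<open>At the unit, \<open>r u X\<close> is \<open>X\<close> precomposed with
  \<open>\<rho> u\<close>, with a minus sign. Precomposition reverses the order of products, and the
  sign makes up for this in the bracket. The derivation rule is the Jacobi identity for commutators
  of fields.\<close>

lemma rho_dot_action: "lie_action_by_derivations brg brh r"
  unfolding lie_action_by_derivations_def bilinear_def
proof (intro conjI allI)
  fix u
  show "linear (r u)"
  proof (rule linearI; rule lft_eqI)
    fix X Y and f :: "'m \<Rightarrow> real" and c :: real
    show "lft (r u (X + Y)) f \<one> = lft (r u X + r u Y) f \<one>"
      by (simp add: linear_add[OF linear_lft] lft_rho_dot_one)
    show "lft (r u (c *\<^sub>R X)) f \<one> = lft (c *\<^sub>R r u X) f \<one>"
      by (simp add: linear_scale[OF linear_lft] lft_rho_dot_one)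
  qed
next
  fix X
  show "linear (\<lambda>u. r u X)"
  proof (rule linearI; rule lft_eqI)
    fix u v and f :: "'m \<Rightarrow> real" and c :: real assume f: "smooth f"
    have "\<rho> (u + v) f = (\<lambda>p. \<rho> u f p + \<rho> v f p)" using linear_add[OF linear_rho] by blast
    then show "lft (r (u + v) X) f \<one> = lft (r u X + r v X) f \<one>"
      by (simp add: linear_add[OF linear_lft] lft_rho_dot_one lft_plus rho_smooth f)
    have "\<rho> (c *\<^sub>R u) f = (\<lambda>p. c * \<rho> u f p)" using linear_scale[OF linear_rho] by auto
    then show "lft (r (c *\<^sub>R u) X) f \<one> = lft (c *\<^sub>R r u X) f \<one>"
      by (simp add: linear_scale[OF linear_lft] lft_rho_dot_one lft_scale rho_smooth f)
  qed
next
  fix u v X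
  show "r (brg u v) X = r u (r v X) - r v (r u X)"
  proof (rule lft_eqI)
    fix f assume f: "smooth f"
    have "\<rho> (brg u v) f = (\<lambda>p. \<rho> u (\<rho> v f) p - \<rho> v (\<rho> u f) p)"
      unfolding rho_commutator commutator_def[abs_def] ..
    then show "lft (r (brg u v) X) f \<one> = lft (r u (r v X) - r v (r u X)) f \<one>"
      by (simp add: linear_diff[OF linear_lft] lft_rho_dot_one lft_minus rho_smooth f)
  qed
next
  fix u X Y
  show "r u (brh X Y) = brh (r u X) Y + brh X (r u Y)"
  proof (rule lft_eqI)
    fix f assume f: "smooth f"
    have c: "lft (r u X) g = (\<lambda>p. \<rho> u (lft X g) p - lft X (\<rho> u g) p)" for X g
      unfolding lft_rho_dot commutator_def[abs_def] ..
    show "lft (r u (brh X Y)) f \<one> = lft (brh (r u X) Y + brh X (r u Y)) f \<one>"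
      by (simp add: linear_add[OF linear_lft] lft_rho_dot_one[of u "brh X Y"] lft_commutator
          commutator_def c lft_minus rho_minus rho_one lft_smooth rho_smooth f)
  qed
qed

section \<open>The cobracket\<close>

definition \<delta> :: "'h \<Rightarrow> 'h tensor2" where "\<delta> = delta_of H A lft \<pi>"

lemma lie_deriv_pi_one:
  "smooth f \<Longrightarrow> smooth g \<Longrightarrow> lie_deriv (lft X) \<pi> f g \<one> = lft X (\<pi> f g) \<one>"
  by (simp add: lie_deriv_def pi_one lft_smooth)

text \<open>Makes the definite description in \<open>delta_of\<close> meaningful.
  \<open>tangent_comp_cong\<close> exchanges the first argument, and antisymmetry of \<pi> transfers
  this to the second.\<close>

lemma lft_pi_cong:
  assumes "smooth f" "smooth f'" "smooth g" "smooth g'" "d f = d f'" "d g = d g'"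
  shows "lft X (\<pi> f g) \<one> = lft X (\<pi> f' g') \<one>"
proof -
  have 1: "lft X (\<pi> f h) \<one> = lft X (\<pi> f' h) \<one>" if "smooth h" "smooth f" "smooth f'" "d f = d f'" for f f' h
    by (rule tangent_comp_cong[where Q="\<lambda>f. \<pi> f h", OF pi_frame pi_smooth pi_one that(2-4) lft_tangent])
      (use that in auto)
  have anti: "lft X (\<pi> h k) \<one> = - lft X (\<pi> k h) \<one>" if "smooth h" "smooth k" for h k
  proof -
    have "\<pi> h k = (\<lambda>p. (-1) * \<pi> k h p)" using pi_antisym[of h k] by auto
    then show ?thesis using lft_scale[OF pi_smooth[OF that(2,1)], of X "-1"] by simp
  qed
  have "lft X (\<pi> f g) \<one> = lft X (\<pi> f' g) \<one>" by (rule 1[OF assms(3,1,2,5)])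
  also have "\<dots> = - lft X (\<pi> g f') \<one>" by (rule anti[OF assms(2,3)])
  also have "lft X (\<pi> g f') \<one> = lft X (\<pi> g' f') \<one>" by (rule 1[OF assms(2,3,4,6)])
  also have "- \<dots> = lft X (\<pi> f' g') \<one>" by (rule anti[OF assms(2,4), symmetric])
  finally show ?thesis .
qed

text \<open>The computational form of \<delta>: only the first term of \<open>lie_deriv\<close>
  survives, since \<pi> vanishes at the unit.\<close>

lemma delta_d:
  assumes "smooth f" "smooth g"
  shows "\<delta> X (d f) (d g) = lft X (\<pi> f g) \<one>"
  unfolding \<delta>_def delta_of_def
proof (rule the_equality)
  show "\<forall>f' g'. smooth f' \<longrightarrow> smooth g' \<longrightarrow> d f' = d f \<longrightarrow> d g' = d g \<longrightarrow>
      lft X (\<pi> f g) \<one> = lie_deriv (lft X) \<pi> f' g' \<one>"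
    by (intro allI impI) (simp add: lie_deriv_pi_one lft_pi_cong[OF assms(1) _ assms(2)])
next
  fix c assume "\<forall>f' g'. smooth f' \<longrightarrow> smooth g' \<longrightarrow> d f' = d f \<longrightarrow> d g' = d g \<longrightarrow>
      c = lie_deriv (lft X) \<pi> f' g' \<one>"
  then show "c = lft X (\<pi> f g) \<one>" using assms lie_deriv_pi_one by simp
qed

lemma linear_delta: "linear (\<lambda>X. \<delta> X \<alpha> \<beta>)"
proof -
  obtain f where f: "smooth f" "d f = \<alpha>" by (rule d_surj)
  obtain g where g: "smooth g" "d g = \<beta>" by (rule d_surj)
  note fg = f g
  show ?thesis using linear_lft[of "\<pi> f g" \<one>] delta_d[OF fg(1,3)] fg by simp
qed

lemma delta_antisym: "\<delta> X \<alpha> \<beta> = - \<delta> X \<beta> \<alpha>"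
proof -
  obtain f where f: "smooth f" "d f = \<alpha>" by (rule d_surj)
  obtain g where g: "smooth g" "d g = \<beta>" by (rule d_surj)
  note fg = f g
  have "\<pi> f g = (\<lambda>p. (-1) * \<pi> g f p)" using pi_antisym[of f g] by auto
  then have "lft X (\<pi> f g) \<one> = - lft X (\<pi> g f) \<one>"
    using lft_scale[OF pi_smooth[OF fg(3,1)], of X "-1"] by simp
  then show ?thesis using delta_d[OF fg(1,3)] delta_d[OF fg(3,1)] fg by simp
qed

lemma delta_linear1: "\<delta> X (\<alpha> + c *\<^sub>R \<alpha>') \<beta> = \<delta> X \<alpha> \<beta> + c * \<delta> X \<alpha>' \<beta>"
proof -
  obtain f where f: "smooth f" "d f = \<alpha>" by (rule d_surj)
  obtain f' where f': "smooth f'" "d f' = \<alpha>'" by (rule d_surj)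
  obtain g where g: "smooth g" "d g = \<beta>" by (rule d_surj)
  note fg = f f' g
  have sm: "smooth (\<lambda>p. c * f' p)" by (intro smooth_intros fg)
  have "d (\<lambda>p. f p + c * f' p) = \<alpha> + c *\<^sub>R \<alpha>'"
    using d_add[OF fg(1) sm] d_scale[OF fg(3)] fg by simp
  then have "\<delta> X (\<alpha> + c *\<^sub>R \<alpha>') \<beta> = lft X (\<pi> (\<lambda>p. f p + c * f' p) g) \<one>"
    using delta_d[OF smooth_fun_add[OF charted fg(1) sm] fg(5)] fg(6) by simp
  also have "\<dots> = lft X (\<pi> f g) \<one> + c * lft X (\<pi> f' g) \<one>"
    unfolding pi_linear1[OF fg(1,3)]
    by (simp add: lft_plus lft_scale smooth_intros pi_smooth fg)
  finally show ?thesis using delta_d[OF fg(1,5)] delta_d[OF fg(3,5)] fg(2,4,6) by simp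
qed

lemma bilinear_delta: "bilinear (\<delta> X)"
proof -
  have 1: "linear (\<lambda>\<alpha>. \<delta> X \<alpha> \<beta>)" for \<beta>
  proof (rule linearI)
    show "\<delta> X (\<alpha> + \<alpha>') \<beta> = \<delta> X \<alpha> \<beta> + \<delta> X \<alpha>' \<beta>" for \<alpha> \<alpha>'
      using delta_linear1[of X \<alpha> 1] by simp
    have "\<delta> X 0 \<beta> = 0" using delta_linear1[of X 0 1 0 \<beta>] by simp
    then show "\<delta> X (c *\<^sub>R \<alpha>) \<beta> = c *\<^sub>R \<delta> X \<alpha> \<beta>" for c \<alpha>
      using delta_linear1[of X 0 c \<alpha> \<beta>] by simp
  qed
  have 2: "linear (\<delta> X \<alpha>)" for \<alpha>
  proof -
    have "\<delta> X \<alpha> = (\<lambda>\<beta>. - \<delta> X \<beta> \<alpha>)" using delta_antisym by blast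
    then show ?thesis using linear_compose_neg[OF 1[of \<alpha>]] by simp
  qed
  show ?thesis unfolding bilinear_def using 1 2 by simp
qed

lemma transpose_d:
  assumes "smooth f" "smooth g"
  shows "transpose_cobracket \<delta> (d f) (d g) = d (\<pi> f g)"
  unfolding transpose_cobracket_def diff_at_one_def[of H lft "\<pi> f g"] delta_d[OF assms] ..

lemma dual_app_transpose: "dual_app (transpose_cobracket \<delta> \<alpha> \<beta>) X = \<delta> X \<alpha> \<beta>"
  unfolding transpose_cobracket_def by (simp add: dual_app_Dual linear_delta)

lemma lft_push3_one:
  assumes "smooth f" "smooth g" "smooth h"
  shows "lft X (push3 B \<rho> \<phi> f g h) \<one> = 0"
proof -
  have sm: "smooth (\<lambda>p. \<phi> (dual_vec B i) (dual_vec B j) (dual_vec B k) * \<rho> i f p * \<rho> j g p * \<rho> k h p)" for i j k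
    by (intro smooth_intros rho_smooth assms)
  have sm': "smooth (\<lambda>p. \<phi> (dual_vec B i) (dual_vec B j) (dual_vec B k) * \<rho> i f p * \<rho> j g p)" for i j k
    by (intro smooth_intros rho_smooth assms)
  have z: "lft X (\<lambda>p. \<phi> (dual_vec B i) (dual_vec B j) (dual_vec B k) * \<rho> i f p * \<rho> j g p * \<rho> k h p) \<one> = 0" for i j k
    unfolding lft_times[OF sm' rho_smooth[OF assms(3)]] by (simp add: rho_one)
  show ?thesis
    unfolding push3_def[abs_def] by (simp add: lft_sum smooth_intros sm z)
qed

lemma cobracket: "lie_cobracket \<delta>"
  unfolding lie_cobracket_def lie_algebra_def
proof (intro conjI allI)
  show "\<delta> X \<in> ext2" for X
    unfolding ext2_def using bilinear_delta delta_antisym by blast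
  show "linear (\<lambda>X. \<delta> X \<alpha> \<beta>)" for \<alpha> \<beta> by (rule linear_delta)
  have l: "linear (\<delta> X \<alpha>)" "linear (\<lambda>\<alpha>. \<delta> X \<alpha> \<beta>)" for X \<alpha> \<beta>
    using bilinear_delta unfolding bilinear_def by auto
  show "bilinear (transpose_cobracket \<delta>)"
    unfolding bilinear_def
    by (intro conjI allI linearI; rule dual_eqI)
      (simp_all add: dual_app_transpose plus_dual.rep_eq scaleR_dual.rep_eq linear_add[OF l(1)] linear_add[OF l(2)]
        linear_scale[OF l(1)] linear_scale[OF l(2)])
  show "transpose_cobracket \<delta> \<alpha> \<alpha> = 0" for \<alpha>
    by (rule dual_eqI) (use delta_antisym[of _ \<alpha> \<alpha>] in \<open>simp add: dual_app_transpose zero_dual.rep_eq\<close>)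
  fix \<alpha> \<beta> \<gamma>
  obtain f where f: "smooth f" "d f = \<alpha>" by (rule d_surj)
  obtain g where g: "smooth g" "d g = \<beta>" by (rule d_surj)
  obtain h where h: "smooth h" "d h = \<gamma>" by (rule d_surj)
  note fgh = f g h
  let ?t = "transpose_cobracket \<delta>"
  show "?t \<alpha> (?t \<beta> \<gamma>) + ?t \<beta> (?t \<gamma> \<alpha>) + ?t \<gamma> (?t \<alpha> \<beta>) = 0"
  proof (rule dual_eqI)
    fix X
    let ?J = "\<lambda>p. \<pi> f (\<pi> g h) p + \<pi> g (\<pi> h f) p + \<pi> h (\<pi> f g) p"
    \<comment> \<open>\<open>schouten \<pi> \<pi>\<close> lists the three terms of the Jacobiator
      twice; the division by 2 in the quasi-Poisson condition undoes this.\<close>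
    have half: "a + b + c = e" if "(a + b + c + a + b + c) / 2 = e" for a b c e :: real
    proof -
      have "(a + b + c + a + b + c) / 2 = a + b + c" by (simp add: field_simps)
      with that show ?thesis by simp
    qed
    have J: "?J = push3 B \<rho> (phi3 brg B t) f g h"
    proof
      fix p show "\<pi> f (\<pi> g h) p + \<pi> g (\<pi> h f) p + \<pi> h (\<pi> f g) p = push3 B \<rho> (phi3 brg B t) f g h p"
        by (rule half[OF pi_schouten[of f g h p, unfolded schouten_def]])
    qed
    have "?t \<alpha> (?t \<beta> \<gamma>) = d (\<pi> f (\<pi> g h))" "?t \<beta> (?t \<gamma> \<alpha>) = d (\<pi> g (\<pi> h f))" "?t \<gamma> (?t \<alpha> \<beta>) = d (\<pi> h (\<pi> f g))"
      using transpose_d[OF fgh(3,5)] transpose_d[OF fgh(5,1)] transpose_d[OF fgh(1,3)]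
        transpose_d[OF fgh(1) pi_smooth[OF fgh(3,5)]] transpose_d[OF fgh(3) pi_smooth[OF fgh(5,1)]]
        transpose_d[OF fgh(5) pi_smooth[OF fgh(1,3)]] fgh by simp_all
    then have "dual_app (?t \<alpha> (?t \<beta> \<gamma>) + ?t \<beta> (?t \<gamma> \<alpha>) + ?t \<gamma> (?t \<alpha> \<beta>)) X = lft X ?J \<one>"
      by (simp add: plus_dual.rep_eq dual_app_d lft_plus smooth_intros pi_smooth fgh)
    also have "\<dots> = 0" unfolding J by (rule lft_push3_one[OF fgh(1,3,5)])
    finally show "dual_app (?t \<alpha> (?t \<beta> \<gamma>) + ?t \<beta> (?t \<gamma> \<alpha>) + ?t \<gamma> (?t \<alpha> \<beta>)) X = dual_app 0 X"
      by (simp add: zero_dual.rep_eq)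
  qed
qed

lemma pullback_rho_dot:
  assumes "smooth f" shows "pullback (r u) (d f) = (-1) *\<^sub>R d (\<rho> u f)"
proof (rule dual_eqI)
  fix X
  have "linear (r u)"
    using rho_dot_action unfolding lie_action_by_derivations_def bilinear_def by blast
  then have "linear (\<lambda>X. dual_app (d f) (r u X))"
    using linear_compose[OF _ linear_dual_app, of "r u" "d f"] by (simp add: o_def)
  then show "dual_app (pullback (r u) (d f)) X = dual_app ((-1) *\<^sub>R d (\<rho> u f)) X"
    unfolding pullback_def scaleR_dual.rep_eq by (simp only: dual_app_Dual) (simp add: dual_app_d lft_rho_dot_one)
qed

text \<open>Invariance of \<pi> is a Leibniz rule for \<open>\<rho> u\<close>. When \<open>X\<close>
  is applied to it at the unit, the left side receives its minus sign from
  \<open>lft_rho_dot_one\<close> and the right side from \<open>pullback_rho_dot\<close>.\<close>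

lemma delta_invariant: "\<delta> (r u X) \<alpha> \<beta> = tensor_deriv (r u) (\<delta> X) \<alpha> \<beta>"
proof -
  obtain f where f: "smooth f" "d f = \<alpha>" by (rule d_surj)
  obtain g where g: "smooth g" "d g = \<beta>" by (rule d_surj)
  note fg = f g
  have l: "linear (\<delta> X \<alpha>)" "linear (\<lambda>\<alpha>. \<delta> X \<alpha> \<beta>)" for X \<alpha> \<beta>
    using bilinear_delta unfolding bilinear_def by auto
  have "\<rho> u (\<pi> f g) = (\<lambda>p. \<pi> (\<rho> u f) g p + \<pi> f (\<rho> u g) p)"
    using pi_invariant[of u f g] by (intro ext) (simp add: lie_deriv_def algebra_simps)
  then have "\<delta> (r u X) \<alpha> \<beta> = - lft X (\<pi> (\<rho> u f) g) \<one> - lft X (\<pi> f (\<rho> u g)) \<one>"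
    using delta_d[OF fg(1,3), of "r u X"] fg
    by (simp add: lft_rho_dot_one lft_plus pi_smooth rho_smooth)
  also have "\<dots> = tensor_deriv (r u) (\<delta> X) \<alpha> \<beta>"
    unfolding tensor_deriv_def fg(2,4)[symmetric] pullback_rho_dot[OF fg(1)] pullback_rho_dot[OF fg(3)]
      linear_scale[OF l(1)] linear_scale[OF l(2)]
    by (simp add: delta_d[OF rho_smooth[OF fg(1)] fg(3)] delta_d[OF fg(1) rho_smooth[OF fg(3)]])
  finally show ?thesis .
qed

section \<open>The cocycle condition\<close>

text \<open>For translates of \<open>f\<close> and \<open>g\<close> by a moving point
  \<open>a\<close>, this separates the functions \<open>lft b f a\<close>, which can be
  differentiated further, from constants that depend on \<delta> alone.\<close>

lemma delta_expand:
  "\<delta> X \<alpha> \<beta> = (\<Sum>b\<in>Bs. \<Sum>c\<in>Bs. dual_app \<alpha> b * dual_app \<beta> c * \<delta> X (d (coframe b)) (d (coframe c)))"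
proof -
  have l: "linear (\<delta> X \<alpha>)" "linear (\<lambda>\<alpha>. \<delta> X \<alpha> \<beta>)" for X \<alpha> \<beta>
    using bilinear_delta unfolding bilinear_def by auto
  have "\<delta> X \<alpha> \<beta> = \<delta> X (\<Sum>b\<in>Bs. dual_app \<alpha> b *\<^sub>R d (coframe b)) (\<Sum>c\<in>Bs. dual_app \<beta> c *\<^sub>R d (coframe c))"
    by (simp only: dual_expand[symmetric])
  then show ?thesis
    unfolding linear_sum_scaleR[OF l(1)] linear_sum_scaleR[OF l(2)]
    by (subst sum.swap) (simp add: sum_distrib_left ac_simps)
qed

text \<open>At the fixed point \<open>a\<close> the bivector is a finite sum of products of tangent
  vectors, so the product rule reduces the claim to
  \<open>lft_tangent_right_translate\<close>.\<close>

lemma lft_pi_right_translate: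
  fixes a :: 'm
  assumes "smooth f" "smooth g"
  defines "G \<equiv> \<lambda>b. \<pi> (\<lambda>x. f (x \<otimes> b)) (\<lambda>x. g (x \<otimes> b)) a"
  shows "smooth G" "lft Y G \<one> = \<pi> (lft Y f) g a + \<pi> f (lft Y g) a"
proof -
  obtain n :: nat and V W where VW: "\<And>k. k < n \<Longrightarrow> V k \<in> tangent_space A a"
    "\<And>k. k < n \<Longrightarrow> W k \<in> tangent_space A a"
    "\<And>f g. \<pi> f g a = (\<Sum>k<n. V k f * W k g - W k f * V k g)"
    by (rule pi_expand[of a]) (rule that)
  have G: "G = (\<lambda>b. \<Sum>k<n. V k (\<lambda>x. f (x \<otimes> b)) * W k (\<lambda>x. g (x \<otimes> b)) - W k (\<lambda>x. f (x \<otimes> b)) * V k (\<lambda>x. g (x \<otimes> b)))"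
    unfolding G_def VW(3) ..
  have sm: "smooth (\<lambda>b. V k (\<lambda>x. h (x \<otimes> b)))" "smooth (\<lambda>b. W k (\<lambda>x. h (x \<otimes> b)))"
    if "k < n" "smooth h" for k h
    using smooth_tangent_right_translate[OF that(2)] VW(1,2)[OF that(1)] by blast+
  show "smooth G"
    unfolding G by (intro smooth_intros sm assms(1,2)) auto
  note sm' = sm[OF _ assms(1)] sm[OF _ assms(2)]
  have tr: "lft Y (\<lambda>b. V k (\<lambda>x. h (x \<otimes> b))) \<one> = V k (lft Y h)"
    "lft Y (\<lambda>b. W k (\<lambda>x. h (x \<otimes> b))) \<one> = W k (lft Y h)" if "k < n" "smooth h" for k h
    using lft_tangent_right_translate[OF that(2)] VW(1,2)[OF that(1)] by blast+
  note tr' = tr[OF _ assms(1)] tr[OF _ assms(2)]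
  have "lft Y G \<one> = (\<Sum>k<n. (V k (lft Y f) * W k g + V k f * W k (lft Y g)) - (W k (lft Y f) * V k g + W k f * V k (lft Y g)))"
  proof -
    have "lft Y G \<one> = (\<Sum>k<n. lft Y (\<lambda>b. V k (\<lambda>x. f (x \<otimes> b)) * W k (\<lambda>x. g (x \<otimes> b))
        - W k (\<lambda>x. f (x \<otimes> b)) * V k (\<lambda>x. g (x \<otimes> b))) \<one>)"
      unfolding G by (rule lft_sum) (intro smooth_intros sm assms(1,2); simp)
    also have "\<dots> = (\<Sum>k<n. (V k (lft Y f) * W k g + V k f * W k (lft Y g)) - (W k (lft Y f) * V k g + W k f * V k (lft Y g)))"
    proof (rule sum.cong)
      fix k assume "k \<in> {..<n}"
      then have k: "k < n" by simp
      show "lft Y (\<lambda>b. V k (\<lambda>x. f (x \<otimes> b)) * W k (\<lambda>x. g (x \<otimes> b))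
          - W k (\<lambda>x. f (x \<otimes> b)) * V k (\<lambda>x. g (x \<otimes> b))) \<one>
        = (V k (lft Y f) * W k g + V k f * W k (lft Y g)) - (W k (lft Y f) * V k g + W k f * V k (lft Y g))"
        by (simp add: lft_minus lft_times smooth_intros sm'[OF k] tr'[OF k])
    qed simp
    finally show ?thesis .
  qed
  also have "\<dots> = \<pi> (lft Y f) g a + \<pi> f (lft Y g) a"
    unfolding VW(3) sum.distrib[symmetric] by (rule sum.cong) simp_all
  finally show "lft Y G \<one> = \<pi> (lft Y f) g a + \<pi> f (lft Y g) a" .
qed

text \<open>The derivative of the multiplicativity of \<open>\<pi>\<close> in the second factor at the unit.\<close>

lemma lft_pi:
  assumes "smooth f" "smooth g"
  shows "lft Y (\<pi> f g) a = \<pi> (lft Y f) g a + \<pi> f (lft Y g) a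
    + (\<Sum>b\<in>Bs. \<Sum>c\<in>Bs. lft b f a * lft c g a * \<delta> Y (d (coframe b)) (d (coframe c)))
    - 1 / 2 * (\<Sum>i\<in>B. \<Sum>j\<in>B. comp2 B t i j * (lft (r j Y) f a * \<rho> i g a - \<rho> i f a * lft (r j Y) g a))"
proof -
  let ?f = "\<lambda>y. f (a \<otimes> y)" and ?g = "\<lambda>y. g (a \<otimes> y)"
  have sL: "smooth ?f" "smooth ?g" by (intro smooth_left_translate assms)+
  define G1 where "G1 = (\<lambda>b. \<pi> (\<lambda>x. f (x \<otimes> b)) (\<lambda>x. g (x \<otimes> b)) a)"
  define G3 where "G3 = (\<lambda>b. \<Sum>i\<in>B. \<Sum>j\<in>B. comp2 B t i j *
        (\<rho> i (\<lambda>x. f (x \<otimes> b)) a * \<rho> j ?g b - \<rho> j ?f b * \<rho> i (\<lambda>x. g (x \<otimes> b)) a))"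
  have sG1: "smooth G1" and G1: "lft Y G1 \<one> = \<pi> (lft Y f) g a + \<pi> f (lft Y g) a"
    unfolding G1_def using lft_pi_right_translate[OF assms] by blast+
  have sR: "smooth (\<lambda>b. \<rho> i (\<lambda>x. h (x \<otimes> b)) a)" if "smooth h" for i h
    by (rule smooth_tangent_right_translate[OF that rho_tangent])
  have sG3: "smooth G3"
    unfolding G3_def by (intro smooth_intros sR rho_smooth sL assms)
  have rL: "lft Y (\<rho> j (\<lambda>y. h (a \<otimes> y))) \<one> = - lft (r j Y) h a" if "smooth h" for j h
    using lft_rho_dot_one[of j Y "\<lambda>y. h (a \<otimes> y)"] lft_at[OF that, of "r j Y" a] by simp
  \<comment> \<open>As \<open>\<rho> j\<close> vanishes at the unit, only the terms in which
    \<open>Y\<close> differentiates it survive, with \<open>\<rho> i\<close> left undifferentiated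
    at \<open>a\<close>; the signs come from \<open>rL\<close>.\<close>
  have G3: "lft Y G3 \<one> = (\<Sum>i\<in>B. \<Sum>j\<in>B. comp2 B t i j * (lft (r j Y) f a * \<rho> i g a - \<rho> i f a * lft (r j Y) g a))"
    unfolding G3_def
    by (simp add: lft_sum lft_scale lft_minus lft_times smooth_intros sR rho_smooth sL assms rho_one rL
        algebra_simps)
  have "lft Y (\<pi> f g) a = lft Y (\<lambda>b. \<pi> f g (a \<otimes> b)) \<one>"
    by (rule lft_at[OF pi_smooth[OF assms]])
  also have "(\<lambda>b. \<pi> f g (a \<otimes> b)) = (\<lambda>b. G1 b + \<pi> ?f ?g b - 1 / 2 * G3 b)"
    unfolding G1_def G3_def using mult_pi[OF assms, of _ a] by auto
  also have "lft Y \<dots> \<one> = lft Y G1 \<one> + lft Y (\<pi> ?f ?g) \<one> - 1 / 2 * lft Y G3 \<one>"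
    by (simp only: lft_minus lft_plus lft_scale smooth_intros sG1 sG3 pi_smooth sL)
  \<comment> \<open>This is \<open>\<delta> Y\<close> on the differentials at the unit of the left
    translates, which take the values \<open>lft b f a\<close> and \<open>lft c g a\<close> on basis
    vectors.\<close>
  also have "lft Y (\<pi> ?f ?g) \<one> = (\<Sum>b\<in>Bs. \<Sum>c\<in>Bs. lft b f a * lft c g a * \<delta> Y (d (coframe b)) (d (coframe c)))"
    using delta_expand[of Y "d ?f" "d ?g"] unfolding delta_d[OF sL] dual_app_d
    by (simp add: lft_at[OF assms(1), of _ a] lft_at[OF assms(2), of _ a])
  finally show ?thesis unfolding G1 G3 .
qed

text \<open>Here \<open>X\<close> is applied to \<open>lft_pi\<close> at the unit. In the fusion
  term \<open>\<rho> i\<close> vanishes there, so \<open>X\<close> must hit it, and the sign of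
  \<open>lft_rho_dot_one\<close> orders the products as in \<open>wedge (r i X) (r j Y)\<close>. The
  first two terms stay unevaluated because the ad terms produce the same ones.\<close>

lemma lft_lft_pi_one:
  assumes "smooth f" "smooth g"
  shows "lft X (lft Y (\<pi> f g)) \<one> = lft X (\<pi> (lft Y f) g) \<one> + lft X (\<pi> f (lft Y g)) \<one>
    + (\<Sum>b\<in>Bs. \<Sum>c\<in>Bs. (lft X (lft b f) \<one> * lft c g \<one> + lft b f \<one> * lft X (lft c g) \<one>) * \<delta> Y (d (coframe b)) (d (coframe c)))
    - 1 / 2 * (\<Sum>i\<in>B. \<Sum>j\<in>B. comp2 B t i j * wedge (r i X) (r j Y) (d f) (d g))"
proof -
  have s: "smooth (\<lambda>a. \<Sum>b\<in>Bs. \<Sum>c\<in>Bs. lft b f a * lft c g a * \<delta> Y (d (coframe b)) (d (coframe c)))"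
    "smooth (\<lambda>a. \<Sum>i\<in>B. \<Sum>j\<in>B. comp2 B t i j * (lft (r j Y) f a * \<rho> i g a - \<rho> i f a * lft (r j Y) g a))"
    by (intro smooth_intros lft_smooth rho_smooth assms)+
  have "lft X (lft Y (\<pi> f g)) \<one> = lft X (\<pi> (lft Y f) g) \<one> + lft X (\<pi> f (lft Y g)) \<one>
    + lft X (\<lambda>a. \<Sum>b\<in>Bs. \<Sum>c\<in>Bs. lft b f a * lft c g a * \<delta> Y (d (coframe b)) (d (coframe c))) \<one>
    - 1 / 2 * lft X (\<lambda>a. \<Sum>i\<in>B. \<Sum>j\<in>B. comp2 B t i j * (lft (r j Y) f a * \<rho> i g a - \<rho> i f a * lft (r j Y) g a)) \<one>"
    unfolding lft_pi[OF assms, abs_def]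
    by (simp only: lft_minus lft_plus lft_scale smooth_intros s pi_smooth lft_smooth assms)
  also have "lft X (\<lambda>a. \<Sum>b\<in>Bs. \<Sum>c\<in>Bs. lft b f a * lft c g a * \<delta> Y (d (coframe b)) (d (coframe c))) \<one>
    = (\<Sum>b\<in>Bs. \<Sum>c\<in>Bs. (lft X (lft b f) \<one> * lft c g \<one> + lft b f \<one> * lft X (lft c g) \<one>) * \<delta> Y (d (coframe b)) (d (coframe c)))"
    by (simp add: lft_sum lft_times lft_const smooth_intros lft_smooth assms)
  also have "lft X (\<lambda>a. \<Sum>i\<in>B. \<Sum>j\<in>B. comp2 B t i j * (lft (r j Y) f a * \<rho> i g a - \<rho> i f a * lft (r j Y) g a)) \<one>
    = (\<Sum>i\<in>B. \<Sum>j\<in>B. comp2 B t i j * wedge (r i X) (r j Y) (d f) (d g))"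
    by (simp add: lft_sum lft_scale lft_minus lft_times smooth_intros lft_smooth rho_smooth assms rho_one
        wedge_def dual_app_d lft_rho_dot_one[of _ X] algebra_simps)
  finally show ?thesis .
qed

text \<open>On \<open>W\<close>, the pullback of \<open>d f\<close> under \<open>brh X\<close> is
  \<open>X (W f) - W (X f)\<close> at the unit. The second part is the differential of
  \<open>lft X f\<close> and reassembles to a value of \<open>\<delta> Y\<close>; the first stays as
  the double sum that also occurs in \<open>lft_lft_pi_one\<close>.\<close>

lemma tensor_deriv_ad_delta:
  assumes "smooth f" "smooth g"
  shows "tensor_deriv (brh X) (\<delta> Y) (d f) (d g) =
    (\<Sum>b\<in>Bs. \<Sum>c\<in>Bs. (lft X (lft b f) \<one> * lft c g \<one> + lft b f \<one> * lft X (lft c g) \<one>) * \<delta> Y (d (coframe b)) (d (coframe c)))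
    - lft Y (\<pi> (lft X f) g) \<one> - lft Y (\<pi> f (lft X g)) \<one>"
proof -
  have "linear (brh X)"
    using lie_algebra_of_group unfolding lie_algebra_of_group_def lie_algebra_def bilinear_def by blast
  then have "linear (\<lambda>W. dual_app \<alpha> (brh X W))" for \<alpha>
    using linear_compose[OF _ linear_dual_app, of "brh X" \<alpha>] by (simp add: o_def)
  then have pb: "dual_app (pullback (brh X) (d h)) W = lft X (lft W h) \<one> - lft W (lft X h) \<one>" for h W
    unfolding pullback_def by (simp only: dual_app_Dual) (simp add: dual_app_d lft_commutator commutator_def)
  show ?thesis
    unfolding tensor_deriv_def delta_expand[of Y "pullback (brh X) (d f)"] delta_expand[of Y "d f" "pullback (brh X) (d g)"]
      pb delta_d[OF lft_smooth[OF assms(1)] assms(2), symmetric] delta_d[OF assms(1) lft_smooth[OF assms(2)], symmetric]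
      delta_expand[of Y "d (lft X f)"] delta_expand[of Y "d f" "d (lft X g)"] dual_app_d
    by (simp add: sum.distrib[symmetric] sum_subtractf[symmetric] algebra_simps)
qed

text \<open>The double sums and the terms with one argument of \<pi> differentiated cancel between
  the ad terms and the commutator applied to \<open>\<pi> f g\<close>; what remains of them is half
  of \<open>?W X Y - ?W Y X\<close>.\<close>

lemma cocycle:
  "tensor_deriv (brh X) (\<delta> Y) \<alpha> \<beta> - tensor_deriv (brh Y) (\<delta> X) \<alpha> \<beta> - \<delta> (brh X Y) \<alpha> \<beta>
    - (\<Sum>i\<in>B. \<Sum>j\<in>B. comp2 B t i j * wedge (r i X) (r j Y) \<alpha> \<beta>) = 0"
proof -
  obtain f where f: "smooth f" "d f = \<alpha>" by (rule d_surj)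
  obtain g where g: "smooth g" "d g = \<beta>" by (rule d_surj)
  let ?W = "\<lambda>X Y. \<Sum>i\<in>B. \<Sum>j\<in>B. comp2 B t i j * wedge (r i X) (r j Y) (d f) (d g)"
  have comm: "comp2 B t i j = comp2 B t j i" for i j
    using sym_t unfolding sym2_def comp2_def by blast
  \<comment> \<open>Symmetry of \<open>t\<close> exchanges the indices and \<open>wedge\<close> then
    changes sign, so the two halves add up instead of cancelling.\<close>
  have "?W Y X = (\<Sum>i\<in>B. \<Sum>j\<in>B. comp2 B t i j * wedge (r j Y) (r i X) (d f) (d g))"
    by (subst sum.swap) (simp add: comm)
  also have "\<dots> = - ?W X Y"
    by (simp add: sum_negf[symmetric] wedge_def algebra_simps)
  finally have W: "?W Y X = - ?W X Y" .
  have "\<delta> (brh X Y) (d f) (d g) = lft X (lft Y (\<pi> f g)) \<one> - lft Y (lft X (\<pi> f g)) \<one>"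
    by (simp add: delta_d[OF f(1) g(1)] lft_commutator commutator_def)
  then show ?thesis
    unfolding f(2)[symmetric] g(2)[symmetric] tensor_deriv_ad_delta[OF f(1) g(1)] lft_lft_pi_one[OF f(1) g(1)] W
    by simp
qed

lemma quasi_bialgebra: "lie_quasi_bialgebra brg B t brh r \<delta>"
  unfolding lie_quasi_bialgebra_def
  using rho_dot_action cobracket delta_invariant cocycle lie_algebra_of_group
  unfolding lie_algebra_of_group_def by blast

end

text \<open>The first two conjuncts certify that the definite descriptions \<open>rho_dot\<close>
  and \<open>delta_of\<close> denote the intended objects; without them the third could be about
  unspecified values.\<close>

theorem theorem3p1:
  fixes brg :: "'g::real_vector \<Rightarrow> 'g \<Rightarrow> 'g"
    and B :: "'g set"
    and t :: "'g tensor2"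
    and H :: "('m::{t2_space,second_countable_topology}) monoid"
    and A :: "('m, 'e::real_inner) atlas"
    and brh :: "'h::real_vector \<Rightarrow> 'h \<Rightarrow> 'h"
    and lft :: "'h \<Rightarrow> 'm vfield"
    and \<rho> :: "'g \<Rightarrow> 'm vfield"
    and \<pi> :: "'m bivfield"
  assumes "lie_algebra brg" and "is_basis B"
    and "t \<in> sym2" and "invariant2 brg t" and "nondegenerate t"
    and "quasi_poisson_lie_group brg B t H A \<rho> \<pi>"
    and "lie_algebra_of_group H A brh lft"
  shows "(\<forall>u X. lft (rho_dot lft \<rho> u X) = commutator (\<rho> u) (lft X)) \<and>
    (\<forall>X f g. smooth_fun A f \<longrightarrow> smooth_fun A g \<longrightarrow>
       delta_of H A lft \<pi> X (diff_at_one H lft f) (diff_at_one H lft g) = lie_deriv (lft X) \<pi> f g \<one>\<^bsub>H\<^esub> \<and>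
       delta_of H A lft \<pi> X (diff_at_one H lft f) (diff_at_one H lft g) = lft X (\<pi> f g) \<one>\<^bsub>H\<^esub>) \<and>
    lie_quasi_bialgebra brg B t brh (rho_dot lft \<rho>) (delta_of H A lft \<pi>)"
proof -
  interpret quasi_poisson_group H A brh lft brg B t \<rho> \<pi>
    using assms by unfold_locales (auto simp: quasi_poisson_lie_group_def)
  show ?thesis
    using lft_rho_dot delta_d lie_deriv_pi_one quasi_bialgebra unfolding \<delta>_def by simp
qed

end
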